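(* Let $\mathbf{K}$ be an infinite field with a non-trivial non-archimedean valuation and let $m\in\mathbb{N}$. Let $h_0,h_1,\dots,h_m\in C^\infty(\mathbf{K},\mathbf{K})$ be functions such that (1) $h_j(0)=0$ for each $j=0,1,\dots,m$; (2) $\lim_{0\ne y\to0}h_{j-1}(y)/h_j(y)^n=0$ for each $n\in\mathbb{N}$ and $j=1,\dots,m$; (3) $\lim_{0\ne y\to0}h_m(y)/y^n=0$ for every $n\in\mathbb{N}$. Put $h(y)=(h_1(y),\dots,h_m(y))\in\mathbf{K}^m$, and suppose that $g\in C^\infty(\mathbf{K}^m,\mathbf{K})$ is not identically zero and $g(x)=0$ for each $|x|>1$. Define $f:\mathbf{K}^{m+1}\to\mathbf{K}$ by $$f(x,y)=g\big((x-h(y))/h_0(y)\big)\quad\text{for each } y\neq0 \text{ and } x\in\mathbf{K}^m,\qquad f(x,0)=0\quad\text{for each } x\in\mathbf{K}^m.$$ Then $f\circ u\in C^\infty(\mathbf{K}^m,\mathbf{K})$ for each locally analytic function $u:\mathbf{K}^m\to\mathbf{K}^{m+1}$, but $f$ is discontinuous.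
   Context: The valuation $|\cdot|$ on $\mathbf{K}$ is real-valued, multiplicative and satisfies $|x+y|\le\max(|x|,|y|)$; $\mathbf{K}^d$ carries the max norm. A function is locally analytic if near each point of its domain it is given by a convergent power series. Spaces $C^n$. Put $X=\mathbf{K}^d$, $Y=\mathbf{K}^l$. For $n\ge1$ let $X^{(n)}=X^{n+1}\times\mathbf{K}^n$ with points $(x;v_1,\dots,v_n;t_1,\dots,t_n)$. For $f:X\to Y$ put $\Phi^1f(x;v;t)=(f(x+tv)-f(x))/t$ for $t\neq0$ and, for $t_1,\dots,t_{n+1}\ne0$, $$\Phi^{n+1}f(x;v_1,\dots,v_{n+1};t_1,\dots,t_{n+1})=\Phi^1\big(\Phi^nf(\,\cdot\,;v_1,\dots,v_n;t_1,\dots,t_n)\big)(x;v_{n+1};t_{n+1}).$$ $f\in C^n(X,Y)$ if $f$ is continuous and each $\Phi^kf$, $k=1,\dots,n$, has a continuous extension $\bar\Phi^kf$ to $X^{(k)}$. $C^\infty=\bigcap_{n\ge 0}C^n$, where $C^0$ is the space of continuous functions. *)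

theory Defs
  imports
    "HOL-Analysis.Abstract_Metric_Spaces"
    "HOL-Analysis.Product_Topology"
    "HOL-Analysis.Function_Topology"
    "Jordan_Normal_Form.Matrix"
begin

locale nontrivial_nonarch_valuation =
  fixes val :: "'k::field \<Rightarrow> real"
  assumes val_nonneg: "0 \<le> val x"
    and val_eq_0_iff: "val x = 0 \<longleftrightarrow> x = 0"
    and val_mult: "val (x * y) = val x * val y"
    and val_ultrametric: "val (x + y) \<le> max (val x) (val y)"
    and val_nontrivial: "\<exists>x. x \<noteq> 0 \<and> val x \<noteq> 1"

definition field_topology :: "('k::field \<Rightarrow> real) \<Rightarrow> 'k topology" where
  "field_topology val = Metric_space.mtopology UNIV (\<lambda>x y. val (x - y))"

text \<open>
  The space \<open>K\<^sup>d\<close> is \<^term>\<open>carrier_vec d\<close>, with coordinates numbered from 0.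
  Inserting 0 only serves to make the maximum over no coordinates (\<open>d = 0\<close>) equal to 0.
\<close>

definition max_norm :: "('k::field \<Rightarrow> real) \<Rightarrow> 'k vec \<Rightarrow> real" where
  "max_norm val x = Max (insert 0 ((\<lambda>i. val (x $ i)) ` {..<dim_vec x}))"

text \<open>
  On \<^term>\<open>carrier_vec d\<close> this is the max norm of \<^term>\<open>x - y\<close> (lemma \<open>max_dist_eq_max_norm\<close> below).
  It is written coordinatewise because \<^const>\<open>Metric_space\<close> demands symmetry also outside the
  carrier, where \<^term>\<open>x - y\<close> takes the dimension of \<^term>\<open>y\<close>.
\<close>

definition max_dist :: "('k::field \<Rightarrow> real) \<Rightarrow> nat \<Rightarrow> 'k vec \<Rightarrow> 'k vec \<Rightarrow> real" where
  "max_dist val d x y = Max (insert 0 ((\<lambda>i. val (x $ i - y $ i)) ` {..<d}))"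

definition vec_topology :: "('k::field \<Rightarrow> real) \<Rightarrow> nat \<Rightarrow> 'k vec topology" where
  "vec_topology val d = Metric_space.mtopology (carrier_vec d) (max_dist val d)"

lemma max_dist_eq_max_norm:
  assumes "x \<in> carrier_vec d" "y \<in> carrier_vec d"
  shows "max_dist val d x y = max_norm val (x - y)"
  using assms by (auto simp: max_dist_def max_norm_def intro!: arg_cong[where f = Max] image_cong)

context nontrivial_nonarch_valuation
begin

lemma val_0 [simp]: "val 0 = 0"
  by (simp add: val_eq_0_iff)

lemma val_1 [simp]: "val 1 = 1"
  using val_mult[of 1 1] val_eq_0_iff[of 1] by simp

lemma val_minus [simp]: "val (- x) = val x"
proof -
  have "val (-1) * val (-1) = 1"
    using val_mult[of "-1" "-1"] by simp
  then have "val (-1) = 1"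
    using val_nonneg[of "-1"] by (auto simp: square_eq_1_iff)
  then show ?thesis
    using val_mult[of "-1" x] by simp
qed

lemma val_diff_commute: "val (x - y) = val (y - x)"
  using val_minus[of "x - y"] by simp

lemma val_diff_triangle: "val (x - z) \<le> val (x - y) + val (y - z)"
  using val_ultrametric[of "x - y" "y - z"] val_nonneg[of "x - y"] val_nonneg[of "y - z"]
  by (auto simp: max_def split: if_splits)

lemma Metric_space_field: "Metric_space UNIV (\<lambda>x y. val (x - y))"
  by unfold_locales
    (simp_all add: val_nonneg val_diff_triangle val_eq_0_iff, rule val_diff_commute)

lemma max_dist_le_iff: "max_dist val d x y \<le> c \<longleftrightarrow> 0 \<le> c \<and> (\<forall>i<d. val (x $ i - y $ i) \<le> c)"
  by (auto simp: max_dist_def)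

lemma max_dist_ge: "0 \<le> max_dist val d x y" "i < d \<Longrightarrow> val (x $ i - y $ i) \<le> max_dist val d x y"
  using max_dist_le_iff[of d x y "max_dist val d x y"] by auto

lemma Metric_space_vec: "Metric_space (carrier_vec d) (max_dist val d)"
proof
  fix x y z :: "'k vec"
  show "0 \<le> max_dist val d x y"
    by (rule max_dist_ge)
  show "max_dist val d x y = max_dist val d y x"
    unfolding max_dist_def by (subst val_diff_commute) (rule refl)
  show "max_dist val d x y = 0 \<longleftrightarrow> x = y" if "x \<in> carrier_vec d" "y \<in> carrier_vec d"
  proof
    assume "max_dist val d x y = 0"
    then have "val (x $ i - y $ i) = 0" if "i < d" for i
      using max_dist_ge(2)[OF that, of x y] val_nonneg[of "x $ i - y $ i"] by simp
    with that show "x = y"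
      by (intro eq_vecI) (auto simp: val_eq_0_iff)
  next
    assume "x = y"
    then show "max_dist val d x y = 0"
      using max_dist_le_iff[of d x y 0] max_dist_ge(1)[of d x y] by auto
  qed
  show "max_dist val d x z \<le> max_dist val d x y + max_dist val d y z"
    unfolding max_dist_le_iff
  proof (intro conjI allI impI)
    fix i assume "i < d"
    then show "val (x $ i - z $ i) \<le> max_dist val d x y + max_dist val d y z"
      using val_diff_triangle[of "x $ i" "z $ i" "y $ i"]
        max_dist_ge(2)[of i d x y] max_dist_ge(2)[of i d y z] by linarith
  qed (simp add: max_dist_ge)
qed

end

definition Phi1 :: "('k::field vec \<Rightarrow> 'k vec) \<Rightarrow> 'k vec \<Rightarrow> 'k vec \<Rightarrow> 'k \<Rightarrow> 'k vec" where
  "Phi1 f x v t = (1 / t) \<cdot>\<^sub>v (f (x + t \<cdot>\<^sub>v v) - f x)"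

text \<open>
  \<open>Phi n f x v t\<close> is \<open>\<Phi>\<^sup>n f(x; v\<^sub>1,\<dots>,v\<^sub>n; t\<^sub>1,\<dots>,t\<^sub>n)\<close> with \<open>v\<^sub>i\<close> and \<open>t\<^sub>i\<close> stored
  as \<open>v (i - 1)\<close> and \<open>t (i - 1)\<close>. It is meaningful only if \<open>t i \<noteq> 0\<close> for all \<open>i < n\<close>.
\<close>

primrec Phi ::
  "nat \<Rightarrow> ('k::field vec \<Rightarrow> 'k vec) \<Rightarrow> 'k vec \<Rightarrow> (nat \<Rightarrow> 'k vec) \<Rightarrow> (nat \<Rightarrow> 'k) \<Rightarrow> 'k vec" where
  "Phi 0 f x v t = f x"
| "Phi (Suc n) f x v t = Phi1 (\<lambda>x'. Phi n f x' v t) x (v n) (t n)"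

definition Phi_domain ::
  "('k::field \<Rightarrow> real) \<Rightarrow> nat \<Rightarrow> nat \<Rightarrow> ('k vec \<times> (nat \<Rightarrow> 'k vec) \<times> (nat \<Rightarrow> 'k)) topology" where
  "Phi_domain val d n =
     prod_topology (vec_topology val d)
       (prod_topology (product_topology (\<lambda>_. vec_topology val d) {..<n})
         (product_topology (\<lambda>_. field_topology val) {..<n}))"

definition Phi_extends ::
  "('k::field \<Rightarrow> real) \<Rightarrow> nat \<Rightarrow> nat \<Rightarrow> nat \<Rightarrow> ('k vec \<Rightarrow> 'k vec) \<Rightarrow> bool" where
  "Phi_extends val d l n f \<longleftrightarrow>
     (\<exists>F. continuous_map (Phi_domain val d n) (vec_topology val l) F \<and>
       (\<forall>x v t. (x, v, t) \<in> topspace (Phi_domain val d n) \<longrightarrow> (\<forall>i<n. t i \<noteq> 0) \<longrightarrow>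
         F (x, v, t) = Phi n f x v t))"

definition C_n :: "('k::field \<Rightarrow> real) \<Rightarrow> nat \<Rightarrow> nat \<Rightarrow> nat \<Rightarrow> ('k vec \<Rightarrow> 'k vec) set" where
  "C_n val d l n =
     {f. continuous_map (vec_topology val d) (vec_topology val l) f \<and>
         (\<forall>k\<in>{1..n}. Phi_extends val d l k f)}"

definition C_infinity :: "('k::field \<Rightarrow> real) \<Rightarrow> nat \<Rightarrow> nat \<Rightarrow> ('k vec \<Rightarrow> 'k vec) set" where
  "C_infinity val d l = (\<Inter>n. C_n val d l n)"

text \<open>The identification of \<open>K\<close> with \<open>K\<^sup>1\<close>.\<close>

definition vec1 :: "'k \<Rightarrow> 'k vec" where
  "vec1 a = vec 1 (\<lambda>_. a)"

text \<open>
  Multi-indices are the elements of \<^term>\<open>{..<d} \<rightarrow>\<^sub>E (UNIV :: nat set)\<close>; the multiple power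
  series converges as the net of its finite partial sums, coordinate by coordinate.
\<close>

definition locally_analytic ::
  "('k::field \<Rightarrow> real) \<Rightarrow> nat \<Rightarrow> nat \<Rightarrow> ('k vec \<Rightarrow> 'k vec) \<Rightarrow> bool" where
  "locally_analytic val d l u \<longleftrightarrow>
     u \<in> carrier_vec d \<rightarrow> carrier_vec l \<and>
     (\<forall>a\<in>carrier_vec d. \<exists>r>0. \<exists>c :: (nat \<Rightarrow> nat) \<Rightarrow> 'k vec.
        \<forall>x\<in>carrier_vec d. max_norm val (x - a) < r \<longrightarrow>
          (\<forall>i<l. limitin (field_topology val)
             (\<lambda>A. \<Sum>\<alpha>\<in>A. c \<alpha> $ i * (\<Prod>j<d. (x $ j - a $ j) ^ \<alpha> j))
             (u x $ i)
             (finite_subsets_at_top ({..<d} \<rightarrow>\<^sub>E UNIV))))"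

end

theory Submission
  imports Defs "HOL-Library.Function_Algebras" "HOL-Computational_Algebra.Polynomial"
begin

text \<open>
  Write \<open>u = (p, q)\<close> with \<open>q\<close> the last component. Where \<open>q \<noteq> 0\<close>, the function \<open>f \<circ> u\<close> is a composition
  of smooth functions. Near a zero \<open>a\<close> of \<open>q\<close> it vanishes identically: otherwise there are points
  \<open>z\<close> converging to \<open>a\<close> with \<open>q(z) \<noteq> 0\<close> and \<open>|p\<^sub>j(z)| = |h\<^sub>j(q(z))|\<close> for all \<open>j\<close>, so that each of the \<open>m + 1\<close> analytic
  functions \<open>q, p\<^sub>m, \<dots>, p\<^sub>1\<close> of \<open>m\<close> variables is, along these points, smaller than every power of the preceding
  one. The values would generate a value group of rank at least \<open>m + 1\<close>, contradicting an inequality of Abhyankar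
  type. That inequality is proved by induction on \<open>m\<close>: Weierstrass preparation turns the functions into polynomials in
  the last variable, any two polynomials in one variable are algebraically dependent over the coefficients,
  and in the resulting relation two terms have the same value; so passing to one more variable raises the rank by at most one.

  Since \<open>K\<close> need not be complete, analytic functions are represented by sequences of polynomials
  that are Cauchy in a Gauss norm, and only the limits of their values are used. Smoothness is established for
  iterated difference quotients in which every step is nonzero, by showing that limits exist as some of the steps tend to 0.
\<close>

section \<open>Gauss norms of polynomial functions\<close>

text \<open>All values are real numbers, so a value group of higher rank appears only along a whole
  family of points. An ultrafilter on such a family makes vanishing a prime condition and turns a
  choice among finitely many alternatives into a fixed one; logarithms modulo bounded functions then
  reduce rank to real linear algebra. Only absolute values have to survive each reduction: the unit
  of Weierstrass preparation leaves just a constant, and limits in the completion of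
  \<open>K\<close> enter through their values alone. A direction in which several functions are
  regular at once is read off from one point where none of them vanishes. The values of
  \<open>p\<close> are known because the support of \<open>g\<close> keeps \<open>p\<close> within
  \<open>|h_0(q)|\<close> of \<open>h(q)\<close>, and \<open>|h_0(q)|\<close> lies below every
  \<open>|h_j(q)|\<close>. The number of variables is sharp: with \<open>m + 1\<close> of them the
  identity is analytic, and its composition with \<open>f\<close> is the discontinuous
  \<open>f\<close> itself. For smoothness, no mean value theorem recovers difference quotients from
  derivatives. The chain rule is therefore proved for the quotients themselves, and series are
  handled by a Cauchy estimate for quotients of every order.\<close>

lemma power_fun_apply: "((f :: 'a \<Rightarrow> 'b::comm_ring_1) ^ n) x = f x ^ n"
  by (induction n) simp_all

lemma sum_fun_apply: "(\<Sum>i\<in>A. (f i :: 'a \<Rightarrow> 'b::comm_ring_1)) x = (\<Sum>i\<in>A. f i x)"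
  by (induction A rule: infinite_finite_induct) simp_all

text \<open>Coefficients lie in a ring of functions: \<open>poly p (\<lambda>z. z m)\<close> is a
  polynomial in the coordinate \<open>z m\<close> whose coefficients may depend on the other
  coordinates. The bound \<open>n\<close> lets the range of summation exceed the degree, as for
  truncated polynomials.\<close>

lemma poly_fun_apply:
  fixes p :: "('a \<Rightarrow> 'b::comm_ring_1) poly"
  assumes "degree p \<le> n"
  shows "poly p X x = (\<Sum>k\<le>n. coeff p k x * X x ^ k)"
proof -
  have "poly p X = (\<Sum>k\<le>n. coeff p k * X ^ k)"
    unfolding poly_altdef
    by (rule sum.mono_neutral_left) (use assms in \<open>auto simp: coeff_eq_0\<close>)
  then show ?thesis
    by (simp add: sum_fun_apply power_fun_apply)
qed

section \<open>Ultrametric arithmetic and the Gauss norm\<close>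

context nontrivial_nonarch_valuation
begin

lemma val_diff_ultrametric: "val (x - y) \<le> max (val x) (val y)"
  using val_ultrametric[of x "- y"] by simp

lemma val_sum_le:
  assumes "0 \<le> C" "\<And>i. i \<in> A \<Longrightarrow> val (f i) \<le> C"
  shows "val (sum f A) \<le> C"
  using assms(2)
proof (induction A rule: infinite_finite_induct)
  case (insert x F)
  then show ?case
    using val_ultrametric[of "f x" "sum f F"] by fastforce
qed (use assms in auto)

lemma val_power: "val (x ^ n) = val x ^ n"
  by (induction n) (auto simp: val_mult)

lemma val_inverse: "val (inverse x) = inverse (val x)"
proof (cases "x = 0")
  case False
  then have "val x * val (inverse x) = 1"
    by (simp flip: val_mult)
  then show ?thesis
    using False val_eq_0_iff[of x] by (simp add: field_simps)
qed simp

lemma val_divide: "val (x / y) = val x / val y"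
  by (simp add: divide_inverse val_mult val_inverse)

text \<open>Every ultrametric triangle is isosceles: the strictly larger summand decides the
  value.\<close>

lemma val_add_eq: "val y < val x \<Longrightarrow> val (x + y) = val x"
  using val_ultrametric[of x y] val_diff_ultrametric[of "x + y" y] by auto

lemma val_eq_of_diff_less: "val (x - y) < val y \<Longrightarrow> val x = val y"
  using val_add_eq[of "x - y" y] by simp

lemma val_pos_iff: "0 < val x \<longleftrightarrow> x \<noteq> 0"
  using val_nonneg[of x] val_eq_0_iff[of x] by linarith

text \<open>Some element or its inverse has value strictly between 0 and 1, and its powers tend to
  0. This is where non-triviality of the valuation enters.\<close>

lemma obtain_small:
  assumes "0 < r"
  obtains c where "c \<noteq> 0" "val c < r"
proof -
  obtain x where x: "x \<noteq> 0" "val x \<noteq> 1"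
    using val_nontrivial by blast
  define y where "y = (if val x < 1 then x else inverse x)"
  have y: "y \<noteq> 0" "val y < 1"
    using x by (auto simp: y_def val_inverse inverse_less_1_iff)
  obtain n where "val y ^ n < r"
    using real_arch_pow_inv[OF assms y(2)] by blast
  then show ?thesis
    using that[of "y ^ n"] y by (simp add: val_power)
qed

text \<open>
  \<open>gauss_le \<rho> m C \<phi>\<close>: \<open>\<phi>\<close> is a polynomial function of the coordinates below \<open>m\<close> whose Gauss norm for
  the radii \<open>\<rho>\<close> is at most \<open>C\<close>. The coefficients are quantified existentially; their uniqueness is never needed.
\<close>

primrec gauss_le :: "(nat \<Rightarrow> real) \<Rightarrow> nat \<Rightarrow> real \<Rightarrow> ((nat \<Rightarrow> 'k) \<Rightarrow> 'k) \<Rightarrow> bool" where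
  "gauss_le \<rho> 0 C \<phi> \<longleftrightarrow> (\<exists>c. \<phi> = (\<lambda>_. c) \<and> val c \<le> C)"
| "gauss_le \<rho> (Suc m) C \<phi> \<longleftrightarrow>
     (\<exists>p. \<phi> = poly p (\<lambda>z. z m) \<and> (\<forall>k. gauss_le \<rho> m (C / \<rho> m ^ k) (coeff p k)))"

text \<open>The same bound attached to a chosen representing polynomial. Weierstrass division
  manipulates individual coefficients, whereas \<open>gauss_le\<close> only asserts that some
  suitable polynomial exists.\<close>

definition gauss_poly_le :: "(nat \<Rightarrow> real) \<Rightarrow> nat \<Rightarrow> real \<Rightarrow> ((nat \<Rightarrow> 'k) \<Rightarrow> 'k) poly \<Rightarrow> bool" where
  "gauss_poly_le \<rho> m C p \<longleftrightarrow> (\<forall>k. gauss_le \<rho> m (C / \<rho> m ^ k) (coeff p k))"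

lemma gauss_le_nonneg: "gauss_le \<rho> m C \<phi> \<Longrightarrow> 0 \<le> C"
proof (induction m arbitrary: C \<phi>)
  case 0
  then show ?case
    using val_nonneg order_trans by fastforce
next
  case (Suc m)
  then obtain p where "\<forall>k. gauss_le \<rho> m (C / \<rho> m ^ k) (coeff p k)"
    by auto
  then have "gauss_le \<rho> m (C / \<rho> m ^ 0) (coeff p 0)"
    by blast
  then show ?case
    using Suc.IH by fastforce
qed

lemma gauss_le_mono:
  assumes "\<And>i. i < m \<Longrightarrow> 0 < \<rho>' i" "\<And>i. i < m \<Longrightarrow> \<rho>' i \<le> \<rho> i" "C \<le> C'" "gauss_le \<rho> m C \<phi>"
  shows "gauss_le \<rho>' m C' \<phi>"
  using assms
proof (induction m arbitrary: C C' \<phi>)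
  case 0
  then show ?case by force
next
  case (Suc m)
  then obtain p where p: "\<phi> = poly p (\<lambda>z. z m)" "\<And>k. gauss_le \<rho> m (C / \<rho> m ^ k) (coeff p k)"
    by auto
  have "C / \<rho> m ^ k \<le> C' / \<rho>' m ^ k" for k
  proof (rule frac_le)
    show "0 \<le> C'"
      using gauss_le_nonneg[OF Suc.prems(4)] Suc.prems(3) by linarith
    show "\<rho>' m ^ k \<le> \<rho> m ^ k"
      using Suc.prems(1,2)[of m] by (intro power_mono) auto
  qed (use Suc.prems in auto)
  then have "gauss_le \<rho>' m (C' / \<rho>' m ^ k) (coeff p k)" for k
    using Suc.IH[OF _ _ _ p(2)[of k]] Suc.prems by auto
  with p(1) show ?case by auto
qed


section \<open>Calculus of Gauss norms for fixed positive radii\<close>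

context
  fixes \<rho> :: "nat \<Rightarrow> real"
  assumes radii_pos: "\<And>i. 0 < \<rho> i"
begin

lemma gauss_le_mono_bound: "gauss_le \<rho> m C \<phi> \<Longrightarrow> C \<le> C' \<Longrightarrow> gauss_le \<rho> m C' \<phi>"
  by (rule gauss_le_mono[of m \<rho> \<rho>]) (auto simp: radii_pos)

lemma gauss_le_SucI: "gauss_poly_le \<rho> m C p \<Longrightarrow> gauss_le \<rho> (Suc m) C (poly p (\<lambda>z. z m))"
  by (auto simp: gauss_poly_le_def)

lemma gauss_le_SucE:
  assumes "gauss_le \<rho> (Suc m) C \<phi>"
  obtains p where "gauss_poly_le \<rho> m C p" "\<phi> = poly p (\<lambda>z. z m)"
  using assms by (auto simp: gauss_poly_le_def)

lemma gauss_le_0: "0 \<le> C \<Longrightarrow> gauss_le \<rho> m C 0"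
proof (induction m arbitrary: C)
  case 0
  then show ?case by (auto intro!: exI[of _ 0] simp: zero_fun_def)
next
  case (Suc m)
  then show ?case
    using radii_pos[of m] by (auto intro!: exI[of _ 0] Suc.IH)
qed

lemma gauss_le_add: "gauss_le \<rho> m C \<phi> \<Longrightarrow> gauss_le \<rho> m C \<psi> \<Longrightarrow> gauss_le \<rho> m C (\<phi> + \<psi>)"
proof (induction m arbitrary: C \<phi> \<psi>)
  case 0
  then obtain a b where "\<phi> = (\<lambda>_. a)" "val a \<le> C" "\<psi> = (\<lambda>_. b)" "val b \<le> C"
    by auto
  then show ?case
    using val_ultrametric[of a b] by (auto intro!: exI[of _ "a + b"])
next
  case (Suc m)
  then obtain p q where "\<phi> = poly p (\<lambda>z. z m)" "\<psi> = poly q (\<lambda>z. z m)"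
    "\<And>k. gauss_le \<rho> m (C / \<rho> m ^ k) (coeff p k)" "\<And>k. gauss_le \<rho> m (C / \<rho> m ^ k) (coeff q k)"
    by auto
  then show ?case
    by (auto intro!: exI[of _ "p + q"] Suc.IH)
qed

lemma gauss_le_uminus: "gauss_le \<rho> m C \<phi> \<Longrightarrow> gauss_le \<rho> m C (- \<phi>)"
proof (induction m arbitrary: C \<phi>)
  case 0
  then obtain a where "\<phi> = (\<lambda>_. a)" "val a \<le> C"
    by auto
  then show ?case
    by (auto intro!: exI[of _ "- a"])
next
  case (Suc m)
  then obtain p where "\<phi> = poly p (\<lambda>z. z m)" "\<And>k. gauss_le \<rho> m (C / \<rho> m ^ k) (coeff p k)"
    by auto
  then show ?case
    by (auto intro!: exI[of _ "- p"] Suc.IH)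
qed

lemma gauss_le_sum:
  assumes "0 \<le> C" "\<And>i. i \<in> A \<Longrightarrow> gauss_le \<rho> m C (f i)"
  shows "gauss_le \<rho> m C (sum f A)"
  using assms(2)
  by (induction A rule: infinite_finite_induct) (simp_all add: assms gauss_le_0 gauss_le_add)

lemma gauss_le_mult:
  "gauss_le \<rho> m C \<phi> \<Longrightarrow> gauss_le \<rho> m D \<psi> \<Longrightarrow> gauss_le \<rho> m (C * D) (\<phi> * \<psi>)"
proof (induction m arbitrary: C D \<phi> \<psi>)
  case 0
  then obtain a b where "\<phi> = (\<lambda>_. a)" "val a \<le> C" "\<psi> = (\<lambda>_. b)" "val b \<le> D"
    by auto
  moreover have "val a * val b \<le> C * D" if "val a \<le> C" "val b \<le> D" for a b
    using that val_nonneg[of a] val_nonneg[of b] by (intro mult_mono) auto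
  ultimately show ?case
    by (auto intro!: exI[of _ "a * b"] simp: val_mult)
next
  case (Suc m)
  then obtain p q where pq: "\<phi> = poly p (\<lambda>z. z m)" "\<psi> = poly q (\<lambda>z. z m)"
    "\<And>k. gauss_le \<rho> m (C / \<rho> m ^ k) (coeff p k)" "\<And>k. gauss_le \<rho> m (D / \<rho> m ^ k) (coeff q k)"
    by auto
  have "gauss_le \<rho> m (C * D / \<rho> m ^ k) (coeff (p * q) k)" for k
    unfolding coeff_mult
  proof (rule gauss_le_sum)
    show "0 \<le> C * D / \<rho> m ^ k"
      using gauss_le_nonneg[OF Suc.prems(1)] gauss_le_nonneg[OF Suc.prems(2)] radii_pos[of m] by simp
    fix i assume "i \<in> {..k}"
    then have "C / \<rho> m ^ i * (D / \<rho> m ^ (k - i)) = C * D / \<rho> m ^ k"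
      by (simp flip: power_add)
    then show "gauss_le \<rho> m (C * D / \<rho> m ^ k) (coeff p i * coeff q (k - i))"
      using Suc.IH[OF pq(3)[of i] pq(4)[of "k - i"]] by metis
  qed
  then show ?case
    by (auto intro!: exI[of _ "p * q"] simp: pq)
qed

lemma gauss_le_const: "val c \<le> C \<Longrightarrow> gauss_le \<rho> m C (\<lambda>_. c)"
proof (induction m arbitrary: C)
  case (Suc m)
  have "0 \<le> C"
    using Suc.prems val_nonneg[of c] by linarith
  then have "gauss_le \<rho> m (C / \<rho> m ^ k) (coeff [:\<lambda>_. c:] k)" for k
    using Suc.IH[OF Suc.prems] radii_pos[of m]
    by (auto simp: coeff_pCons gauss_le_0 split: nat.splits)
  then show ?case
    by (auto intro!: exI[of _ "[:\<lambda>_. c:]"])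
qed auto

lemma gauss_le_var: "i < m \<Longrightarrow> gauss_le \<rho> m (\<rho> i) (\<lambda>z. z i)"
proof (induction m)
  case (Suc m)
  show ?case
  proof (cases "i = m")
    case True
    have "gauss_le \<rho> m (\<rho> m / \<rho> m ^ k) (coeff [:0, 1:] k)" for k
      using radii_pos[of m] gauss_le_const[of 1 1 m]
      by (auto simp: coeff_pCons gauss_le_0 one_fun_def split: nat.splits)
    then show ?thesis
      using True by (auto intro!: exI[of _ "[:0, 1:]"])
  next
    case False
    then have "gauss_le \<rho> m (\<rho> i / \<rho> m ^ k) (coeff [:\<lambda>z. z i:] k)" for k
      using Suc radii_pos[of m] radii_pos[of i]
      by (auto simp: coeff_pCons gauss_le_0 split: nat.splits)
    then show ?thesis
      by (auto intro!: exI[of _ "[:\<lambda>z. z i:]"])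
  qed
qed simp

lemma gauss_le_power: "gauss_le \<rho> m C \<phi> \<Longrightarrow> gauss_le \<rho> m (C ^ n) (\<phi> ^ n)"
proof (induction n)
  case 0
  then show ?case
    using gauss_le_const[of 1 1 m] by (simp add: one_fun_def)
qed (simp add: gauss_le_mult)

lemma gauss_le_cmult: "gauss_le \<rho> m C \<phi> \<Longrightarrow> gauss_le \<rho> m (val c * C) (\<lambda>z. c * \<phi> z)"
  using gauss_le_mult[OF gauss_le_const[OF order_refl], of m C \<phi> c] by (simp add: times_fun_def)

lemma gauss_poly_le_nonneg: "gauss_poly_le \<rho> m C p \<Longrightarrow> 0 \<le> C"
  unfolding gauss_poly_le_def
  using gauss_le_nonneg[of \<rho> m "C / \<rho> m ^ 0" "coeff p 0"] by (metis div_by_1 power_0)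

lemma gauss_poly_le_add:
  "gauss_poly_le \<rho> m C p \<Longrightarrow> gauss_poly_le \<rho> m C q \<Longrightarrow> gauss_poly_le \<rho> m C (p + q)"
  by (auto simp: gauss_poly_le_def gauss_le_add)

lemma gauss_poly_le_uminus: "gauss_poly_le \<rho> m C p \<Longrightarrow> gauss_poly_le \<rho> m C (- p)"
  by (auto simp: gauss_poly_le_def gauss_le_uminus)

lemma gauss_poly_le_0: "0 \<le> C \<Longrightarrow> gauss_poly_le \<rho> m C 0"
  using radii_pos[of m] by (auto simp: gauss_poly_le_def intro!: gauss_le_0)

lemma gauss_poly_le_sum:
  assumes "0 \<le> C" "\<And>i. i \<in> A \<Longrightarrow> gauss_poly_le \<rho> m C (f i)"
  shows "gauss_poly_le \<rho> m C (sum f A)"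
  using assms(2)
  by (induction A rule: infinite_finite_induct) (simp_all add: assms gauss_poly_le_0 gauss_poly_le_add)

lemma gauss_poly_le_mono: "gauss_poly_le \<rho> m C p \<Longrightarrow> C \<le> C' \<Longrightarrow> gauss_poly_le \<rho> m C' p"
  unfolding gauss_poly_le_def
  using radii_pos[of m] by (meson divide_right_mono gauss_le_mono_bound less_imp_le zero_less_power)

lemma gauss_poly_le_mult:
  assumes "gauss_poly_le \<rho> m C p" "gauss_poly_le \<rho> m D q"
  shows "gauss_poly_le \<rho> m (C * D) (p * q)"
  unfolding gauss_poly_le_def coeff_mult
proof (intro allI gauss_le_sum)
  show "0 \<le> C * D / \<rho> m ^ k" for k
    using gauss_poly_le_nonneg[OF assms(1)] gauss_poly_le_nonneg[OF assms(2)] radii_pos[of m] by simp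
  fix k i :: nat assume "i \<in> {..k}"
  then have "C / \<rho> m ^ i * (D / \<rho> m ^ (k - i)) = C * D / \<rho> m ^ k"
    by (simp flip: power_add)
  then show "gauss_le \<rho> m (C * D / \<rho> m ^ k) (coeff p i * coeff q (k - i))"
    using gauss_le_mult[of m "C / \<rho> m ^ i" "coeff p i" "D / \<rho> m ^ (k - i)"] assms
    unfolding gauss_poly_le_def by metis
qed

text \<open>Coefficient \<open>k + d\<close> becomes coefficient \<open>k\<close>, so forming the
  quotient by the \<open>d\<close>-th power of the variable gains the factor
  \<open>\<rho> m ^ d\<close> in the Gauss norm.\<close>

lemma gauss_poly_le_shift:
  assumes "gauss_poly_le \<rho> m (C * \<rho> m ^ d) p"
  shows "gauss_poly_le \<rho> m C (poly_shift d p)"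
  unfolding gauss_poly_le_def
proof
  fix k
  have "gauss_le \<rho> m (C * \<rho> m ^ d / \<rho> m ^ (k + d)) (coeff p (k + d))"
    using assms by (auto simp: gauss_poly_le_def)
  then show "gauss_le \<rho> m (C / \<rho> m ^ k) (coeff (poly_shift d p) k)"
    using radii_pos[of m] by (simp add: coeff_poly_shift power_add)
qed

text \<open>On the closed polydisc each monomial is bounded by its Gauss weight, and the ultrametric
  inequality passes this on to the sum.\<close>

lemma gauss_le_bound:
  assumes "gauss_le \<rho> m C \<phi>" "\<And>i. i < m \<Longrightarrow> val (z i) \<le> \<rho> i"
  shows "val (\<phi> z) \<le> C"
  using assms
proof (induction m arbitrary: C \<phi>)
  case 0
  then show ?case by auto
next
  case (Suc m)
  then obtain p where p: "\<phi> = poly p (\<lambda>z. z m)" "\<And>k. gauss_le \<rho> m (C / \<rho> m ^ k) (coeff p k)"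
    by auto
  have "val (coeff p k z * z m ^ k) \<le> C" for k
  proof -
    have *: "val (coeff p k z) \<le> C / \<rho> m ^ k"
      by (rule Suc.IH[OF p(2)]) (use Suc.prems in auto)
    have "val (coeff p k z) * val (z m) ^ k \<le> (C / \<rho> m ^ k) * \<rho> m ^ k"
      using Suc.prems(2)[of m] val_nonneg order_trans[OF val_nonneg *]
      by (intro mult_mono * power_mono) auto
    then show ?thesis
      using radii_pos[of m] by (simp add: val_mult val_power)
  qed
  then show ?case
    using gauss_le_nonneg[OF Suc.prems(1)] by (simp add: p(1) poly_fun_apply[OF order_refl] val_sum_le)
qed

lemma gauss_poly_le_bound:
  assumes "gauss_poly_le \<rho> m C p" "\<And>i. i \<le> m \<Longrightarrow> val (z i) \<le> \<rho> i"
  shows "val (poly p (\<lambda>z. z m) z) \<le> C"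
  using gauss_le_bound[OF gauss_le_SucI[OF assms(1)]] assms(2) by auto

end

section \<open>Dependence on coordinates, substitution, smaller radii\<close>

lemma gauss_le_cong_point:
  "gauss_le \<rho> m C \<phi> \<Longrightarrow> (\<And>i. i < m \<Longrightarrow> z i = z' i) \<Longrightarrow> \<phi> z = \<phi> z'"
proof (induction m arbitrary: C \<phi>)
  case (Suc m)
  then obtain p where p: "\<phi> = poly p (\<lambda>z. z m)" "\<And>k. gauss_le \<rho> m (C / \<rho> m ^ k) (coeff p k)"
    by auto
  have "coeff p k z = coeff p k z'" for k
    using Suc.IH[OF p(2)] Suc.prems by auto
  then show ?case
    by (simp add: p(1) poly_fun_apply[OF order_refl] Suc.prems)
qed auto

text \<open>Substituting functions whose norms do not exceed the corresponding radii keeps every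
  term within \<open>C\<close>. The case of interest is a linear change of coordinates.\<close>

lemma gauss_le_compose:
  assumes \<rho>: "\<And>i. 0 < \<rho> i" and \<rho>': "\<And>i. 0 < \<rho>' i"
    and "gauss_le \<rho> m C \<phi>" "\<And>i. i < m \<Longrightarrow> gauss_le \<rho>' m' (\<rho> i) (\<lambda>z. \<psi> z i)"
  shows "gauss_le \<rho>' m' C (\<lambda>z. \<phi> (\<psi> z))"
  using assms(3,4)
proof (induction m arbitrary: C \<phi>)
  case 0
  then show ?case by (auto intro!: gauss_le_const \<rho>')
next
  case (Suc m)
  then obtain p where p: "\<phi> = poly p (\<lambda>z. z m)" "\<And>k. gauss_le \<rho> m (C / \<rho> m ^ k) (coeff p k)"
    by auto
  have "gauss_le \<rho>' m' C ((\<lambda>z. coeff p k (\<psi> z)) * (\<lambda>z. \<psi> z m) ^ k)" for k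
    using gauss_le_mult[OF \<rho>' Suc.IH[OF p(2)] gauss_le_power[OF \<rho>' Suc.prems(2)[of m]], of k k]
      Suc.prems \<rho>[of m] by (simp split: if_splits)
  then have "gauss_le \<rho>' m' C (\<Sum>k\<le>degree p. (\<lambda>z. coeff p k (\<psi> z)) * (\<lambda>z. \<psi> z m) ^ k)"
    by (intro gauss_le_sum \<rho>' gauss_le_nonneg[OF Suc.prems(1)])
  moreover have "(\<Sum>k\<le>degree p. (\<lambda>z. coeff p k (\<psi> z)) * (\<lambda>z. \<psi> z m) ^ k) = (\<lambda>z. \<phi> (\<psi> z))"
    by (auto simp: fun_eq_iff sum_fun_apply power_fun_apply p(1) poly_fun_apply[OF order_refl])
  ultimately show ?case by simp
qed

text \<open>When the radii shrink, a nonconstant monomial gains at least one factor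
  \<open>\<rho>' i / \<rho> i \<le> \<theta>\<close>, and its other factors gain too. On a small
  polydisc a polynomial is therefore close to its value at the origin.\<close>

lemma gauss_le_diff_origin:
  assumes "\<And>i. 0 < \<rho>' i" "\<And>i. \<rho>' i \<le> \<theta> * \<rho> i" "\<And>i. 0 < \<rho> i" "\<theta> \<le> 1"
    and "gauss_le \<rho> m C \<phi>"
  shows "gauss_le \<rho>' m (\<theta> * C) (\<lambda>z. \<phi> z - \<phi> (\<lambda>_. 0))"
  using assms(5)
proof (induction m arbitrary: C \<phi>)
  case 0
  have "0 < \<theta>"
    using assms(1)[of 0] assms(2)[of 0] assms(3)[of 0] by (metis less_le_trans zero_less_mult_pos2)
  then show ?case
    using 0 gauss_le_nonneg[OF 0] by (auto intro!: exI[of _ 0])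
next
  case (Suc m)
  then obtain p where p: "\<phi> = poly p (\<lambda>z. z m)" "\<And>k. gauss_le \<rho> m (C / \<rho> m ^ k) (coeff p k)"
    by auto
  \<comment> \<open>In the last variable only the coefficient of degree 0 still has a constant part;
    the induction hypothesis treats it, and the higher coefficients are kept.\<close>
  define q where "q = pCons (\<lambda>z. coeff p 0 z - coeff p 0 (\<lambda>_. 0)) (poly_shift 1 p)"
  have \<theta>: "0 < \<theta>"
    using assms(1)[of 0] assms(2)[of 0] assms(3)[of 0] by (metis less_le_trans zero_less_mult_pos2)
  have C: "0 \<le> C"
    using gauss_le_nonneg[OF Suc.prems] .
  have \<rho>'\<rho>: "\<rho>' i \<le> \<rho> i" for i
    using assms(2)[of i] assms(4) assms(3)[of i] mult_right_mono[of \<theta> 1 "\<rho> i"] by linarith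
  have "gauss_le \<rho>' m (\<theta> * C / \<rho>' m ^ k) (coeff q k)" for k
  proof (cases k)
    case 0
    then show ?thesis
      using Suc.IH[OF p(2)[of 0]] by (simp add: q_def)
  next
    case (Suc j)
    have "\<rho>' m * \<rho>' m ^ j \<le> (\<theta> * \<rho> m) * \<rho> m ^ j"
      using assms \<rho>'\<rho> \<theta> by (intro mult_mono power_mono) (auto intro: less_imp_le)
    then have "C / \<rho> m ^ k \<le> \<theta> * C / \<rho>' m ^ k"
      using assms(1)[of m] assms(3)[of m] C Suc mult_left_mono[of "\<rho>' m ^ k" "\<theta> * \<rho> m ^ k" C]
      by (simp add: field_simps)
    then show ?thesis
      using Suc gauss_le_mono[of m \<rho>' \<rho>, OF _ _ _ p(2)[of k]] assms(1) \<rho>'\<rho>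
      by (auto simp: q_def coeff_poly_shift)
  qed
  moreover have "(\<lambda>z. \<phi> z - \<phi> (\<lambda>_. 0)) = poly q (\<lambda>z. z m)"
  proof
    fix z
    have "p = pCons (coeff p 0) (poly_shift 1 p)"
      by (simp add: poly_eq_iff coeff_pCons coeff_poly_shift split: nat.splits)
    then have "poly p (\<lambda>z. z m) = coeff p 0 + (\<lambda>z. z m) * poly (poly_shift 1 p) (\<lambda>z. z m)"
      by (metis poly_pCons)
    then show "\<phi> z - \<phi> (\<lambda>_. 0) = poly q (\<lambda>z. z m) z"
      by (simp add: p(1) q_def)
  qed
  ultimately show ?case by auto
qed

end

section \<open>Linear systems modulo a prime ideal, ultrafilters, Cauchy sequences\<close>

text \<open>Gaussian elimination without division over the integral domain \<open>A / N\<close>: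
  fewer equations than unknowns leave a nontrivial solution. Working with sets \<open>A\<close> and
  \<open>N\<close> instead of a quotient type lets the same lemma serve the ring of Cauchy sequences
  and, with \<open>N = {0}\<close>, the reals.\<close>

lemma homogeneous_system_mod_prime:
  fixes A N :: "'a::comm_ring_1 set" and M :: "nat \<Rightarrow> 'j \<Rightarrow> 'a"
  assumes A: "1 \<in> A" "\<And>a b. a \<in> A \<Longrightarrow> b \<in> A \<Longrightarrow> a + b \<in> A"
      "\<And>a b. a \<in> A \<Longrightarrow> b \<in> A \<Longrightarrow> a * b \<in> A" "\<And>a. a \<in> A \<Longrightarrow> - a \<in> A"
    and N: "0 \<in> N" "1 \<notin> N" "\<And>a b. a \<in> N \<Longrightarrow> b \<in> N \<Longrightarrow> a + b \<in> N"
      "\<And>a b. a \<in> N \<Longrightarrow> b \<in> A \<Longrightarrow> a * b \<in> N"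
      "\<And>a b. a \<in> A \<Longrightarrow> b \<in> A \<Longrightarrow> a * b \<in> N \<Longrightarrow> a \<in> N \<or> b \<in> N"
    and J: "finite J" "e < card J"
    and M: "\<And>i j. i < e \<Longrightarrow> j \<in> J \<Longrightarrow> M i j \<in> A"
  shows "\<exists>x. (\<forall>j\<in>J. x j \<in> A) \<and> (\<exists>j\<in>J. x j \<notin> N) \<and> (\<forall>i<e. (\<Sum>j\<in>J. M i j * x j) \<in> N)"
  using J M
proof (induction e arbitrary: J M)
  case 0
  then have "J \<noteq> {}"
    by auto
  then show ?case
    using A(1) N(2) by (intro exI[of _ "\<lambda>_. 1"]) auto
next
  case (Suc e)
  have zero: "0 \<in> A"
    using A(1) A(2)[of 1 "-1"] A(4)[of 1] by simp
  have A_sum: "(\<Sum>j\<in>I. f j) \<in> A" if "\<And>j. j \<in> I \<Longrightarrow> f j \<in> A" for I :: "'j set" and f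
    using that by (induction I rule: infinite_finite_induct) (auto simp: zero A(2))
  have N_sum: "(\<Sum>j\<in>I. f j) \<in> N" if "\<And>j. j \<in> I \<Longrightarrow> f j \<in> N" for I :: "'j set" and f
    using that by (induction I rule: infinite_finite_induct) (auto simp: N(1,3))
  show ?case
  proof (cases "\<forall>j\<in>J. M e j \<in> N")
    case True
    obtain x where x: "\<forall>j\<in>J. x j \<in> A" "\<exists>j\<in>J. x j \<notin> N" "\<forall>i<e. (\<Sum>j\<in>J. M i j * x j) \<in> N"
      using Suc.IH[of J M] Suc.prems by auto
    moreover have "(\<Sum>j\<in>J. M e j * x j) \<in> N"
      using True x(1) by (intro N_sum N(4)) auto
    ultimately show ?thesis
      by (intro exI[of _ x]) (auto simp: less_Suc_eq)
  next
    case False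
    then obtain k where k: "k \<in> J" "M e k \<notin> N"
      by blast
    define c where "c = M e k"
    define I where "I = J - {k}"
    have c: "c \<in> A" "c \<notin> N"
      using k Suc.prems(3)[of e k] by (auto simp: c_def)
    have I: "finite I" "e < card I" "k \<notin> I" "J = insert k I"
      using Suc.prems k by (auto simp: I_def)
    \<comment> \<open>\<open>M i k\<close> times row \<open>e\<close> is subtracted from
      \<open>c\<close> times row \<open>i\<close>, which eliminates the unknown
      \<open>k\<close>.\<close>
    define M' where "M' = (\<lambda>i j. c * M i j + - (M i k * M e j))"
    have "M' i j \<in> A" if "i < e" "j \<in> I" for i j
      unfolding M'_def using that I(4) c Suc.prems(3) by (intro A(2) A(3) A(4)) auto
    then obtain y where y: "\<forall>j\<in>I. y j \<in> A" "\<exists>j\<in>I. y j \<notin> N" "\<forall>i<e. (\<Sum>j\<in>I. M' i j * y j) \<in> N"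
      using Suc.IH[of I M'] I by auto
    \<comment> \<open>The other unknowns are scaled by the pivot \<open>c\<close>, so that row
      \<open>e\<close> is solved for the unknown \<open>k\<close> without inverting
      \<open>c\<close>; primality keeps some \<open>c * y j\<close> outside
      \<open>N\<close>.\<close>
    define x where "x = (\<lambda>j. if j = k then - (\<Sum>j\<in>I. M e j * y j) else c * y j)"
    have row: "(\<Sum>j\<in>J. M i j * x j) =
        (\<Sum>j\<in>I. M i j * (c * y j)) - M i k * (\<Sum>j\<in>I. M e j * y j)" for i
    proof -
      have "(\<Sum>j\<in>I. M i j * x j) = (\<Sum>j\<in>I. M i j * (c * y j))"
        by (rule sum.cong) (use I in \<open>auto simp: x_def\<close>)
      then show ?thesis
        using I by (simp add: x_def)
    qed
    have "(\<Sum>j\<in>J. M i j * x j) = (\<Sum>j\<in>I. M' i j * y j)" for i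
      unfolding row M'_def sum_distrib_left sum_subtractf[symmetric]
      by (rule sum.cong) (auto simp: algebra_simps)
    then have "(\<Sum>j\<in>J. M i j * x j) \<in> N" if "i < e" for i
      using y that by simp
    moreover have "(\<Sum>j\<in>J. M e j * x j) = 0"
      unfolding row sum_distrib_left c_def[symmetric] by (simp add: mult.left_commute)
    moreover have "x j \<in> A" if "j \<in> J" for j
      unfolding x_def using that y I c Suc.prems(3) by (auto intro!: A_sum A(3) A(4))
    moreover have "\<exists>j\<in>J. x j \<notin> N"
      using y I c N(5) unfolding x_def by (metis insertCI)
    ultimately show ?thesis
      using N(1) by (intro exI[of _ x]) (auto simp: less_Suc_eq)
  qed
qed

section \<open>Ultrafilters\<close>

definition ultrafilter :: "'a filter \<Rightarrow> bool" where
  "ultrafilter U \<longleftrightarrow> U \<noteq> bot \<and> (\<forall>P. eventually P U \<or> eventually (\<lambda>x. \<not> P x) U)"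

text \<open>Zorn's lemma for the proper filters below \<open>F\<close>: the infimum of a chain stays
  proper, since what holds eventually along it holds eventually along some member. Intersecting a
  minimal filter with \<open>{x. P x}\<close> gives either \<open>bot\<close> or the same filter, so
  \<open>P\<close> is decided.\<close>

lemma ultrafilter_exists:
  assumes "F \<noteq> bot"
  obtains U where "U \<le> F" "ultrafilter U"
proof -
  define \<S> where "\<S> = {G. G \<le> F \<and> G \<noteq> bot}"
  have "\<exists>m\<in>\<S>. \<forall>a\<in>\<S>. a \<le> m \<longrightarrow> a = m"
  proof (rule predicate_Zorn)
    show "partial_order_on \<S> (relation_of (\<lambda>G H. H \<le> G) \<S>)"
      by (rule partial_order_on_relation_ofI) auto
    fix \<C> assume C: "\<C> \<in> Chains (relation_of (\<lambda>G H. H \<le> G) \<S>)"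
    then have sub: "\<C> \<subseteq> \<S>"
      by (auto simp: Chains_def relation_of_def)
    show "\<exists>u\<in>\<S>. \<forall>a\<in>\<C>. u \<le> a"
    proof (cases "\<C> = {}")
      case True
      then show ?thesis
        using assms by (auto simp: \<S>_def)
    next
      case False
      have "eventually P (Inf \<C>) \<longleftrightarrow> (\<exists>b\<in>\<C>. eventually P b)" for P
      proof (rule eventually_Inf_base[OF False])
        fix G H assume "G \<in> \<C>" "H \<in> \<C>"
        then have "G \<le> H \<or> H \<le> G"
          using C by (auto simp: Chains_def relation_of_def)
        then show "\<exists>x\<in>\<C>. x \<le> inf G H"
          using \<open>G \<in> \<C>\<close> \<open>H \<in> \<C>\<close> by (metis inf.order_iff inf_commute order_refl)
      qed
      then have "Inf \<C> \<noteq> bot"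
        using sub by (auto simp: \<S>_def trivial_limit_def)
      moreover have "Inf \<C> \<le> F"
        using False sub by (metis (mono_tags) Inf_lower2 \<S>_def ex_in_conv mem_Collect_eq subsetD)
      ultimately show ?thesis
        by (intro bexI[of _ "Inf \<C>"]) (auto simp: \<S>_def Inf_lower)
    qed
  qed
  then obtain U where U: "U \<le> F" "U \<noteq> bot" "\<And>G. G \<le> F \<Longrightarrow> G \<noteq> bot \<Longrightarrow> G \<le> U \<Longrightarrow> G = U"
    unfolding \<S>_def by auto
  have "eventually P U \<or> eventually (\<lambda>x. \<not> P x) U" for P
  proof (cases "inf U (principal {x. P x}) = bot")
    case True
    then show ?thesis
      by (simp add: trivial_limit_def eventually_inf_principal)
  next
    case False
    then have "inf U (principal {x. P x}) = U"
      using U(1,3) by (meson inf.cobounded1 le_infI1)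
    moreover have "eventually P (inf U (principal {x. P x}))"
      by (simp add: eventually_inf_principal)
    ultimately show ?thesis
      by simp
  qed
  then show ?thesis
    using that U(1,2) by (simp add: ultrafilter_def)
qed

lemma ultrafilter_disj:
  assumes "ultrafilter U" "eventually (\<lambda>x. P x \<or> Q x) U"
  shows "eventually P U \<or> eventually Q U"
proof (cases "eventually P U")
  case False
  then have "eventually (\<lambda>x. \<not> P x) U"
    using assms(1) by (auto simp: ultrafilter_def)
  with assms(2) have "eventually Q U"
    by eventually_elim auto
  then show ?thesis ..
qed simp

text \<open>Turns a choice that depends on the point, among finitely many alternatives, into one
  fixed choice valid almost everywhere.\<close>

lemma ultrafilter_bex_finite:
  assumes "ultrafilter U" "finite S" "eventually (\<lambda>x. \<exists>s\<in>S. P s x) U"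
  shows "\<exists>s\<in>S. eventually (P s) U"
  using assms(2,3)
proof (induction S rule: finite_induct)
  case empty
  then show ?case
    using assms(1) by (simp add: ultrafilter_def trivial_limit_def)
next
  case (insert s S)
  then have "eventually (\<lambda>x. P s x \<or> (\<exists>s\<in>S. P s x)) U"
    by simp
  from ultrafilter_disj[OF assms(1) this] insert show ?case
    by auto
qed

lemma ultrafilter_filtermap: "ultrafilter U \<Longrightarrow> ultrafilter (filtermap f U)"
  by (simp add: ultrafilter_def filtermap_bot_iff eventually_filtermap)

section \<open>Functions bounded along a filter\<close>

definition bounded_along :: "'a filter \<Rightarrow> ('a \<Rightarrow> real) \<Rightarrow> bool" where
  "bounded_along U f \<longleftrightarrow> (\<exists>B. eventually (\<lambda>z. \<bar>f z\<bar> \<le> B) U)"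

lemma bounded_along_const: "bounded_along U (\<lambda>_. c)"
  unfolding bounded_along_def by (rule exI[of _ "\<bar>c\<bar>"]) simp

lemma bounded_along_add:
  assumes "bounded_along U f" "bounded_along U g"
  shows "bounded_along U (\<lambda>z. f z + g z)"
proof -
  obtain B B' where "eventually (\<lambda>z. \<bar>f z\<bar> \<le> B) U" "eventually (\<lambda>z. \<bar>g z\<bar> \<le> B') U"
    using assms by (auto simp: bounded_along_def)
  then have "eventually (\<lambda>z. \<bar>f z + g z\<bar> \<le> B + B') U"
    by eventually_elim linarith
  then show ?thesis
    by (auto simp: bounded_along_def)
qed

lemma bounded_along_cmult:
  assumes "bounded_along U f"
  shows "bounded_along U (\<lambda>z. c * f z)"
proof -
  obtain B where "eventually (\<lambda>z. \<bar>f z\<bar> \<le> B) U"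
    using assms by (auto simp: bounded_along_def)
  then have "eventually (\<lambda>z. \<bar>c * f z\<bar> \<le> \<bar>c\<bar> * B) U"
    by eventually_elim (auto simp: abs_mult intro: mult_left_mono)
  then show ?thesis
    by (auto simp: bounded_along_def)
qed

lemma bounded_along_sum:
  "(\<And>i. i \<in> A \<Longrightarrow> bounded_along U (f i)) \<Longrightarrow> bounded_along U (\<lambda>z. \<Sum>i\<in>A. f i z)"
  by (induction A rule: infinite_finite_induct) (simp_all add: bounded_along_const bounded_along_add)

lemma bounded_along_cong:
  "bounded_along U f \<Longrightarrow> eventually (\<lambda>z. f z = g z) U \<Longrightarrow> bounded_along U g"
  unfolding bounded_along_def by (elim exE, rule_tac x = B in exI, erule (1) eventually_elim2) simp

section \<open>Cauchy sequences of scalars and the values of their limits\<close>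

context nontrivial_nonarch_valuation
begin

text \<open>In an ultrametric, consecutive differences tending to 0 already make a sequence Cauchy;
  \<open>ucauchy_tail\<close> recovers the usual form.\<close>

definition ucauchy :: "(nat \<Rightarrow> 'k) \<Rightarrow> bool" where
  "ucauchy s \<longleftrightarrow> (\<lambda>n. val (s (Suc n) - s n)) \<longlonglongrightarrow> 0"

text \<open>For a Cauchy sequence this is the value of its limit in the completion of
  \<open>K\<close>; it exists as a real number whether or not the sequence converges in
  \<open>K\<close>.\<close>

definition lim_val :: "(nat \<Rightarrow> 'k) \<Rightarrow> real" where
  "lim_val s = lim (\<lambda>n. val (s n))"

lemma ucauchy_tail:
  assumes "ucauchy s" "0 < e"
  obtains N where "\<And>n k. N \<le> n \<Longrightarrow> N \<le> k \<Longrightarrow> val (s n - s k) < e"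
proof -
  have "\<forall>\<^sub>F n in sequentially. val (s (Suc n) - s n) < e"
    using assms order_tendstoD(2)[of _ 0 sequentially e] by (simp add: ucauchy_def)
  then obtain N where N: "\<And>n. N \<le> n \<Longrightarrow> val (s (Suc n) - s n) < e"
    by (auto simp: eventually_sequentially)
  have *: "val (s (N + k) - s N) < e" for k
  proof (induction k)
    case (Suc k)
    have "s (N + Suc k) - s N = (s (Suc (N + k)) - s (N + k)) + (s (N + k) - s N)"
      by simp
    then show ?case
      using val_ultrametric[of "s (Suc (N + k)) - s (N + k)" "s (N + k) - s N"] Suc N[of "N + k"]
      by (metis le_add1 le_less_trans max_less_iff_conj)
  qed (use assms in simp)
  show ?thesis
  proof (rule that)
    fix n k assume "N \<le> n" "N \<le> k"
    then have "val (s n - s N) < e" "val (s k - s N) < e"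
      using *[of "n - N"] *[of "k - N"] by auto
    then show "val (s n - s k) < e"
      using val_diff_ultrametric[of "s n - s N" "s k - s N"] by auto
  qed
qed

text \<open>Once all differences are below \<open>e\<close>, a single term of value at least
  \<open>e\<close> freezes the value of all later terms, by the isosceles principle.\<close>

lemma ucauchy_cases:
  assumes "ucauchy s"
  obtains "(\<lambda>n. val (s n)) \<longlonglongrightarrow> 0"
  | c where "0 < c" "eventually (\<lambda>n. val (s n) = c) sequentially"
proof (cases "(\<lambda>n. val (s n)) \<longlonglongrightarrow> 0")
  case False
  then obtain e where e: "0 < e" "\<And>N. \<exists>n\<ge>N. e \<le> val (s n)"
    using val_nonneg by (fastforce simp: lim_sequentially dist_real_def)
  obtain N where N: "\<And>n k. N \<le> n \<Longrightarrow> N \<le> k \<Longrightarrow> val (s n - s k) < e"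
    using ucauchy_tail[OF assms e(1)] by blast
  obtain n where n: "N \<le> n" "e \<le> val (s n)"
    using e(2) by blast
  have "val (s k) = val (s n)" if "N \<le> k" for k
    using N[OF that n(1)] n(2) by (intro val_eq_of_diff_less) auto
  then have "eventually (\<lambda>k. val (s k) = val (s n)) sequentially"
    by (auto simp: eventually_sequentially)
  moreover have "0 < val (s n)"
    using e n by linarith
  ultimately show ?thesis
    using that(2) by blast
qed (use that in blast)

lemma tendsto_lim_val:
  assumes "ucauchy s"
  shows "(\<lambda>n. val (s n)) \<longlonglongrightarrow> lim_val s"
proof -
  have "convergent (\<lambda>n. val (s n))"
    using assms
    by (rule ucauchy_cases) (auto simp: convergent_def intro: tendsto_eventually)
  then show ?thesis
    by (simp add: lim_val_def convergent_LIMSEQ_iff)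
qed

lemma lim_val_eqI: "(\<lambda>n. val (s n)) \<longlonglongrightarrow> l \<Longrightarrow> lim_val s = l"
  unfolding lim_val_def by (rule limI)

lemma lim_val_nonneg: "ucauchy s \<Longrightarrow> 0 \<le> lim_val s"
  using tendsto_lim_val[of s] val_nonneg by (intro LIMSEQ_le_const) auto

lemma ucauchy_const [simp]: "ucauchy (\<lambda>_. c)" "lim_val (\<lambda>_. c) = val c"
  by (auto simp: ucauchy_def intro!: lim_val_eqI)

lemma ucauchy_uminus:
  assumes "ucauchy s"
  shows "ucauchy (\<lambda>n. - s n)" "lim_val (\<lambda>n. - s n) = lim_val s"
proof -
  have "val (- s (Suc n) - - s n) = val (s (Suc n) - s n)" for n
    using val_minus[of "s (Suc n) - s n"] by (simp del: val_minus)
  then show "ucauchy (\<lambda>n. - s n)"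
    using assms by (simp add: ucauchy_def)
qed (simp add: lim_val_def)

lemma ucauchy_add:
  assumes "ucauchy s" "ucauchy t"
  shows "ucauchy (\<lambda>n. s n + t n)" "lim_val (\<lambda>n. s n + t n) \<le> max (lim_val s) (lim_val t)"
proof -
  have "(\<lambda>n. max (val (s (Suc n) - s n)) (val (t (Suc n) - t n))) \<longlonglongrightarrow> max 0 0"
    using assms unfolding ucauchy_def by (intro tendsto_max)
  then have lim: "(\<lambda>n. max (val (s (Suc n) - s n)) (val (t (Suc n) - t n))) \<longlonglongrightarrow> 0"
    by simp
  have "val (s (Suc n) + t (Suc n) - (s n + t n)) \<le> max (val (s (Suc n) - s n)) (val (t (Suc n) - t n))" for n
    using val_ultrametric[of "s (Suc n) - s n" "t (Suc n) - t n"] by (simp add: add_diff_add)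
  then show *: "ucauchy (\<lambda>n. s n + t n)"
    unfolding ucauchy_def by (intro tendsto_sandwich[OF _ _ tendsto_const lim] always_eventually)
      (auto intro: val_nonneg)
  show "lim_val (\<lambda>n. s n + t n) \<le> max (lim_val s) (lim_val t)"
    by (rule LIMSEQ_le[OF tendsto_lim_val[OF *] tendsto_max[OF tendsto_lim_val[OF assms(1)] tendsto_lim_val[OF assms(2)]]])
      (auto simp: val_ultrametric)
qed

lemma ucauchy_diff:
  assumes "ucauchy s" "ucauchy t"
  shows "ucauchy (\<lambda>n. s n - t n)" "lim_val (\<lambda>n. s n - t n) \<le> max (lim_val s) (lim_val t)"
  using ucauchy_add[OF assms(1) ucauchy_uminus(1)[OF assms(2)]] ucauchy_uminus(2)[OF assms(2)] by auto

lemma ucauchy_mult: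
  assumes "ucauchy s" "ucauchy t"
  shows "ucauchy (\<lambda>n. s n * t n)" "lim_val (\<lambda>n. s n * t n) = lim_val s * lim_val t"
proof -
  note ls = tendsto_lim_val[OF assms(1)] and lt = tendsto_lim_val[OF assms(2)]
  have "(\<lambda>n. max (val (s (Suc n)) * val (t (Suc n) - t n)) (val (s (Suc n) - s n) * val (t n)))
      \<longlonglongrightarrow> max (lim_val s * 0) (0 * lim_val t)"
    using assms LIMSEQ_Suc[OF ls] lt unfolding ucauchy_def by (intro tendsto_max tendsto_mult)
  then have lim: "(\<lambda>n. max (val (s (Suc n)) * val (t (Suc n) - t n)) (val (s (Suc n) - s n) * val (t n))) \<longlonglongrightarrow> 0"
    by simp
  have "val (s (Suc n) * t (Suc n) - s n * t n)
      \<le> max (val (s (Suc n)) * val (t (Suc n) - t n)) (val (s (Suc n) - s n) * val (t n))" for n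
  proof -
    have "s (Suc n) * t (Suc n) - s n * t n = s (Suc n) * (t (Suc n) - t n) + (s (Suc n) - s n) * t n"
      by (simp add: algebra_simps)
    then show ?thesis
      using val_ultrametric[of "s (Suc n) * (t (Suc n) - t n)" "(s (Suc n) - s n) * t n"]
      by (simp add: val_mult)
  qed
  then show "ucauchy (\<lambda>n. s n * t n)"
    unfolding ucauchy_def by (intro tendsto_sandwich[OF _ _ tendsto_const lim] always_eventually)
      (auto intro: val_nonneg)
  show "lim_val (\<lambda>n. s n * t n) = lim_val s * lim_val t"
    using tendsto_mult[OF ls lt] by (intro lim_val_eqI) (simp add: val_mult)
qed

lemma ucauchy_sum:
  assumes "\<And>i. i \<in> A \<Longrightarrow> ucauchy (s i)"
  shows "ucauchy (\<lambda>n. \<Sum>i\<in>A. s i n)"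
  using assms by (induction A rule: infinite_finite_induct) (auto simp: ucauchy_add)

lemma lim_val_sum_le:
  assumes "\<And>i. i \<in> A \<Longrightarrow> ucauchy (s i)" "\<And>i. i \<in> A \<Longrightarrow> lim_val (s i) \<le> c" "0 \<le> c"
  shows "lim_val (\<lambda>n. \<Sum>i\<in>A. s i n) \<le> c"
  using assms(1,2)
proof (induction A rule: infinite_finite_induct)
  case (insert i A)
  then have "lim_val (\<lambda>n. s i n + (\<Sum>i\<in>A. s i n)) \<le> max (lim_val (s i)) (lim_val (\<lambda>n. \<Sum>i\<in>A. s i n))"
    by (intro ucauchy_add ucauchy_sum) auto
  also have "\<dots> \<le> c"
    using insert by (intro max.boundedI) auto
  finally show ?case
    using insert by simp
qed (use assms in auto)

lemma ucauchy_power: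
  assumes "ucauchy s"
  shows "ucauchy (\<lambda>n. s n ^ k)" "lim_val (\<lambda>n. s n ^ k) = lim_val s ^ k"
  using assms by (induction k) (auto simp: ucauchy_mult)

text \<open>If the largest value were attained by one term only, that term would dominate and the
  sum would have a nonzero value.\<close>

lemma lim_val_sum_zero_two_terms:
  assumes "finite A" "\<And>i. i \<in> A \<Longrightarrow> ucauchy (s i)" "lim_val (\<lambda>n. \<Sum>i\<in>A. s i n) = 0"
    and "i0 \<in> A" "lim_val (s i0) \<noteq> 0"
  shows "\<exists>i\<in>A. \<exists>j\<in>A. i \<noteq> j \<and> lim_val (s i) = lim_val (s j) \<and> lim_val (s i) \<noteq> 0"
proof (rule ccontr)
  assume neg: "\<not> ?thesis"
  define c where "c = Max ((\<lambda>i. lim_val (s i)) ` A)"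
  have "c \<in> (\<lambda>i. lim_val (s i)) ` A"
    unfolding c_def using assms by (intro Max_in) auto
  then obtain i where i: "i \<in> A" "lim_val (s i) = c"
    by auto
  have max: "lim_val (s j) \<le> c" if "j \<in> A" for j
    unfolding c_def using assms that by (intro Max_ge) auto
  have "0 < c"
    using max[OF assms(4)] assms(5) lim_val_nonneg[OF assms(2)[OF assms(4)]] by linarith
  \<comment> \<open>The largest value among the remaining terms; the inserted 0 covers the case that
    there are none.\<close>
  define c' where "c' = Max (insert 0 ((\<lambda>j. lim_val (s j)) ` (A - {i})))"
  have "c' \<in> insert 0 ((\<lambda>j. lim_val (s j)) ` (A - {i}))"
    unfolding c'_def using assms(1) by (intro Max_in) auto
  then have "c' < c"
  proof
    assume "c' \<in> (\<lambda>j. lim_val (s j)) ` (A - {i})"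
    then obtain j where "j \<in> A" "j \<noteq> i" "c' = lim_val (s j)"
      by auto
    with neg i max[of j] \<open>0 < c\<close> show ?thesis
      by (metis less_eq_real_def less_irrefl)
  qed (use \<open>0 < c\<close> in simp)
  have "0 \<le> c'" "\<And>j. j \<in> A - {i} \<Longrightarrow> lim_val (s j) \<le> c'"
    unfolding c'_def using assms(1) by (auto intro!: Max_ge)
  then have rest: "lim_val (\<lambda>n. \<Sum>j\<in>A - {i}. s j n) \<le> c'"
    using assms(2) by (intro lim_val_sum_le) auto
  have "s i n = (\<Sum>j\<in>A. s j n) - (\<Sum>j\<in>A - {i}. s j n)" for n
    using assms(1) i(1) by (simp add: sum.remove[of A i])
  then have "s i = (\<lambda>n. (\<Sum>j\<in>A. s j n) - (\<Sum>j\<in>A - {i}. s j n))"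
    by (rule ext)
  then have "c \<le> max (lim_val (\<lambda>n. \<Sum>j\<in>A. s j n)) (lim_val (\<lambda>n. \<Sum>j\<in>A - {i}. s j n))"
    using ucauchy_diff(2)[OF ucauchy_sum[of A s] ucauchy_sum[of "A - {i}" s]] assms(2) i(2) by auto
  then show False
    using rest assms(3) \<open>c' < c\<close> \<open>0 \<le> c'\<close> \<open>0 < c\<close> by auto
qed

text \<open>Represents an element of the completion of the polynomial ring in the Gauss norm, a Tate
  algebra with radii \<open>\<rho>\<close>. The null sequence \<open>e\<close> stands in for a
  metric, because \<open>gauss_le\<close> provides upper bounds only.\<close>

definition gauss_cauchy :: "(nat \<Rightarrow> real) \<Rightarrow> nat \<Rightarrow> (nat \<Rightarrow> (nat \<Rightarrow> 'k) \<Rightarrow> 'k) \<Rightarrow> bool" where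
  "gauss_cauchy \<rho> m F \<longleftrightarrow> (\<exists>C. gauss_le \<rho> m C (F 0)) \<and>
     (\<exists>e. e \<longlonglongrightarrow> 0 \<and> (\<forall>n. gauss_le \<rho> m (e n) (F (Suc n) - F n)))"

lemma gauss_cauchy_mono:
  assumes "\<And>i. i < m \<Longrightarrow> 0 < \<rho>' i" "\<And>i. i < m \<Longrightarrow> \<rho>' i \<le> \<rho> i" "gauss_cauchy \<rho> m F"
  shows "gauss_cauchy \<rho>' m F"
  using assms(3) gauss_le_mono[of m \<rho>' \<rho>, OF assms(1,2) order_refl] unfolding gauss_cauchy_def by blast

section \<open>Ring operations on Cauchy sequences in the Gauss norm\<close>

context
  fixes \<rho> :: "nat \<Rightarrow> real"
  assumes radii_pos: "\<And>i. 0 < \<rho> i"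
begin

lemma gauss_cauchy_bounded:
  assumes "gauss_cauchy \<rho> m F"
  obtains C where "\<And>n. gauss_le \<rho> m C (F n)"
proof -
  obtain C e where C: "gauss_le \<rho> m C (F 0)" and e: "e \<longlonglongrightarrow> 0" "\<And>n. gauss_le \<rho> m (e n) (F (Suc n) - F n)"
    using assms by (auto simp: gauss_cauchy_def)
  obtain B where B: "\<And>n. \<bar>e n\<bar> \<le> B"
    using convergent_imp_Bseq[OF convergentI[OF e(1)]] by (auto simp: Bseq_def)
  have "gauss_le \<rho> m (max C B) (F n)" for n
  proof (induction n)
    case 0
    show ?case
      by (rule gauss_le_mono_bound[OF radii_pos C]) simp
  next
    case (Suc n)
    have "gauss_le \<rho> m (max C B) (F (Suc n) - F n)"
      by (rule gauss_le_mono_bound[OF radii_pos e(2)]) (use B[of n] in linarith)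
    from gauss_le_add[OF radii_pos this Suc] show ?case by simp
  qed
  then show ?thesis
    using that by blast
qed

lemma gauss_cauchy_add:
  assumes "gauss_cauchy \<rho> m F" "gauss_cauchy \<rho> m G"
  shows "gauss_cauchy \<rho> m (F + G)"
proof -
  obtain C e where C: "gauss_le \<rho> m C (F 0)" and e: "e \<longlonglongrightarrow> 0" "\<And>n. gauss_le \<rho> m (e n) (F (Suc n) - F n)"
    using assms by (auto simp: gauss_cauchy_def)
  obtain C' e' where C': "gauss_le \<rho> m C' (G 0)" and e': "e' \<longlonglongrightarrow> 0" "\<And>n. gauss_le \<rho> m (e' n) (G (Suc n) - G n)"
    using assms by (auto simp: gauss_cauchy_def)
  have "gauss_le \<rho> m (max C C') ((F + G) 0)"
    using gauss_le_mono_bound[OF radii_pos C, of "max C C'"] gauss_le_mono_bound[OF radii_pos C', of "max C C'"]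
    by (simp add: gauss_le_add[OF radii_pos])
  moreover have "gauss_le \<rho> m (max (e n) (e' n)) ((F + G) (Suc n) - (F + G) n)" for n
    using gauss_le_add[OF radii_pos gauss_le_mono_bound[OF radii_pos e(2)[of n], of "max (e n) (e' n)"]
      gauss_le_mono_bound[OF radii_pos e'(2)[of n], of "max (e n) (e' n)"]]
    by (simp add: add_diff_add)
  moreover have "(\<lambda>n. max (e n) (e' n)) \<longlonglongrightarrow> 0"
    using tendsto_max[OF e(1) e'(1)] by simp
  ultimately show ?thesis
    unfolding gauss_cauchy_def by blast
qed

lemma gauss_cauchy_mult:
  assumes "gauss_cauchy \<rho> m F" "gauss_cauchy \<rho> m G"
  shows "gauss_cauchy \<rho> m (F * G)"
proof -
  obtain C where C: "\<And>n. gauss_le \<rho> m C (F n)"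
    using gauss_cauchy_bounded[OF assms(1)] by blast
  obtain C' where C': "\<And>n. gauss_le \<rho> m C' (G n)"
    using gauss_cauchy_bounded[OF assms(2)] by blast
  obtain e where e: "e \<longlonglongrightarrow> 0" "\<And>n. gauss_le \<rho> m (e n) (F (Suc n) - F n)"
    using assms by (auto simp: gauss_cauchy_def)
  obtain e' where e': "e' \<longlonglongrightarrow> 0" "\<And>n. gauss_le \<rho> m (e' n) (G (Suc n) - G n)"
    using assms by (auto simp: gauss_cauchy_def)
  define b where "b = (\<lambda>n. max (C * e' n) (e n * C'))"
  have "gauss_le \<rho> m (b n) ((F * G) (Suc n) - (F * G) n)" for n
  proof -
    have "gauss_le \<rho> m (b n) (F (Suc n) * (G (Suc n) - G n))"
      "gauss_le \<rho> m (b n) ((F (Suc n) - F n) * G n)"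
      using gauss_le_mult[OF radii_pos C[of "Suc n"] e'(2)[of n]] gauss_le_mult[OF radii_pos e(2)[of n] C'[of n]]
      by (auto intro: gauss_le_mono_bound[OF radii_pos] simp: b_def)
    from gauss_le_add[OF radii_pos this] show ?thesis
      by (simp add: algebra_simps)
  qed
  moreover have "b \<longlonglongrightarrow> 0"
    unfolding b_def using tendsto_max[OF tendsto_mult[OF tendsto_const e'(1), of C] tendsto_mult[OF e(1) tendsto_const, of C']] by simp
  moreover have "gauss_le \<rho> m (C * C') ((F * G) 0)"
    using gauss_le_mult[OF radii_pos C C'] by (simp del: times_fun_apply add: times_fun_apply[of F G 0])
  ultimately show ?thesis
    unfolding gauss_cauchy_def by blast
qed

lemma gauss_cauchy_uminus:
  assumes "gauss_cauchy \<rho> m F"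
  shows "gauss_cauchy \<rho> m (- F)"
proof -
  obtain C e where C: "gauss_le \<rho> m C (F 0)" and e: "e \<longlonglongrightarrow> 0" "\<And>n. gauss_le \<rho> m (e n) (F (Suc n) - F n)"
    using assms by (auto simp: gauss_cauchy_def)
  have "(- F) (Suc n) - (- F) n = - (F (Suc n) - F n)" for n
    by simp
  then have "gauss_le \<rho> m (e n) ((- F) (Suc n) - (- F) n)" for n
    using gauss_le_uminus[OF radii_pos e(2)[of n]] by metis
  moreover have "gauss_le \<rho> m C ((- F) 0)"
    using gauss_le_uminus[OF radii_pos C] by (simp add: fun_Compl_def)
  ultimately show ?thesis
    using e(1) unfolding gauss_cauchy_def by blast
qed

lemma gauss_cauchy_const:
  assumes "ucauchy s"
  shows "gauss_cauchy \<rho> m (\<lambda>n _. s n)"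
  unfolding gauss_cauchy_def
proof (intro conjI exI)
  show "gauss_le \<rho> m (val (s 0)) (\<lambda>_. s 0)"
    by (intro gauss_le_const radii_pos order_refl)
  show "(\<lambda>n. val (s (Suc n) - s n)) \<longlonglongrightarrow> 0"
    using assms by (simp add: ucauchy_def)
  show "\<forall>n. gauss_le \<rho> m (val (s (Suc n) - s n)) ((\<lambda>_. s (Suc n)) - (\<lambda>_. s n))"
    by (auto simp: fun_diff_def intro!: gauss_le_const radii_pos)
qed

lemma gauss_cauchy_1: "gauss_cauchy \<rho> m 1"
  using gauss_cauchy_const[OF ucauchy_const(1), of m 1] by (simp add: one_fun_def)

lemma gauss_cauchy_0: "gauss_cauchy \<rho> m 0"
  using gauss_cauchy_const[OF ucauchy_const(1), of m 0] by (simp add: zero_fun_def)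

lemma gauss_cauchy_imp_ucauchy:
  assumes "gauss_cauchy \<rho> m F" "\<And>i. i < m \<Longrightarrow> val (z i) \<le> \<rho> i"
  shows "ucauchy (\<lambda>n. F n z)"
proof -
  obtain e where e: "e \<longlonglongrightarrow> 0" "\<And>n. gauss_le \<rho> m (e n) (F (Suc n) - F n)"
    using assms by (auto simp: gauss_cauchy_def)
  have "val (F (Suc n) z - F n z) \<le> e n" for n
    using gauss_le_bound[OF radii_pos e(2)[of n], of z] assms(2) by simp
  then show ?thesis
    unfolding ucauchy_def by (intro tendsto_sandwich[OF _ _ tendsto_const e(1)] always_eventually)
      (auto intro: val_nonneg)
qed

end

end

section \<open>Weierstrass preparation\<close>

lemma poly_shift_diff: "poly_shift d (p - q) = poly_shift d p - poly_shift d (q :: 'a::comm_ring_1 poly)"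
  by (simp add: poly_eq_iff coeff_poly_shift)

text \<open>Division by the \<open>d\<close>-th power of the variable: \<open>poly_shift\<close> is
  the quotient, \<open>poly_cutoff\<close> the remainder.\<close>

lemma monom_mult_shift_add_cutoff:
  "p = monom 1 d * poly_shift d p + poly_cutoff d (p :: 'a::comm_ring_1 poly)"
  by (auto simp: poly_eq_iff coeff_monom_mult coeff_poly_shift coeff_poly_cutoff)

lemma poly_cutoff_fun_apply:
  fixes p :: "('a \<Rightarrow> 'b::comm_ring_1) poly"
  shows "poly (poly_cutoff d p) X x = (\<Sum>k<d. coeff p k x * X x ^ k)"
proof -
  have "degree (poly_cutoff d p) \<le> d"
    by (rule degree_le) (auto simp: coeff_poly_cutoff)
  then have "poly (poly_cutoff d p) X x = (\<Sum>k\<le>d. coeff (poly_cutoff d p) k x * X x ^ k)"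
    by (rule poly_fun_apply)
  also have "\<dots> = (\<Sum>k<d. coeff p k x * X x ^ k)"
    by (rule sum.mono_neutral_cong_right) (auto simp: coeff_poly_cutoff)
  finally show ?thesis .
qed

context nontrivial_nonarch_valuation
begin

lemma abs_val_diff_le: "\<bar>val x - val y\<bar> \<le> val (x - y)"
  using val_diff_triangle[of x 0 y] val_diff_triangle[of y 0 x] val_diff_commute[of x y] by simp

text \<open>
  Weierstrass division of \<open>X\<^sup>d\<close> by \<open>X\<^sup>d + E\<close>: dividing by \<open>X\<^sup>d\<close> instead leaves an error that is
  smaller by the factor \<open>\<epsilon>\<close>, and this error is divided again.
\<close>

primrec weierstrass_error ::
  "nat \<Rightarrow> ((nat \<Rightarrow> 'k) \<Rightarrow> 'k) poly \<Rightarrow> nat \<Rightarrow> ((nat \<Rightarrow> 'k) \<Rightarrow> 'k) poly" where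
  "weierstrass_error d E 0 = monom 1 d"
| "weierstrass_error d E (Suc i) = - (E * poly_shift d (weierstrass_error d E i))"

text \<open>An error \<open>w\<close> equals \<open>X^d\<close> times its shift plus its cutoff.
  Replacing \<open>X^d\<close> by \<open>X^d + E\<close> costs \<open>E\<close> times the shift, and
  its negative is the next error. The identity collects quotients and remainders of \<open>n\<close>
  such steps together with the error left undivided.\<close>

lemma weierstrass_identity:
  "monom 1 d = (monom 1 d + E) * (\<Sum>i<n. poly_shift d (weierstrass_error d E i))
     + (\<Sum>i<n. poly_cutoff d (weierstrass_error d E i)) + weierstrass_error d E n"
proof (induction n)
  case (Suc n)
  have "weierstrass_error d E n = (monom 1 d + E) * poly_shift d (weierstrass_error d E n)
      + poly_cutoff d (weierstrass_error d E n) + weierstrass_error d E (Suc n)"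
    using monom_mult_shift_add_cutoff[of "weierstrass_error d E n" d] by (simp add: algebra_simps)
  moreover have "f * (A + S) + (B + c) + w = f * A + B + (f * S + c + w)"
    for f A S B c w :: "((nat \<Rightarrow> 'k) \<Rightarrow> 'k) poly"
    by (simp add: algebra_simps)
  ultimately show ?case
    unfolding sum.lessThan_Suc using Suc by presburger
qed (simp add: one_fun_def)

section \<open>Weierstrass division along a Cauchy sequence of divisors\<close>

context
  fixes \<rho> :: "nat \<Rightarrow> real" and m d :: nat and \<epsilon> :: real and e :: "nat \<Rightarrow> real"
    and E :: "nat \<Rightarrow> ((nat \<Rightarrow> 'k) \<Rightarrow> 'k) poly"
  assumes radii_pos: "\<And>i. 0 < \<rho> i"
    and \<epsilon>: "0 \<le> \<epsilon>" "\<epsilon> < 1"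
    and E: "\<And>n. gauss_poly_le \<rho> m (\<epsilon> * \<rho> m ^ d) (E n)"
    and dE: "\<And>n. gauss_poly_le \<rho> m (e n) (E (Suc n) - E n)" "e \<longlonglongrightarrow> 0"
begin

text \<open>A step divides by \<open>X^d\<close>, of norm \<open>\<rho> m ^ d\<close>, and
  multiplies by \<open>E n\<close>, of norm at most \<open>\<epsilon> * \<rho> m ^ d\<close>: a gain
  of \<open>\<epsilon>\<close> each time.\<close>

lemma weierstrass_error_le: "gauss_poly_le \<rho> m (\<epsilon> ^ i * \<rho> m ^ d) (weierstrass_error d (E n) i)"
proof (induction i)
  case 0
  have "gauss_le \<rho> m (\<rho> m ^ d / \<rho> m ^ k) (coeff (monom 1 d) k)" for k
    using radii_pos[of m] gauss_le_const[of \<rho>, OF radii_pos, of 1 1 m]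
    by (cases "k = d") (auto simp: gauss_le_0[OF radii_pos] one_fun_def)
  then show ?case
    by (simp add: gauss_poly_le_def)
next
  case (Suc i)
  have "gauss_poly_le \<rho> m ((\<epsilon> * \<rho> m ^ d) * \<epsilon> ^ i) (E n * poly_shift d (weierstrass_error d (E n) i))"
    by (intro gauss_poly_le_mult radii_pos E gauss_poly_le_shift Suc)
  then show ?case
    using gauss_poly_le_uminus[OF radii_pos] by (simp add: mult_ac)
qed

lemma weierstrass_error_shift_le: "gauss_poly_le \<rho> m (\<epsilon> ^ i) (poly_shift d (weierstrass_error d (E n) i))"
  by (intro gauss_poly_le_shift radii_pos weierstrass_error_le)

text \<open>Changing one factor of the product at a time: a change of \<open>E\<close> meets a
  quotient of norm at most 1, while a change of the quotient, magnified by
  \<open>1 / \<rho> m ^ d\<close>, meets \<open>E\<close> of norm at most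
  \<open>\<epsilon> * \<rho> m ^ d\<close>. So the bound is uniform in the number of steps.\<close>

lemma weierstrass_error_diff_le:
  "gauss_poly_le \<rho> m (e n) (weierstrass_error d (E (Suc n)) i - weierstrass_error d (E n) i)"
proof (induction i)
  case 0
  then show ?case
    using gauss_poly_le_nonneg[OF radii_pos dE(1)[of n]] by (simp add: gauss_poly_le_0[OF radii_pos])
next
  case (Suc i)
  let ?S = "\<lambda>n. poly_shift d (weierstrass_error d (E n) i)"
  have e: "0 \<le> e n"
    using gauss_poly_le_nonneg[OF radii_pos dE(1)] .
  have "gauss_poly_le \<rho> m (e n * \<epsilon> ^ i) ((E (Suc n) - E n) * ?S (Suc n))"
    by (intro gauss_poly_le_mult radii_pos dE weierstrass_error_shift_le)
  then have 1: "gauss_poly_le \<rho> m (e n) ((E (Suc n) - E n) * ?S (Suc n))"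
    by (rule gauss_poly_le_mono[OF radii_pos])
      (use e \<epsilon> in \<open>auto intro!: mult_left_le power_le_one\<close>)
  have "gauss_poly_le \<rho> m (e n / \<rho> m ^ d) (?S (Suc n) - ?S n)"
    unfolding poly_shift_diff[symmetric]
    by (rule gauss_poly_le_shift[OF radii_pos]) (use radii_pos[of m] Suc in simp)
  then have "gauss_poly_le \<rho> m (\<epsilon> * \<rho> m ^ d * (e n / \<rho> m ^ d)) (E n * (?S (Suc n) - ?S n))"
    by (intro gauss_poly_le_mult radii_pos E)
  then have 2: "gauss_poly_le \<rho> m (e n) (E n * (?S (Suc n) - ?S n))"
    by (rule gauss_poly_le_mono[OF radii_pos])
      (use e \<epsilon> radii_pos[of m] in \<open>auto intro!: mult_left_le_one_le\<close>)
  have "weierstrass_error d (E (Suc n)) (Suc i) - weierstrass_error d (E n) (Suc i) =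
      - ((E (Suc n) - E n) * ?S (Suc n) + E n * (?S (Suc n) - ?S n))"
    by (simp add: algebra_simps)
  then show ?case
    using gauss_poly_le_uminus[OF radii_pos gauss_poly_le_add[OF radii_pos 1 2]] by metis
qed

text \<open>The Weierstrass polynomial is \<open>X^d\<close> minus the remainder, hence the sign.
  The number of division steps and the divisor \<open>E n\<close> share the index \<open>n\<close>:
  one diagonal sequence represents the limit of both processes.\<close>

definition weierstrass_coeff :: "nat \<Rightarrow> nat \<Rightarrow> (nat \<Rightarrow> 'k) \<Rightarrow> 'k" where
  "weierstrass_coeff k n = - (\<Sum>i<n. coeff (weierstrass_error d (E n) i) k)"

text \<open>Passing from \<open>n\<close> to \<open>n + 1\<close> adds one more error, of order
  \<open>\<epsilon> ^ n\<close>, and replaces the divisor, which changes each earlier error by at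
  most \<open>e n\<close>.\<close>

lemma gauss_cauchy_weierstrass_coeff: "gauss_cauchy \<rho> m (weierstrass_coeff k)"
  unfolding gauss_cauchy_def
proof (intro conjI exI allI)
  let ?w = "\<lambda>n i. weierstrass_error d (E n) i"
  let ?b = "\<lambda>n. max (\<epsilon> ^ n * \<rho> m ^ d / \<rho> m ^ k) (e n / \<rho> m ^ k)"
  show "gauss_le \<rho> m 0 (weierstrass_coeff k 0)"
    by (simp add: weierstrass_coeff_def gauss_le_0[OF radii_pos] flip: zero_fun_def)
  have "(\<lambda>n. \<epsilon> ^ n) \<longlonglongrightarrow> 0"
    using \<epsilon> by (intro LIMSEQ_realpow_zero) auto
  then have "?b \<longlonglongrightarrow> max (0 * \<rho> m ^ d / \<rho> m ^ k) (0 / \<rho> m ^ k)"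
    using radii_pos[of m] dE(2) by (intro tendsto_max tendsto_divide tendsto_mult tendsto_const) auto
  then show "?b \<longlonglongrightarrow> 0"
    by simp
  fix n
  have 1: "gauss_le \<rho> m (?b n) (coeff (?w (Suc n) n) k)"
    using weierstrass_error_le[of n "Suc n"] gauss_le_mono_bound[OF radii_pos]
    unfolding gauss_poly_le_def by (meson max.cobounded1)
  have 2: "gauss_le \<rho> m (?b n) (coeff (?w (Suc n) i) k - coeff (?w n i) k)" for i
    using weierstrass_error_diff_le[of n i] gauss_le_mono_bound[OF radii_pos]
    unfolding gauss_poly_le_def coeff_diff by (meson max.cobounded2)
  have 3: "weierstrass_coeff k (Suc n) - weierstrass_coeff k n =
      - (coeff (?w (Suc n) n) k + (\<Sum>i<n. coeff (?w (Suc n) i) k - coeff (?w n i) k))"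
    by (simp add: weierstrass_coeff_def sum_subtractf)
  show "gauss_le \<rho> m (?b n) (weierstrass_coeff k (Suc n) - weierstrass_coeff k n)"
    unfolding 3 by (intro gauss_le_uminus gauss_le_add gauss_le_sum radii_pos 1 2 gauss_le_nonneg[OF 1])
qed

text \<open>By the division identity the Weierstrass polynomial differs from divisor times quotient
  only by the last error, which tends to 0, and the quotient has value exactly 1. Divisor and
  polynomial thus have the same limiting value.\<close>

lemma weierstrass_polynomial_limit:
  assumes z: "\<And>i. i \<le> m \<Longrightarrow> val (z i) \<le> \<rho> i"
    and lim: "(\<lambda>n. val (poly (monom 1 d + E n) (\<lambda>z. z m) z)) \<longlonglongrightarrow> l"
  shows "(\<lambda>n. val (z m ^ d + (\<Sum>k<d. weierstrass_coeff k n z * z m ^ k))) \<longlonglongrightarrow> l"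
proof -
  let ?X = "\<lambda>z::nat \<Rightarrow> 'k. z m"
  let ?w = "\<lambda>n i. weierstrass_error d (E n) i"
  define W where "W = (\<lambda>n. z m ^ d + (\<Sum>k<d. weierstrass_coeff k n z * z m ^ k))"
  define f where "f = (\<lambda>n. poly (monom 1 d + E n) ?X z)"
  define Q where "Q = (\<lambda>n. \<Sum>i<n. poly (poly_shift d (?w n i)) ?X z)"
  define g where "g = (\<lambda>n. poly (?w n n) ?X z)"
  have W: "W n = f n * Q n + g n" for n
  proof -
    have "poly (monom 1 d) ?X z = f n * Q n + (\<Sum>i<n. poly (poly_cutoff d (?w n i)) ?X z) + g n"
      by (subst weierstrass_identity[of d "E n" n])
        (simp only: f_def Q_def g_def poly_sum sum_fun_apply poly_add poly_mult plus_fun_apply times_fun_apply)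
    moreover have "(\<Sum>i<n. poly (poly_cutoff d (?w n i)) ?X z) = - (\<Sum>k<d. weierstrass_coeff k n z * z m ^ k)"
      unfolding poly_cutoff_fun_apply
      by (subst sum.swap) (simp add: weierstrass_coeff_def sum_fun_apply sum_distrib_right sum_negf)
    moreover have "poly (monom 1 d) ?X z = z m ^ d"
      by (simp add: poly_monom power_fun_apply)
    ultimately show ?thesis
      by (simp add: W_def algebra_simps)
  qed
  \<comment> \<open>The summand for \<open>i = 0\<close> is the shift of \<open>X^d\<close>, that is
    1; all later summands have value at most \<open>\<epsilon> < 1\<close>.\<close>
  have Q: "val (Q n) = 1" if "0 < n" for n
  proof -
    obtain k where n: "n = Suc k"
      using gr0_implies_Suc[OF \<open>0 < n\<close>] by blast
    have "Q n = 1 + (\<Sum>i<k. poly (poly_shift d (?w n (Suc i))) ?X z)"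
      unfolding Q_def n sum.lessThan_Suc_shift by (simp add: poly_shift_monom)
    moreover have "val (\<Sum>i<k. poly (poly_shift d (?w n (Suc i))) ?X z) \<le> \<epsilon>"
    proof (rule val_sum_le)
      fix i
      have "val (poly (poly_shift d (?w n (Suc i))) ?X z) \<le> \<epsilon> ^ Suc i"
        by (rule gauss_poly_le_bound[OF radii_pos weierstrass_error_shift_le]) (rule z)
      also have "\<dots> \<le> \<epsilon>"
        using \<epsilon> by (simp add: mult_left_le power_le_one)
      finally show "val (poly (poly_shift d (?w n (Suc i))) ?X z) \<le> \<epsilon>" .
    qed (use \<epsilon> in simp)
    ultimately show ?thesis
      using val_add_eq[of "\<Sum>i<k. poly (poly_shift d (?w n (Suc i))) ?X z" 1] \<epsilon> by simp
  qed
  have g: "val (g n) \<le> \<epsilon> ^ n * \<rho> m ^ d" for n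
    unfolding g_def by (rule gauss_poly_le_bound[OF radii_pos weierstrass_error_le]) (rule z)
  have "(\<lambda>n. \<epsilon> ^ n * \<rho> m ^ d) \<longlonglongrightarrow> 0 * \<rho> m ^ d"
    using \<epsilon> by (intro tendsto_intros LIMSEQ_realpow_zero) auto
  then have lim0: "(\<lambda>n. \<epsilon> ^ n * \<rho> m ^ d) \<longlonglongrightarrow> 0"
    by simp
  have "eventually (\<lambda>n. \<bar>val (W n) - val (f n)\<bar> \<le> \<epsilon> ^ n * \<rho> m ^ d) sequentially"
    using eventually_gt_at_top[of 0]
  proof eventually_elim
    case (elim n)
    have "\<bar>val (W n) - val (f n * Q n)\<bar> \<le> val (W n - f n * Q n)"
      by (rule abs_val_diff_le)
    then show ?case
      using g[of n] Q[OF elim] by (simp add: W val_mult)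
  qed
  then have "(\<lambda>n. val (W n) - val (f n)) \<longlonglongrightarrow> 0"
    using Lim_null_comparison[OF _ lim0, of "\<lambda>n. val (W n) - val (f n)"] by simp
  moreover have "(\<lambda>n. val (f n)) \<longlonglongrightarrow> l"
    using lim by (simp only: f_def)
  ultimately have "(\<lambda>n. val (W n)) \<longlonglongrightarrow> l"
    using tendsto_add by fastforce
  then show ?thesis
    by (simp only: W_def)
qed

end

end

section \<open>From series to Weierstrass polynomials\<close>

context nontrivial_nonarch_valuation
begin

text \<open>Each difference \<open>F (Suc n) - F n\<close> comes with its own small polynomial.
  Adding these to a polynomial for \<open>F 0\<close> gives representatives whose coefficients are
  again Cauchy; polynomials chosen separately for each \<open>F n\<close> would be unrelated to each
  other.\<close>

lemma gauss_cauchy_coeffs: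
  assumes r: "0 < r" and F: "gauss_cauchy (\<lambda>_. r) (Suc m) F"
  obtains a C e where "\<And>n. F n = poly (a n) (\<lambda>z. z m)" "\<And>n. gauss_poly_le (\<lambda>_. r) m C (a n)"
    "e \<longlonglongrightarrow> 0" "\<And>n. gauss_poly_le (\<lambda>_. r) m (e n) (a (Suc n) - a n)"
proof -
  note P = gauss_le_SucE[of "\<lambda>_. r", OF r]
  obtain C0 e where C0: "gauss_le (\<lambda>_. r) (Suc m) C0 (F 0)" and e: "e \<longlonglongrightarrow> 0"
    and de: "\<And>n. gauss_le (\<lambda>_. r) (Suc m) (e n) (F (Suc n) - F n)"
    using F by (auto simp only: gauss_cauchy_def)
  obtain p0 where p0: "gauss_poly_le (\<lambda>_. r) m C0 p0" "F 0 = poly p0 (\<lambda>z. z m)"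
    using P[OF C0] by blast
  have "\<exists>p. gauss_poly_le (\<lambda>_. r) m (e n) p \<and> F (Suc n) - F n = poly p (\<lambda>z. z m)" for n
    using P[OF de[of n]] by blast
  then obtain D where D: "\<And>n. gauss_poly_le (\<lambda>_. r) m (e n) (D n)"
    "\<And>n. F (Suc n) - F n = poly (D n) (\<lambda>z. z m)"
    by metis
  define a where "a = (\<lambda>n. p0 + (\<Sum>i<n. D i))"
  obtain B where B: "\<And>n. \<bar>e n\<bar> \<le> B"
    using convergent_imp_Bseq[OF convergentI[OF e]] by (auto simp: Bseq_def)
  have C: "gauss_poly_le (\<lambda>_. r) m (max C0 B) (a n)" for n
    unfolding a_def
  proof (intro gauss_poly_le_add gauss_poly_le_sum r)
    show "gauss_poly_le (\<lambda>_. r) m (max C0 B) p0"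
      by (rule gauss_poly_le_mono[of "\<lambda>_. r", OF r p0(1)]) simp
    show "gauss_poly_le (\<lambda>_. r) m (max C0 B) (D i)" for i
      by (rule gauss_poly_le_mono[of "\<lambda>_. r", OF r D(1)]) (use B[of i] in linarith)
    show "0 \<le> max C0 B"
      using gauss_poly_le_nonneg[of "\<lambda>_. r", OF r p0(1)] by linarith
  qed
  have "F n = poly (a n) (\<lambda>z. z m)" for n
  proof (induction n)
    case (Suc n)
    have "F (Suc n) = F n + poly (D n) (\<lambda>z. z m)"
      using D(2)[of n] by (metis add_diff_cancel_left' add_diff_eq)
    then show ?case
      using Suc by (simp add: a_def add.assoc)
  qed (simp add: a_def p0)
  moreover have "a (Suc n) - a n = D n" for n
    by (simp add: a_def)
  ultimately show ?thesis
    using that[of a "max C0 B" e] C e D(1) by metis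
qed

text \<open>Here \<open>d\<close> is the order of vanishing along the last axis, finite because the
  function does not vanish at the point \<open>\<zeta>\<close> of that axis. A smaller radius
  \<open>rX\<close> for the last variable makes the term of degree \<open>d\<close> dominate the
  higher ones; radii smaller by \<open>\<theta>\<close> for the others keep the lower coefficients
  near their values at the origin, which are almost 0. Up to a scalar of value \<open>g\<close>, the
  function is then \<open>X^d + E\<close> with small \<open>E\<close>.\<close>

lemma weierstrass_preparation:
  assumes r: "0 < r" and F: "gauss_cauchy (\<lambda>_. r) (Suc m) F"
    and \<zeta>: "\<And>i. i < m \<Longrightarrow> \<zeta> i = 0" "val (\<zeta> m) \<le> r" "lim_val (\<lambda>n. F n \<zeta>) \<noteq> 0"
  obtains d s r' g where "0 < r'" "r' \<le> r" "0 < g" "\<And>k. gauss_cauchy (\<lambda>_. r') m (s k)"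
    "\<And>z. (\<And>i. i \<le> m \<Longrightarrow> val (z i) \<le> r') \<Longrightarrow>
       lim_val (\<lambda>n. F n z) = g * lim_val (\<lambda>n. z m ^ d + (\<Sum>k<d. s k n z * z m ^ k))"
proof -
  obtain a C e where a: "\<And>n. F n = poly (a n) (\<lambda>z. z m)"
    and C: "\<And>n. gauss_poly_le (\<lambda>_. r) m C (a n)"
    and e: "e \<longlonglongrightarrow> 0" and de: "\<And>n. gauss_poly_le (\<lambda>_. r) m (e n) (a (Suc n) - a n)"
    using gauss_cauchy_coeffs[OF r F] by blast
  define o0 where "o0 = (\<lambda>_::nat. 0::'k)"
  define \<alpha> where "\<alpha> = (\<lambda>k n. coeff (a n) k o0)"
  have C0: "0 \<le> C"
    using gauss_poly_le_nonneg[of "\<lambda>_. r", OF r C] .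
  have at0: "val (coeff p k o0) \<le> c / r ^ k" if "gauss_poly_le (\<lambda>_. r) m c p" for p c k
    using gauss_le_bound[of "\<lambda>_. r", OF r, of m "c / r ^ k" "coeff p k" o0] that r
    by (simp add: gauss_poly_le_def o0_def)
  have uc: "ucauchy (\<alpha> k)" for k
    unfolding ucauchy_def
  proof (rule tendsto_sandwich[OF _ _ tendsto_const])
    have "(\<lambda>n. e n / r ^ k) \<longlonglongrightarrow> 0 / r ^ k"
      using r by (intro tendsto_divide e tendsto_const) auto
    then show "(\<lambda>n. e n / r ^ k) \<longlonglongrightarrow> 0"
      by simp
    show "\<forall>\<^sub>F n in sequentially. val (\<alpha> k (Suc n) - \<alpha> k n) \<le> e n / r ^ k"
      using at0[OF de] by (simp add: \<alpha>_def)
  qed (simp add: val_nonneg)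
  \<comment> \<open>If all coefficients on the axis tended to 0, so would
    \<open>F n \<zeta>\<close>: the tail bound in the Gauss norm makes this convergence uniform in
    \<open>k\<close>.\<close>
  have "\<exists>k. lim_val (\<alpha> k) \<noteq> 0"
  proof (rule ccontr)
    assume "\<nexists>k. lim_val (\<alpha> k) \<noteq> 0"
    then have \<alpha>0: "(\<lambda>n. val (\<alpha> k n)) \<longlonglongrightarrow> 0" for k
      using tendsto_lim_val[OF uc[of k]] by simp
    have "(\<lambda>n. val (F n \<zeta>)) \<longlonglongrightarrow> 0"
      unfolding lim_sequentially
    proof (intro allI impI)
      fix c :: real assume c: "0 < c"
      then have "\<forall>\<^sub>F n in sequentially. e n < c / 2"
        using order_tendstoD(2)[OF e, of "c / 2"] by simp
      then obtain N where N: "\<And>n. N \<le> n \<Longrightarrow> e n < c / 2"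
        by (auto simp: eventually_sequentially)
      have tail: "gauss_poly_le (\<lambda>_. r) m (c / 2) (a (n + j) - a n)" if "N \<le> n" for n j
      proof (induction j)
        case 0
        then show ?case
          using c by (simp add: gauss_poly_le_0[of "\<lambda>_. r", OF r])
      next
        case (Suc j)
        have "gauss_poly_le (\<lambda>_. r) m (c / 2) (a (Suc (n + j)) - a (n + j))"
          by (rule gauss_poly_le_mono[of "\<lambda>_. r", OF r de]) (use N[of "n + j"] that in auto)
        from gauss_poly_le_add[of "\<lambda>_. r", OF r this Suc] show ?case
          by simp
      qed
      have small: "val (\<alpha> k n) \<le> c / 2 / r ^ k" if n: "N \<le> n" for n k
      proof -
        have "0 < c / 2 / r ^ k"
          using c r by simp
        then have "\<forall>\<^sub>F i in sequentially. val (\<alpha> k i) < c / 2 / r ^ k"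
          using order_tendstoD(2)[OF \<alpha>0] by blast
        then obtain M where M: "\<And>i. M \<le> i \<Longrightarrow> val (\<alpha> k i) < c / 2 / r ^ k"
          by (auto simp: eventually_sequentially)
        have "val (\<alpha> k (n + M) - \<alpha> k n) \<le> c / 2 / r ^ k"
          using at0[OF tail[OF n, of M], of k] by (simp add: \<alpha>_def)
        then show ?thesis
          using val_diff_ultrametric[of "\<alpha> k (n + M)" "\<alpha> k (n + M) - \<alpha> k n"] M[of "n + M"] by simp
      qed
      have half: "val (F n \<zeta>) \<le> c / 2" if n: "N \<le> n" for n
      proof -
        have "coeff (a n) k \<zeta> = \<alpha> k n" for k
          unfolding \<alpha>_def o0_def
          by (rule gauss_le_cong_point[of "\<lambda>_. r" m "C / r ^ k"])
            (use C[of n] \<zeta>(1) in \<open>auto simp: gauss_poly_le_def\<close>)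
        then have "F n \<zeta> = (\<Sum>k\<le>degree (a n). \<alpha> k n * \<zeta> m ^ k)"
          by (simp add: a poly_fun_apply[OF order_refl])
        moreover have "val (\<alpha> k n * \<zeta> m ^ k) \<le> c / 2" for k
        proof -
          have "val (\<alpha> k n) * val (\<zeta> m) ^ k \<le> c / 2 / r ^ k * r ^ k"
            using small[OF n] \<zeta>(2) val_nonneg c r by (intro mult_mono power_mono) auto
          then show ?thesis
            using r by (simp add: val_mult val_power)
        qed
        ultimately show ?thesis
          using c val_sum_le[of "c / 2" "{..degree (a n)}" "\<lambda>k. \<alpha> k n * \<zeta> m ^ k"] by simp
      qed
      have "dist (val (F n \<zeta>)) 0 < c" if "N \<le> n" for n
        using half[OF that] c val_nonneg[of "F n \<zeta>"] by (simp add: dist_real_def)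
      then show "\<exists>N. \<forall>n\<ge>N. dist (val (F n \<zeta>)) 0 < c"
        by blast
    qed
    then show False
      using \<zeta>(3) lim_val_eqI[of "\<lambda>n. F n \<zeta>" 0] by simp
  qed
  then obtain k where k: "lim_val (\<alpha> k) \<noteq> 0"
    by blast
  define d where "d = (LEAST k. lim_val (\<alpha> k) \<noteq> 0)"
  define g where "g = lim_val (\<alpha> d)"
  have d: "lim_val (\<alpha> k) = 0" if "k < d" for k
    using not_less_Least[of k "\<lambda>k. lim_val (\<alpha> k) \<noteq> 0"] that by (auto simp: d_def)
  have "g \<noteq> 0"
    unfolding g_def d_def using k by (rule LeastI)
  then have g: "0 < g"
    using lim_val_nonneg[OF uc[of d]] by (simp add: g_def)
  \<comment> \<open>One extra factor \<open>rX / r\<close> is small enough that each term of degree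
    above \<open>d\<close> has at most half the weight of the term of degree \<open>d\<close>. Using
    \<open>C + 1\<close> avoids division by 0.\<close>
  define rX where "rX = min r (g * r ^ Suc d / (2 * (C + 1)))"
  have rX: "0 < rX" "rX \<le> r" "C * rX \<le> g / 2 * r ^ Suc d"
  proof -
    show "0 < rX" "rX \<le> r"
      using r g C0 by (auto simp: rX_def)
    have "C * rX \<le> (C + 1) * (g * r ^ Suc d / (2 * (C + 1)))"
      using C0 r g by (intro mult_mono) (auto simp: rX_def)
    also have "\<dots> = g / 2 * r ^ Suc d"
      using C0 by (auto simp: divide_simps)
    finally show "C * rX \<le> g / 2 * r ^ Suc d" .
  qed
  \<comment> \<open>A lower bound common to the degrees \<open>k \<le> d\<close>, so that one
    \<open>\<theta>\<close> serves all of them.\<close>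
  define c where "c = Min ((\<lambda>k. rX ^ (d - k) * r ^ k) ` {..d})"
  have c: "0 < c" "\<And>k. k \<le> d \<Longrightarrow> c \<le> rX ^ (d - k) * r ^ k"
  proof -
    have "c \<in> (\<lambda>k. rX ^ (d - k) * r ^ k) ` {..d}"
      unfolding c_def by (rule Min_in) auto
    then show "0 < c"
      using rX r by auto
    show "\<And>k. k \<le> d \<Longrightarrow> c \<le> rX ^ (d - k) * r ^ k"
      unfolding c_def by (rule Min_le) auto
  qed
  define \<theta> where "\<theta> = min (min 1 (rX / r)) (g * c / (2 * (C + 1)))"
  have \<theta>: "0 < \<theta>" "\<theta> \<le> 1" "\<theta> * r \<le> rX" "\<theta> * C \<le> g / 2 * c"
  proof -
    show "0 < \<theta>" "\<theta> \<le> 1"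
      using r rX g c(1) C0 by (auto simp: \<theta>_def min_le_iff_disj)
    have "\<theta> * r \<le> rX / r * r"
      using r by (intro mult_right_mono) (auto simp: \<theta>_def)
    then show "\<theta> * r \<le> rX"
      using r by simp
    have "\<theta> * C \<le> g * c / (2 * (C + 1)) * (C + 1)"
      using C0 g c by (intro mult_mono) (auto simp: \<theta>_def)
    also have "\<dots> = g / 2 * c"
      using C0 by (auto simp: divide_simps)
    finally show "\<theta> * C \<le> g / 2 * c" .
  qed
  have \<theta>C: "\<theta> * (C / r ^ k) \<le> g / 2 * rX ^ (d - k)" if "k \<le> d" for k
  proof -
    have "\<theta> * C \<le> g / 2 * (rX ^ (d - k) * r ^ k)"
      using \<theta>(4) mult_left_mono[OF c(2)[OF that], of "g / 2"] g by linarith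
    then show ?thesis
      using r by (simp add: field_simps)
  qed
  have rXd: "rX ^ d / rX ^ k = rX ^ (d - k)" if "k \<le> d" for k
    using rX that by (simp add: power_diff)
  have "\<forall>\<^sub>F n in sequentially. val (\<alpha> k n) < g / 2 * rX ^ (d - k)" if "k < d" for k
    using tendsto_lim_val[OF uc[of k]] d[OF that] g rX order_tendstoD(2)[of _ 0 sequentially "g / 2 * rX ^ (d - k)"]
    by simp
  then have "\<forall>\<^sub>F n in sequentially. \<forall>k\<in>{..<d}. val (\<alpha> k n) < g / 2 * rX ^ (d - k)"
    by (intro eventually_ball_finite) auto
  then obtain N1 where N1: "\<And>n k. N1 \<le> n \<Longrightarrow> k < d \<Longrightarrow> val (\<alpha> k n) < g / 2 * rX ^ (d - k)"
    by (auto simp: eventually_sequentially)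
  obtain N2 where N2: "\<And>n k. N2 \<le> n \<Longrightarrow> N2 \<le> k \<Longrightarrow> val (\<alpha> d n - \<alpha> d k) < g / 2"
    using ucauchy_tail[OF uc[of d], of "g / 2"] g by auto
  obtain N3 where N3: "\<And>n. N3 \<le> n \<Longrightarrow> val (\<alpha> d n) = g"
    using uc[of d]
  proof (cases rule: ucauchy_cases)
    case 1
    then show ?thesis
      using lim_val_eqI[OF 1] \<open>g \<noteq> 0\<close> by (simp add: g_def)
  next
    case (2 c)
    then have "g = c"
      unfolding g_def by (intro lim_val_eqI tendsto_eventually)
    with 2 show ?thesis
      using that by (auto simp: eventually_sequentially)
  qed
  define N where "N = max N1 (max N2 N3)"
  \<comment> \<open>The limit of \<open>\<alpha> d\<close> need not lie in \<open>K\<close>, so a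
    late approximant normalises instead: its value is already \<open>g\<close>, and later terms
    differ from it by less than \<open>g / 2\<close>.\<close>
  define \<gamma> where "\<gamma> = \<alpha> d N"
  have \<gamma>: "val \<gamma> = g" "\<gamma> \<noteq> 0"
    using N3[of N] g val_eq_0_iff[of \<gamma>] by (auto simp: \<gamma>_def N_def)
  define \<beta> where "\<beta> = (\<lambda>k. if k = d then \<gamma> else 0)"
  have \<beta>: "val (\<alpha> k n - \<beta> k) \<le> g / 2 * rX ^ (d - k)" if "k \<le> d" "N \<le> n" for k n
    using that N1[of n k] N2[of n N]
    by (cases "k = d") (auto simp: \<beta>_def \<gamma>_def N_def intro!: less_imp_le)
  define E where "E = (\<lambda>n. smult (\<lambda>_. inverse \<gamma>) (a (n + N)) - monom 1 d)"
  \<comment> \<open>The last variable keeps the larger radius \<open>rX\<close>, needed for the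
    division; the other radii are cut down to \<open>\<theta> * r \<le> rX\<close>.\<close>
  define \<rho> where "\<rho> = (\<lambda>i. if i < m then \<theta> * r else rX)"
  have \<rho>: "0 < \<rho> i" "\<rho> i \<le> r" for i
    using \<theta> r rX by (auto simp: \<rho>_def)
  have \<rho>m: "\<rho> m = rX"
    by (simp add: \<rho>_def)
  have to_r: "gauss_le \<rho> m C' \<phi>" if "gauss_le (\<lambda>_. r) m C' \<phi>" for C' \<phi>
    by (rule gauss_le_mono[OF _ _ order_refl that]) (use \<rho> in auto)
  have E1: "gauss_poly_le \<rho> m (1 / 2 * \<rho> m ^ d) (E n)" for n
    unfolding gauss_poly_le_def
  proof
    fix k
    let ?\<phi> = "coeff (a (n + N)) k"
    have \<phi>: "gauss_le (\<lambda>_. r) m (C / r ^ k) ?\<phi>"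
      using C[of "n + N"] by (simp add: gauss_poly_le_def)
    show "gauss_le \<rho> m (1 / 2 * \<rho> m ^ d / \<rho> m ^ k) (coeff (E n) k)"
    proof (cases "k \<le> d")
      case True
      \<comment> \<open>For degrees up to \<open>d\<close> the coefficient is close to its value at
        the origin, and that value is close to \<open>\<beta> k\<close>.\<close>
      have "gauss_le (\<lambda>_. \<theta> * r) m (\<theta> * (C / r ^ k)) (\<lambda>z. ?\<phi> z - ?\<phi> (\<lambda>_. 0))"
        by (rule gauss_le_diff_origin[OF _ _ _ _ \<phi>]) (use \<theta> r in auto)
      then have "gauss_le \<rho> m (g / 2 * rX ^ (d - k)) (\<lambda>z. ?\<phi> z - \<alpha> k (n + N))"
        by (intro gauss_le_mono[of m \<rho> "\<lambda>_. \<theta> * r", OF _ _ \<theta>C[OF True]])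
          (use \<theta> r in \<open>auto simp: \<rho>_def \<alpha>_def o0_def\<close>)
      moreover have "gauss_le \<rho> m (g / 2 * rX ^ (d - k)) (\<lambda>_. \<alpha> k (n + N) - \<beta> k)"
        by (intro gauss_le_const \<rho> \<beta> True) simp
      ultimately have "gauss_le \<rho> m (g / 2 * rX ^ (d - k))
          ((\<lambda>z. ?\<phi> z - \<alpha> k (n + N)) + (\<lambda>_. \<alpha> k (n + N) - \<beta> k))"
        by (intro gauss_le_add \<rho>)
      moreover have "(\<lambda>z. ?\<phi> z - \<alpha> k (n + N)) + (\<lambda>_. \<alpha> k (n + N) - \<beta> k) = (\<lambda>z. ?\<phi> z - \<beta> k)"
        by auto
      ultimately have "gauss_le \<rho> m (g / 2 * rX ^ (d - k)) (\<lambda>z. ?\<phi> z - \<beta> k)"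
        by metis
      then have "gauss_le \<rho> m (val (inverse \<gamma>) * (g / 2 * rX ^ (d - k))) (\<lambda>z. inverse \<gamma> * (?\<phi> z - \<beta> k))"
        by (rule gauss_le_cmult[OF \<rho>(1)])
      moreover have "(\<lambda>z. inverse \<gamma> * (?\<phi> z - \<beta> k)) = coeff (E n) k"
        using \<gamma> by (auto simp: E_def \<beta>_def fun_eq_iff algebra_simps)
      moreover have "val (inverse \<gamma>) * (g / 2 * rX ^ (d - k)) = 1 / 2 * \<rho> m ^ d / \<rho> m ^ k"
        using \<gamma> g rXd[OF True] by (simp add: val_inverse \<rho>m)
      ultimately show ?thesis
        by metis
    next
      case False
      then obtain j where j: "k = Suc d + j"
        by (metis add_Suc_right add_Suc less_imp_Suc_add not_le add.commute)
      have "C * rX * (rX ^ d * rX ^ j) \<le> g / 2 * r ^ Suc d * (rX ^ d * r ^ j)"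
        by (rule mult_mono[OF rX(3) mult_left_mono[OF power_mono]]) (use rX r g C0 in auto)
      then have "C / r ^ k \<le> g / 2 * rX ^ d / rX ^ k"
        using rX r by (simp add: j power_add field_simps)
      then have "inverse g * (C / r ^ k) \<le> inverse g * (g / 2 * rX ^ d / rX ^ k)"
        using g by (intro mult_left_mono) auto
      also have "inverse g * (g / 2 * rX ^ d / rX ^ k) = 1 / 2 * rX ^ d / rX ^ k"
        using g by (simp add: divide_simps)
      finally have le: "val (inverse \<gamma>) * (C / r ^ k) \<le> 1 / 2 * \<rho> m ^ d / \<rho> m ^ k"
        by (simp only: val_inverse \<gamma> \<rho>m)
      have "gauss_le \<rho> m (val (inverse \<gamma>) * (C / r ^ k)) (\<lambda>z. inverse \<gamma> * ?\<phi> z)"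
        by (rule gauss_le_cmult[OF \<rho>(1) to_r[OF \<phi>]])
      moreover have "(\<lambda>z. inverse \<gamma> * ?\<phi> z) = coeff (E n) k"
        using False by (auto simp: E_def fun_eq_iff)
      ultimately show ?thesis
        using gauss_le_mono_bound[of \<rho>, OF \<rho>(1) _ le] by metis
    qed
  qed
  have E2: "gauss_poly_le \<rho> m (inverse g * e (n + N)) (E (Suc n) - E n)" for n
    unfolding gauss_poly_le_def
  proof
    fix k
    let ?D = "a (Suc (n + N)) - a (n + N)"
    have e0: "0 \<le> e (n + N)"
      using gauss_poly_le_nonneg[of "\<lambda>_. r", OF r de] .
    have "gauss_le (\<lambda>_. r) m (e (n + N) / r ^ k) (coeff ?D k)"
      using de[of "n + N"] by (simp only: gauss_poly_le_def)
    then have "gauss_le \<rho> m (val (inverse \<gamma>) * (e (n + N) / r ^ k)) (\<lambda>z. inverse \<gamma> * coeff ?D k z)"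
      by (intro gauss_le_cmult \<rho> to_r)
    moreover have "(\<lambda>z. inverse \<gamma> * coeff ?D k z) = coeff (E (Suc n) - E n) k"
      by (auto simp: E_def fun_eq_iff algebra_simps)
    moreover have "val (inverse \<gamma>) * (e (n + N) / r ^ k) \<le> inverse g * e (n + N) / \<rho> m ^ k"
    proof -
      have "e (n + N) / r ^ k \<le> e (n + N) / rX ^ k"
        using e0 rX by (intro divide_left_mono power_mono) (auto simp: r)
      from mult_left_mono[OF this, of "inverse g"] show ?thesis
        using g by (simp add: val_inverse \<gamma> \<rho>m)
    qed
    ultimately show "gauss_le \<rho> m (inverse g * e (n + N) / \<rho> m ^ k) (coeff (E (Suc n) - E n) k)"
      using gauss_le_mono_bound[of \<rho>, OF \<rho>(1)] by metis
  qed
  have E3: "(\<lambda>n. inverse g * e (n + N)) \<longlonglongrightarrow> 0"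
    using tendsto_mult[OF tendsto_const LIMSEQ_ignore_initial_segment[OF e, of N], of "inverse g"] by simp
  define s where "s = weierstrass_coeff d E"
  have s: "gauss_cauchy \<rho> m (s k)" for k
    unfolding s_def by (rule gauss_cauchy_weierstrass_coeff[of \<rho> "1/2", OF \<rho>(1) _ _ E1 E2 E3]) auto
  have lim: "lim_val (\<lambda>n. F n z) = g * lim_val (\<lambda>n. z m ^ d + (\<Sum>k<d. s k n z * z m ^ k))"
    if z: "\<And>i. i \<le> m \<Longrightarrow> val (z i) \<le> \<theta> * r" for z
  proof -
    have z\<rho>: "val (z i) \<le> \<rho> i" if "i \<le> m" for i
      using z[OF that] \<theta> by (auto simp: \<rho>_def)
    have uF: "ucauchy (\<lambda>n. F n z)"
      by (rule gauss_cauchy_imp_ucauchy[of "\<lambda>_. r", OF r F])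
        (metis \<rho>(2) less_Suc_eq_le order_trans z\<rho>)
    have "poly (monom 1 d + E n) (\<lambda>z. z m) z = inverse \<gamma> * F (n + N) z" for n
      by (simp add: E_def a)
    then have "val (poly (monom 1 d + E n) (\<lambda>z. z m) z) = inverse g * val (F (n + N) z)" for n
      by (simp only: val_mult val_inverse \<gamma>)
    moreover have "(\<lambda>n. inverse g * val (F (n + N) z)) \<longlonglongrightarrow> inverse g * lim_val (\<lambda>n. F n z)"
      by (intro tendsto_mult tendsto_const LIMSEQ_ignore_initial_segment tendsto_lim_val uF)
    ultimately have "(\<lambda>n. val (poly (monom 1 d + E n) (\<lambda>z. z m) z)) \<longlonglongrightarrow> inverse g * lim_val (\<lambda>n. F n z)"
      by (simp only:)
    then have "(\<lambda>n. val (z m ^ d + (\<Sum>k<d. s k n z * z m ^ k))) \<longlonglongrightarrow> inverse g * lim_val (\<lambda>n. F n z)"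
      unfolding s_def
      by (intro weierstrass_polynomial_limit[of \<rho> "1/2", OF \<rho>(1) _ _ E1 E2 E3] z\<rho>) auto
    from lim_val_eqI[OF this] show ?thesis
      using g by simp
  qed
  show ?thesis
  proof (rule that[of "\<theta> * r" g s d])
    show "0 < \<theta> * r" "\<theta> * r \<le> r" "0 < g"
      using \<theta> r g by auto
    show "gauss_cauchy (\<lambda>_. \<theta> * r) m (s k)" for k
      by (rule gauss_cauchy_mono[OF _ _ s]) (use \<theta> r in \<open>auto simp: \<rho>_def\<close>)
  qed (use lim in blast)
qed

end

section \<open>The rank inequality\<close>

text \<open>The coefficient ring now consists of sequences of functions, so one polynomial over it
  carries a whole sequence of polynomials in the last variable, of uniformly bounded degree.\<close>

lemma poly_seq_apply:
  fixes p :: "('a \<Rightarrow> 'b \<Rightarrow> 'c::comm_ring_1) poly"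
  shows "poly p X n z = (\<Sum>k\<le>degree p. coeff p k n z * X n z ^ k)"
  by (simp add: poly_fun_apply[OF order_refl] sum_fun_apply power_fun_apply)

section \<open>Algebraic dependence and relations between values\<close>

context nontrivial_nonarch_valuation
begin

abbreviation lim_val_at :: "(nat \<Rightarrow> 'k) \<Rightarrow> (nat \<Rightarrow> (nat \<Rightarrow> 'k) \<Rightarrow> 'k) \<Rightarrow> real" where
  "lim_val_at z F \<equiv> lim_val (\<lambda>n. F n z)"

context
  fixes \<rho> :: "nat \<Rightarrow> real"
  assumes radii_pos: "\<And>i. 0 < \<rho> i"
begin

lemma gauss_cauchy_sum:
  "(\<And>i. i \<in> A \<Longrightarrow> gauss_cauchy \<rho> m (f i)) \<Longrightarrow> gauss_cauchy \<rho> m (sum f A)"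
  by (induction A rule: infinite_finite_induct)
    (simp_all add: gauss_cauchy_0[of \<rho>, OF radii_pos] gauss_cauchy_add[of \<rho>, OF radii_pos])

lemma gauss_cauchy_coeff_mult:
  assumes "\<And>k. gauss_cauchy \<rho> m (coeff p k)" "\<And>k. gauss_cauchy \<rho> m (coeff q k)"
  shows "gauss_cauchy \<rho> m (coeff (p * q) k)"
  unfolding coeff_mult using assms by (intro gauss_cauchy_sum gauss_cauchy_mult radii_pos)

lemma gauss_cauchy_coeff_power:
  assumes "\<And>k. gauss_cauchy \<rho> m (coeff p k)"
  shows "gauss_cauchy \<rho> m (coeff (p ^ n) k)"
proof (induction n arbitrary: k)
  case 0
  then show ?case
    using gauss_cauchy_0[of \<rho>, OF radii_pos] gauss_cauchy_1[of \<rho>, OF radii_pos]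
    by (simp add: coeff_1)
qed (simp only: power_Suc gauss_cauchy_coeff_mult assms)

lemma lim_val_poly_eq_0:
  assumes "\<And>k. gauss_cauchy \<rho> m (coeff p k)" "\<And>k. lim_val_at z (coeff p k) = 0"
    "\<And>i. i < m \<Longrightarrow> val (z i) \<le> \<rho> i"
  shows "lim_val_at z (poly p (\<lambda>n z. z m)) = 0"
proof -
  have u: "ucauchy (\<lambda>n. coeff p k n z * z m ^ k)" "lim_val (\<lambda>n. coeff p k n z * z m ^ k) = 0" for k
    using ucauchy_mult[OF gauss_cauchy_imp_ucauchy[of \<rho>, OF radii_pos assms(1) assms(3)] ucauchy_const(1)]
      assms(2) by auto
  then show ?thesis
    unfolding poly_seq_apply using lim_val_sum_le[of "{..degree p}" "\<lambda>k n. coeff p k n z * z m ^ k" 0]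
      lim_val_nonneg[OF ucauchy_sum[of "{..degree p}" "\<lambda>k n. coeff p k n z * z m ^ k"]] by fastforce
qed

lemma ucauchy_poly:
  assumes "\<And>k. gauss_cauchy \<rho> m (coeff p k)" "\<And>i. i < m \<Longrightarrow> val (z i) \<le> \<rho> i"
  shows "ucauchy (\<lambda>n. poly p (\<lambda>n z. z m) n z)"
  unfolding poly_seq_apply
  by (intro ucauchy_sum ucauchy_mult(1) ucauchy_const(1) gauss_cauchy_imp_ucauchy[of \<rho> m "coeff p _"] radii_pos assms)

text \<open>
  Any two polynomials in one variable are algebraically dependent over the coefficients; in the
  resulting relation two terms must have the same value.
\<close>

lemma value_relation:
  fixes p q :: "(nat \<Rightarrow> (nat \<Rightarrow> 'k) \<Rightarrow> 'k) poly" and m :: nat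
  defines "P \<equiv> poly p (\<lambda>n z. z m)" and "Q \<equiv> poly q (\<lambda>n z. z m)"
  assumes U: "ultrafilter U"
    and disc: "eventually (\<lambda>z. \<forall>i<m. val (z i) \<le> \<rho> i) U"
    and p: "\<And>k. gauss_cauchy \<rho> m (coeff p k)" and q: "\<And>k. gauss_cauchy \<rho> m (coeff q k)"
    and P0: "eventually (\<lambda>z. lim_val_at z P \<noteq> 0) U" and Q0: "eventually (\<lambda>z. lim_val_at z Q \<noteq> 0) U"
  obtains x y i j i' j' where "gauss_cauchy \<rho> m x" "gauss_cauchy \<rho> m y" "(i, j) \<noteq> (i', j')"
    "eventually (\<lambda>z. lim_val_at z x \<noteq> 0) U" "eventually (\<lambda>z. lim_val_at z y \<noteq> 0) U"
    "eventually (\<lambda>z. lim_val_at z x * lim_val_at z P ^ i * lim_val_at z Q ^ j =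
        lim_val_at z y * lim_val_at z P ^ i' * lim_val_at z Q ^ j') U"
proof -
  define A where "A = {a. gauss_cauchy \<rho> m a}"
  \<comment> \<open>The Cauchy sequences whose limit vanishes along \<open>U\<close>; a prime ideal
    of \<open>A\<close> because \<open>U\<close> is an ultrafilter.\<close>
  define N where "N = {a. gauss_cauchy \<rho> m a \<and> eventually (\<lambda>z. lim_val_at z a = 0) U}"
  \<comment> \<open>With \<open>D = degree p + degree q\<close> and \<open>M = D + 1\<close> there
    are \<open>(M + 1)^2\<close> products of powers with exponents up to \<open>M\<close>. All have
    degree at most \<open>M * D\<close>, so only \<open>e = M * D + 1\<close> coefficients are to be
    annihilated, which is fewer.\<close>
  define M where "M = Suc (degree p + degree q)"
  define J where "J = {..M} \<times> {..M}"
  define e where "e = Suc (M * (degree p + degree q))"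
  define B where "B = (\<lambda>l ij. coeff (p ^ fst ij * q ^ snd ij) l)"
  have uA: "ucauchy (\<lambda>n. a n z)" if "a \<in> A" "\<forall>i<m. val (z i) \<le> \<rho> i" for a z
    using that gauss_cauchy_imp_ucauchy[of \<rho>, OF radii_pos] by (auto simp: A_def)
  have NA: "a \<in> A" if "a \<in> N" for a
    using that by (auto simp: A_def N_def)
  have mult: "eventually (\<lambda>z. lim_val_at z (a * b) = lim_val_at z a * lim_val_at z b) U"
    if "a \<in> A" "b \<in> A" for a b
    using disc by eventually_elim (use uA that in \<open>simp add: ucauchy_mult\<close>)
  have B: "B l ij \<in> A" for l ij
    unfolding B_def A_def mem_Collect_eq
    by (intro gauss_cauchy_coeff_mult gauss_cauchy_coeff_power p q)
  have "\<exists>x. (\<forall>j\<in>J. x j \<in> A) \<and> (\<exists>j\<in>J. x j \<notin> N) \<and> (\<forall>l<e. (\<Sum>j\<in>J. B l j * x j) \<in> N)"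
  proof (rule homogeneous_system_mod_prime)
    show "1 \<in> A" "\<And>a b. a \<in> A \<Longrightarrow> b \<in> A \<Longrightarrow> a + b \<in> A"
      "\<And>a b. a \<in> A \<Longrightarrow> b \<in> A \<Longrightarrow> a * b \<in> A" "\<And>a. a \<in> A \<Longrightarrow> - a \<in> A"
      using gauss_cauchy_1[of \<rho>, OF radii_pos] gauss_cauchy_add[of \<rho>, OF radii_pos]
        gauss_cauchy_mult[of \<rho>, OF radii_pos] gauss_cauchy_uminus[of \<rho>, OF radii_pos]
      by (auto simp: A_def)
    show "0 \<in> N"
      using gauss_cauchy_0[of \<rho>, OF radii_pos] by (simp add: N_def)
    show "1 \<notin> N"
      using U by (simp add: N_def ultrafilter_def)
    show "a + b \<in> N" if "a \<in> N" "b \<in> N" for a b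
    proof -
      have "eventually (\<lambda>z. lim_val_at z a = 0) U" "eventually (\<lambda>z. lim_val_at z b = 0) U"
        using that by (auto simp: N_def)
      with disc have "eventually (\<lambda>z. lim_val_at z (a + b) = 0) U"
      proof eventually_elim
        case (elim z)
        note u = uA[OF NA[OF that(1)] elim(1)] uA[OF NA[OF that(2)] elim(1)]
        show ?case
          using ucauchy_add(2)[OF u] lim_val_nonneg[OF ucauchy_add(1)[OF u]] elim by simp
      qed
      then show ?thesis
        using that gauss_cauchy_add[of \<rho>, OF radii_pos] by (auto simp: N_def)
    qed
    show "a * b \<in> N" if "a \<in> N" "b \<in> A" for a b
    proof -
      have "eventually (\<lambda>z. lim_val_at z a = 0) U"
        using that by (auto simp: N_def)
      with mult[OF NA[OF that(1)] that(2)] have "eventually (\<lambda>z. lim_val_at z (a * b) = 0) U"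
        by eventually_elim simp
      then show ?thesis
        using that gauss_cauchy_mult[of \<rho>, OF radii_pos] by (auto simp: N_def A_def)
    qed
    show "a \<in> N \<or> b \<in> N" if "a \<in> A" "b \<in> A" "a * b \<in> N" for a b
    proof -
      have "eventually (\<lambda>z. lim_val_at z (a * b) = 0) U"
        using that by (auto simp: N_def)
      with mult[OF that(1,2)] have "eventually (\<lambda>z. lim_val_at z a = 0 \<or> lim_val_at z b = 0) U"
        by eventually_elim simp
      from ultrafilter_disj[OF U this] show ?thesis
        using that by (auto simp: N_def A_def)
    qed
    show "finite J"
      by (simp add: J_def)
    show "e < card J"
      by (simp add: J_def e_def card_cartesian_product M_def)
  qed (rule B)
  then obtain x where x: "\<And>j. j \<in> J \<Longrightarrow> x j \<in> A" "\<exists>j\<in>J. x j \<notin> N"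
    "\<And>l. l < e \<Longrightarrow> (\<Sum>j\<in>J. B l j * x j) \<in> N"
    by blast
  \<comment> \<open>All coefficients of \<open>T\<close> lie in \<open>N\<close>. Its value at
    \<open>z m\<close> therefore vanishes along \<open>U\<close>, and two of its terms must
    balance.\<close>
  define T where "T = (\<Sum>ij\<in>J. smult (x ij) (p ^ fst ij * q ^ snd ij))"
  have coeff_T: "coeff T l = (\<Sum>j\<in>J. B l j * x j)" for l
    unfolding T_def coeff_sum coeff_smult B_def by (simp only: mult.commute)
  have deg: "degree (p ^ fst ij * q ^ snd ij) < e" if "ij \<in> J" for ij
  proof -
    have "degree (p ^ fst ij * q ^ snd ij) \<le> degree (p ^ fst ij) + degree (q ^ snd ij)"
      by (rule degree_mult_le)
    also have "\<dots> \<le> degree p * fst ij + degree q * snd ij"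
      by (intro add_mono degree_power_le)
    also have "\<dots> \<le> degree p * M + degree q * M"
      using that by (intro add_mono mult_left_mono) (auto simp: J_def)
    finally show ?thesis
      by (simp add: e_def algebra_simps)
  qed
  have T_N: "coeff T l \<in> N" for l
  proof (cases "l < e")
    case False
    then have "B l ij = 0" if "ij \<in> J" for ij
      unfolding B_def using deg[OF that] by (intro coeff_eq_0) auto
    then show ?thesis
      using gauss_cauchy_0[of \<rho>, OF radii_pos] by (simp add: coeff_T N_def)
  qed (simp add: coeff_T x(3))
  have "eventually (\<lambda>z. \<forall>l\<in>{..degree T}. lim_val_at z (coeff T l) = 0) U"
    using T_N by (intro eventually_ball_finite) (auto simp: N_def)
  with disc have "eventually (\<lambda>z. lim_val_at z (poly T (\<lambda>n z. z m)) = 0) U"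
  proof eventually_elim
    case (elim z)
    have "lim_val_at z (coeff T l) = 0" for l
      using elim(2) by (cases "l \<le> degree T") (auto simp: coeff_eq_0)
    then show ?case
      using elim(1) T_N by (intro lim_val_poly_eq_0) (auto simp: N_def)
  qed
  moreover have "poly T (\<lambda>n z. z m) n z = (\<Sum>ij\<in>J. x ij n z * (P n z ^ fst ij * Q n z ^ snd ij))" for n z
    unfolding T_def poly_sum P_def Q_def
    by (simp only: sum_fun_apply poly_smult poly_mult poly_power times_fun_apply power_fun_apply)
  ultimately have null: "eventually (\<lambda>z. lim_val (\<lambda>n. \<Sum>ij\<in>J. x ij n z * (P n z ^ fst ij * Q n z ^ snd ij)) = 0) U"
    by simp
  obtain k where k: "k \<in> J" "x k \<notin> N"
    using x(2) by blast
  then have "eventually (\<lambda>z. lim_val_at z (x k) \<noteq> 0) U"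
    using U x(1)[of k] by (auto simp: N_def A_def ultrafilter_def)
  with null disc P0 Q0 have "eventually (\<lambda>z. \<exists>w\<in>J \<times> J. fst w \<noteq> snd w \<and>
      lim_val_at z (x (fst w)) \<noteq> 0 \<and> lim_val_at z (x (snd w)) \<noteq> 0 \<and>
      lim_val_at z (x (fst w)) * lim_val_at z P ^ fst (fst w) * lim_val_at z Q ^ snd (fst w) =
      lim_val_at z (x (snd w)) * lim_val_at z P ^ fst (snd w) * lim_val_at z Q ^ snd (snd w)) U"
  proof eventually_elim
    case (elim z)
    have uP: "ucauchy (\<lambda>n. P n z)" "ucauchy (\<lambda>n. Q n z)"
      unfolding P_def Q_def using elim(2) p q by (auto intro!: ucauchy_poly)
    have ux: "ucauchy (\<lambda>n. x ij n z)" if "ij \<in> J" for ij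
      using uA[OF x(1)[OF that] elim(2)] .
    define s where "s = (\<lambda>ij n. x ij n z * (P n z ^ fst ij * Q n z ^ snd ij))"
    have us: "ucauchy (s ij)" if "ij \<in> J" for ij
      unfolding s_def using ux[OF that] uP by (intro ucauchy_mult ucauchy_power)
    have ls: "lim_val (s ij) = lim_val_at z (x ij) * lim_val_at z P ^ fst ij * lim_val_at z Q ^ snd ij"
      if "ij \<in> J" for ij
      unfolding s_def using ux[OF that] uP by (simp add: ucauchy_mult ucauchy_power)
    have "\<exists>i\<in>J. \<exists>j\<in>J. i \<noteq> j \<and> lim_val (s i) = lim_val (s j) \<and> lim_val (s i) \<noteq> 0"
    proof (rule lim_val_sum_zero_two_terms[of J s k])
      show "lim_val (\<lambda>n. \<Sum>i\<in>J. s i n) = 0"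
        using elim(1) by (simp only: s_def)
      show "lim_val (s k) \<noteq> 0"
        using elim ls[OF k(1)] by simp
    qed (use us k in \<open>auto simp: J_def\<close>)
    then obtain i j where "i \<in> J" "j \<in> J" "i \<noteq> j" "lim_val (s i) = lim_val (s j)" "lim_val (s i) \<noteq> 0"
      by blast
    then show ?case
      using ls by (intro bexI[of _ "(i, j)"]) (auto simp: mult.assoc)
  qed
  \<comment> \<open>The balancing pair depends on the point, but there are only finitely many
    pairs.\<close>
  then have "\<exists>w\<in>J \<times> J. eventually (\<lambda>z. fst w \<noteq> snd w \<and>
      lim_val_at z (x (fst w)) \<noteq> 0 \<and> lim_val_at z (x (snd w)) \<noteq> 0 \<and>
      lim_val_at z (x (fst w)) * lim_val_at z P ^ fst (fst w) * lim_val_at z Q ^ snd (fst w) =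
      lim_val_at z (x (snd w)) * lim_val_at z P ^ fst (snd w) * lim_val_at z Q ^ snd (snd w)) U"
    by (intro ultrafilter_bex_finite[OF U]) (auto simp: J_def)
  then obtain i j where ij: "i \<in> J" "j \<in> J" and ev: "eventually (\<lambda>z. i \<noteq> j \<and>
      lim_val_at z (x i) \<noteq> 0 \<and> lim_val_at z (x j) \<noteq> 0 \<and>
      lim_val_at z (x i) * lim_val_at z P ^ fst i * lim_val_at z Q ^ snd i =
      lim_val_at z (x j) * lim_val_at z P ^ fst j * lim_val_at z Q ^ snd j) U"
    by auto
  show ?thesis
  proof (rule that[of "x i" "x j" "fst i" "snd i" "fst j" "snd j"])
    have "i \<noteq> j"
      using eventually_happens'[OF _ ev] U by (auto simp: ultrafilter_def)
    then show "(fst i, snd i) \<noteq> (fst j, snd j)"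
      by simp
  qed (use x(1)[OF ij(1)] x(1)[OF ij(2)] in \<open>auto simp: A_def intro: eventually_mono[OF ev]\<close>)
qed

end

end

section \<open>Spans modulo bounded functions\<close>

lemma bounded_along_filtermap: "bounded_along (filtermap S U) f \<longleftrightarrow> bounded_along U (\<lambda>z. f (S z))"
  by (simp add: bounded_along_def eventually_filtermap)

text \<open>Only the number \<open>m\<close> of generators matters for the rank, so \<open>b\<close>
  may consist of arbitrary functions and the coefficients are real.\<close>

definition span_mod_bounded :: "'a filter \<Rightarrow> nat \<Rightarrow> (nat \<Rightarrow> 'a \<Rightarrow> real) \<Rightarrow> ('a \<Rightarrow> real) \<Rightarrow> bool" where
  "span_mod_bounded U m b f \<longleftrightarrow> (\<exists>c. bounded_along U (\<lambda>z. f z - (\<Sum>i<m. c i * b i z)))"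

lemma span_mod_bounded_comb:
  assumes "span_mod_bounded U m b f" "span_mod_bounded U m b g"
  shows "span_mod_bounded U m b (\<lambda>z. x * f z + y * g z)"
proof -
  obtain c c' where c: "bounded_along U (\<lambda>z. f z - (\<Sum>i<m. c i * b i z))"
    "bounded_along U (\<lambda>z. g z - (\<Sum>i<m. c' i * b i z))"
    using assms by (auto simp: span_mod_bounded_def)
  have "bounded_along U (\<lambda>z. x * (f z - (\<Sum>i<m. c i * b i z)) + y * (g z - (\<Sum>i<m. c' i * b i z)))"
    by (intro bounded_along_add bounded_along_cmult c)
  moreover have "x * (f z - (\<Sum>i<m. c i * b i z)) + y * (g z - (\<Sum>i<m. c' i * b i z)) =
      (x * f z + y * g z) - (\<Sum>i<m. (x * c i + y * c' i) * b i z)" for z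
    by (simp add: algebra_simps sum.distrib sum_distrib_left)
  ultimately show ?thesis
    unfolding span_mod_bounded_def by (intro exI[of _ "\<lambda>i. x * c i + y * c' i"]) simp
qed

lemma span_mod_bounded_cong:
  assumes "span_mod_bounded U m b f" "eventually (\<lambda>z. f z = g z) U"
  shows "span_mod_bounded U m b g"
proof -
  obtain c where "bounded_along U (\<lambda>z. f z - (\<Sum>i<m. c i * b i z))"
    using assms(1) by (auto simp: span_mod_bounded_def)
  moreover have "eventually (\<lambda>z. f z - (\<Sum>i<m. c i * b i z) = g z - (\<Sum>i<m. c i * b i z)) U"
    using assms(2) by eventually_elim simp
  ultimately have "bounded_along U (\<lambda>z. g z - (\<Sum>i<m. c i * b i z))"
    by (rule bounded_along_cong)
  then show ?thesis
    unfolding span_mod_bounded_def by blast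
qed

lemma span_mod_bounded_Suc:
  assumes "span_mod_bounded U m b (\<lambda>z. f z - a * w z)"
  shows "span_mod_bounded U (Suc m) (b(m := w)) f"
proof -
  obtain c where c: "bounded_along U (\<lambda>z. f z - a * w z - (\<Sum>i<m. c i * b i z))"
    using assms by (auto simp: span_mod_bounded_def)
  have "f z - a * w z - (\<Sum>i<m. c i * b i z) = f z - (\<Sum>i<Suc m. (c(m := a)) i * (b(m := w)) i z)" for z
    by simp
  with c show ?thesis
    unfolding span_mod_bounded_def by (intro exI[of _ "c(m := a)"]) simp
qed

section \<open>Induction on the number of variables\<close>

context nontrivial_nonarch_valuation
begin

lemma gauss_cauchy_cong_point:
  assumes "0 < r" "gauss_cauchy (\<lambda>_. r) m F" "\<And>i. i < m \<Longrightarrow> z i = z' i"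
  shows "F n z = F n z'"
proof -
  obtain C where "\<And>n. gauss_le (\<lambda>_. r) m C (F n)"
    using gauss_cauchy_bounded[of "\<lambda>_. r", OF assms(1,2)] by blast
  from gauss_le_cong_point[OF this assms(3)] show ?thesis .
qed

text \<open>
  The linear change of coordinates moving the direction \<open>\<zeta>\<close> to the last coordinate axis; the
  entries of its matrix have value at most 1 because \<open>i\<^sub>0\<close> maximizes the value of \<open>\<zeta>\<close>.
\<close>

lemma linear_change:
  fixes \<zeta> :: "nat \<Rightarrow> 'k"
  obtains T S \<eta> where
    "\<And>r F. 0 < r \<Longrightarrow> gauss_cauchy (\<lambda>_. r) (Suc m) F \<Longrightarrow> gauss_cauchy (\<lambda>_. r) (Suc m) (\<lambda>n y. F n (T y))"
    "\<And>z. T (S z) = z"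
    "\<And>e z i. \<forall>i\<le>m. val (z i) \<le> e \<Longrightarrow> i \<le> m \<Longrightarrow> val (S z i) \<le> e"
    "\<And>j. j \<le> m \<Longrightarrow> T \<eta> j = \<zeta> j" "\<And>i. i < m \<Longrightarrow> \<eta> i = 0" "\<exists>i\<le>m. \<eta> m = \<zeta> i"
proof -
  have "\<exists>i\<in>{..m}. \<forall>j\<in>{..m}. val (\<zeta> j) \<le> val (\<zeta> i)"
  proof -
    have "Max ((\<lambda>j. val (\<zeta> j)) ` {..m}) \<in> (\<lambda>j. val (\<zeta> j)) ` {..m}"
      by (rule Max_in) auto
    then obtain i where "Max ((\<lambda>j. val (\<zeta> j)) ` {..m}) = val (\<zeta> i)" "i \<in> {..m}"
      by (rule imageE)
    then show ?thesis
      by (intro bexI[of _ i]) (auto simp flip: \<open>Max _ = _\<close>)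
  qed
  then obtain i0 where i0: "i0 \<le> m" "\<And>j. j \<le> m \<Longrightarrow> val (\<zeta> j) \<le> val (\<zeta> i0)"
    by auto
  define \<mu> where "\<mu> = (\<lambda>j. if j \<le> m then \<zeta> j / \<zeta> i0 else 0)"
  define \<pi> where "\<pi> = (\<lambda>j. if j = i0 then m else if j = m then i0 else j)"
  \<comment> \<open>For \<open>\<zeta> i0 \<noteq> 0\<close> the last basis vector goes to
    \<open>\<zeta> / \<zeta> i0\<close>, and the others are permuted by the transposition
    \<open>\<pi>\<close>. If all relevant coordinates of \<open>\<zeta>\<close> are 0, then
    \<open>\<mu>\<close> is 0 and the change is a mere permutation.\<close>
  define T where "T = (\<lambda>y j. if j = i0 then y m else y (\<pi> j) + \<mu> j * y m)"
  define S where "S = (\<lambda>z k. if k = m then z i0 else z (\<pi> k) - \<mu> (\<pi> k) * z i0)"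
  define \<eta> where "\<eta> = (\<lambda>k. if k = m then \<zeta> i0 else 0)"
  have \<mu>: "val (\<mu> j) \<le> 1" for j
    using i0(2)[of j] val_nonneg[of "\<zeta> i0"]
    by (cases "\<zeta> i0 = 0") (auto simp: \<mu>_def val_divide val_eq_0_iff[symmetric] divide_le_eq_1)
  have \<pi>: "\<pi> j \<le> m" if "j \<le> m" for j
    using that i0 by (auto simp: \<pi>_def)
  have \<pi>\<pi>: "\<pi> (\<pi> j) = j" for j
    by (auto simp: \<pi>_def)
  have \<pi>m: "\<pi> j = m \<longleftrightarrow> j = i0" for j
    by (auto simp: \<pi>_def)
  have T: "gauss_le (\<lambda>_. r) (Suc m) r (\<lambda>y. T y i)" if r: "0 < r" and i: "i < Suc m" for r i
  proof (cases "i = i0")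
    case True
    then show ?thesis
      using gauss_le_var[of "\<lambda>_. r", OF r, of m "Suc m"] by (simp add: T_def)
  next
    case False
    have "gauss_le (\<lambda>_. r) (Suc m) r (\<lambda>y. y (\<pi> i))"
      using gauss_le_var[of "\<lambda>_. r", OF r, of "\<pi> i" "Suc m"] \<pi>[of i] i by simp
    moreover have "gauss_le (\<lambda>_. r) (Suc m) r (\<lambda>y. \<mu> i * y m)"
      by (rule gauss_le_mono_bound[of "\<lambda>_. r", OF r
            gauss_le_cmult[of "\<lambda>_. r", OF r gauss_le_var[of "\<lambda>_. r", OF r, of m "Suc m"]]])
        (use \<mu>[of i] r in \<open>auto simp: mult_left_le_one_le val_nonneg\<close>)
    ultimately have "gauss_le (\<lambda>_. r) (Suc m) r ((\<lambda>y. y (\<pi> i)) + (\<lambda>y. \<mu> i * y m))"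
      by (intro gauss_le_add r)
    then show ?thesis
      using False by (simp add: T_def plus_fun_def)
  qed
  have comp: "gauss_le (\<lambda>_. r) (Suc m) C (\<lambda>y. \<phi> (T y))" if r: "0 < r" and \<phi>: "gauss_le (\<lambda>_. r) (Suc m) C \<phi>" for r C \<phi>
    by (rule gauss_le_compose[OF r r \<phi>]) (rule T[OF r])
  show ?thesis
  proof (rule that[of T S \<eta>])
    fix r F assume r: "0 < r" and F: "gauss_cauchy (\<lambda>_. r) (Suc m) F"
    obtain C e where C: "gauss_le (\<lambda>_. r) (Suc m) C (F 0)" "e \<longlonglongrightarrow> 0"
      "\<And>n. gauss_le (\<lambda>_. r) (Suc m) (e n) (F (Suc n) - F n)"
      using F unfolding gauss_cauchy_def by blast
    have "gauss_le (\<lambda>_. r) (Suc m) (e n) ((\<lambda>y. F (Suc n) (T y)) - (\<lambda>y. F n (T y)))" for n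
      using comp[OF r C(3)[of n]] by (simp only: fun_diff_def)
    then show "gauss_cauchy (\<lambda>_. r) (Suc m) (\<lambda>n y. F n (T y))"
      unfolding gauss_cauchy_def using comp[OF r C(1)] C(2) by blast
  next
    show "T (S z) = z" for z
      by (rule ext) (simp add: T_def S_def \<pi>m \<pi>\<pi>)
  next
    fix e z i assume "\<forall>i\<le>m. val (z i) \<le> e" and i: "i \<le> m"
    then have e: "val (z i) \<le> e" if "i \<le> m" for i
      using that by blast
    have "val (\<mu> (\<pi> i)) * val (z i0) \<le> 1 * val (z i0)"
      by (intro mult_right_mono \<mu> val_nonneg)
    then have "val (\<mu> (\<pi> i) * z i0) \<le> e"
      using e[OF i0(1)] by (simp add: val_mult)
    then show "val (S z i) \<le> e"
      using e[OF i0(1)] e[OF \<pi>[OF i]] val_diff_ultrametric[of "z (\<pi> i)" "\<mu> (\<pi> i) * z i0"]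
      by (auto simp: S_def)
  next
    fix j assume j: "j \<le> m"
    show "T \<eta> j = \<zeta> j"
      using i0(2)[OF j] j val_nonneg[of "\<zeta> j"]
      by (cases "\<zeta> i0 = 0") (auto simp: T_def \<eta>_def \<pi>m \<mu>_def val_eq_0_iff[symmetric])
  qed (use i0 in \<open>auto simp: \<eta>_def\<close>)
qed

text \<open>
  An Abhyankar inequality: the rank of the value group along \<open>U\<close> is measured by logarithms of values
  modulo bounded functions, so constants contribute nothing.
\<close>

lemma rank_bound:
  assumes "ultrafilter U" "0 < r"
    and "\<And>e. 0 < e \<Longrightarrow> eventually (\<lambda>z. \<forall>i<m. val (z i) \<le> e) U"
    and "finite \<Phi>" "\<And>\<phi>. \<phi> \<in> \<Phi> \<Longrightarrow> gauss_cauchy (\<lambda>_. r) m \<phi>"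
    and "\<And>\<phi>. \<phi> \<in> \<Phi> \<Longrightarrow> eventually (\<lambda>z. lim_val_at z \<phi> \<noteq> 0) U"
  shows "\<exists>b. \<forall>\<phi>\<in>\<Phi>. span_mod_bounded U m b (\<lambda>z. ln (lim_val_at z \<phi>))"
  using assms
proof (induction m arbitrary: U r \<Phi>)
  case 0
  have "span_mod_bounded U 0 b (\<lambda>z. ln (lim_val_at z \<phi>))" if "\<phi> \<in> \<Phi>" for \<phi> b
  proof -
    have *: "\<phi> n z = \<phi> n (\<lambda>_. 0)" for n z
      by (rule gauss_cauchy_cong_point[OF 0(2) 0(5)[OF that]]) simp
    define c where "c = lim_val_at (\<lambda>_. 0) \<phi>"
    have "lim_val_at z \<phi> = c" for z
      unfolding c_def by (rule arg_cong[where f = lim_val], rule ext, rule *)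
    then show ?thesis
      by (simp add: span_mod_bounded_def bounded_along_const)
  qed
  then show ?case by blast
next
  case (Suc m)
  note U = Suc.prems(1) and r = Suc.prems(2) and small = Suc.prems(3) and fin = Suc.prems(4)
    and gc = Suc.prems(5) and nz = Suc.prems(6)
  have "eventually (\<lambda>z. \<forall>\<phi>\<in>\<Phi>. lim_val_at z \<phi> \<noteq> 0) U"
    using nz by (intro eventually_ball_finite fin) auto
  with small[OF r] have ev: "eventually (\<lambda>z. (\<forall>i<Suc m. val (z i) \<le> r) \<and> (\<forall>\<phi>\<in>\<Phi>. lim_val_at z \<phi> \<noteq> 0)) U"
    by eventually_elim auto
  \<comment> \<open>No member of the family vanishes at this point, so the line through it is a
    direction in which all of them are regular: a single change of coordinates serves the whole
    family.\<close>
  then obtain \<zeta> where \<zeta>: "\<And>i. i \<le> m \<Longrightarrow> val (\<zeta> i) \<le> r" "\<And>\<phi>. \<phi> \<in> \<Phi> \<Longrightarrow> lim_val_at \<zeta> \<phi> \<noteq> 0"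
  proof -
    assume *: "\<And>\<zeta>. (\<And>i. i \<le> m \<Longrightarrow> val (\<zeta> i) \<le> r) \<Longrightarrow> (\<And>\<phi>. \<phi> \<in> \<Phi> \<Longrightarrow> lim_val_at \<zeta> \<phi> \<noteq> 0) \<Longrightarrow> thesis"
    have "U \<noteq> bot"
      using U by (simp add: ultrafilter_def)
    from eventually_happens'[OF this ev] show thesis
      using * less_Suc_eq_le by blast
  qed
  obtain T S \<eta> where
    T: "\<And>r F. 0 < r \<Longrightarrow> gauss_cauchy (\<lambda>_. r) (Suc m) F \<Longrightarrow> gauss_cauchy (\<lambda>_. r) (Suc m) (\<lambda>n y. F n (T y))"
    and TS: "\<And>z. T (S z) = z"
    and S: "\<And>e z i. \<forall>i\<le>m. val (z i) \<le> e \<Longrightarrow> i \<le> m \<Longrightarrow> val (S z i) \<le> e"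
    and \<eta>: "\<And>j. j \<le> m \<Longrightarrow> T \<eta> j = \<zeta> j" "\<And>i. i < m \<Longrightarrow> \<eta> i = 0" "\<exists>i\<le>m. \<eta> m = \<zeta> i"
    by (rule linear_change[of m \<zeta>]) blast
  define V where "V = filtermap S U"
  have V: "ultrafilter V"
    unfolding V_def by (rule ultrafilter_filtermap[OF U])
  have smallV: "eventually (\<lambda>z. \<forall>i\<le>m. val (z i) \<le> e) V" if "0 < e" for e
    unfolding V_def eventually_filtermap
    using small[OF that] by eventually_elim (use S in \<open>auto simp: less_Suc_eq_le\<close>)
  define prep where "prep = (\<lambda>\<phi> d s r' g. 0 < r' \<and> r' \<le> r \<and> 0 < g \<and> (\<forall>k. gauss_cauchy (\<lambda>_. r') m (s k)) \<and>
      (\<forall>z. (\<forall>i\<le>m. val (z i) \<le> r') \<longrightarrow>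
        lim_val (\<lambda>n. \<phi> n (T z)) = g * lim_val (\<lambda>n. z m ^ d + (\<Sum>k<d. s k n z * z m ^ k))))"
  have "\<exists>d s r' g. prep \<phi> d s r' g" if "\<phi> \<in> \<Phi>" for \<phi>
  proof -
    have "\<phi> n (T \<eta>) = \<phi> n \<zeta>" for n
      by (rule gauss_cauchy_cong_point[OF r gc[OF that]]) (use \<eta>(1) in \<open>simp add: less_Suc_eq_le\<close>)
    then have l: "lim_val (\<lambda>n. \<phi> n (T \<eta>)) \<noteq> 0"
      using \<zeta>(2)[OF that] by simp
    have v: "val (\<eta> m) \<le> r"
      using \<eta>(3) \<zeta>(1) by auto
    note gT = T[OF r gc[OF that]]
    show ?thesis
    proof (rule weierstrass_preparation[of r m "\<lambda>n y. \<phi> n (T y)" \<eta>, OF r gT \<eta>(2) v l])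
      fix d s r' g
      assume "0 < r'" "r' \<le> r" "0 < g" "\<And>k. gauss_cauchy (\<lambda>_. r') m (s k)"
        "\<And>z. (\<And>i. i \<le> m \<Longrightarrow> val (z i) \<le> r') \<Longrightarrow>
           lim_val (\<lambda>n. \<phi> n (T z)) = g * lim_val (\<lambda>n. z m ^ d + (\<Sum>k<d. s k n z * z m ^ k))"
      then show ?thesis
        unfolding prep_def by (intro exI[of _ d] exI[of _ s] exI[of _ r'] exI[of _ g]) simp
    qed
  qed
  then obtain d s r' g where "\<And>\<phi>. \<phi> \<in> \<Phi> \<Longrightarrow> prep \<phi> (d \<phi>) (s \<phi>) (r' \<phi>) (g \<phi>)"
    by metis
  note W = this[unfolded prep_def]
  \<comment> \<open>A radius at which all the preparations are valid; the inserted \<open>r\<close>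
    covers an empty family.\<close>
  define R where "R = Min (insert r (r' ` \<Phi>))"
  have "R \<in> insert r (r' ` \<Phi>)"
    unfolding R_def using fin by (intro Min_in) auto
  then have R: "0 < R"
    using r W by auto
  have R_le: "R \<le> r' \<phi>" if "\<phi> \<in> \<Phi>" for \<phi>
    unfolding R_def using fin that by (intro Min_le) auto
  define P where "P = (\<lambda>\<phi>. monom 1 (d \<phi>) + (\<Sum>k<d \<phi>. monom (s \<phi> k) k))"
  define Px where "Px = (\<lambda>\<phi>. poly (P \<phi>) (\<lambda>n z. z m))"
  have Pc: "gauss_cauchy (\<lambda>_. R) m (coeff (P \<phi>) k)" if "\<phi> \<in> \<Phi>" for \<phi> k
  proof -
    have "gauss_cauchy (\<lambda>_. R) m (s \<phi> k)" for k
      by (rule gauss_cauchy_mono[of m _ "\<lambda>_. r' \<phi>"]) (use R R_le W that in auto)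
    then show ?thesis
      unfolding P_def coeff_add coeff_sum coeff_monom
      using gauss_cauchy_0[of "\<lambda>_. R", OF R] gauss_cauchy_1[of "\<lambda>_. R", OF R]
      by (intro gauss_cauchy_add gauss_cauchy_sum R) auto
  qed
  have Px: "Px \<phi> n z = z m ^ d \<phi> + (\<Sum>k<d \<phi>. s \<phi> k n z * z m ^ k)" for \<phi> n z
    by (simp add: Px_def P_def poly_sum poly_monom sum_fun_apply power_fun_apply)
  have val_Px: "eventually (\<lambda>y. lim_val (\<lambda>n. \<phi> n (T y)) = g \<phi> * lim_val_at y (Px \<phi>)) V" if "\<phi> \<in> \<Phi>" for \<phi>
    using smallV[OF R]
  proof eventually_elim
    case (elim y)
    then have "\<forall>i\<le>m. val (y i) \<le> r' \<phi>"
      using R_le[OF that] by force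
    then show ?case
      using W[OF that] by (simp add: Px)
  qed
  have nzV: "eventually (\<lambda>y. lim_val_at y (Px \<phi>) \<noteq> 0) V" if "\<phi> \<in> \<Phi>" for \<phi>
  proof -
    have "eventually (\<lambda>y. lim_val (\<lambda>n. \<phi> n (T y)) \<noteq> 0) V"
      unfolding V_def eventually_filtermap TS using nz[OF that] .
    with val_Px[OF that] show ?thesis
      by eventually_elim auto
  qed
  have discV: "eventually (\<lambda>z. \<forall>i<m. val (z i) \<le> R) V"
    using smallV[OF R] by eventually_elim auto
  have posV: "eventually (\<lambda>y. 0 < lim_val_at y F) V"
    if "gauss_cauchy (\<lambda>_. R) m F" "eventually (\<lambda>y. lim_val_at y F \<noteq> 0) V" for F
    using that(2) discV
  proof eventually_elim
    case (elim y)
    then show ?case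
      using lim_val_nonneg[OF gauss_cauchy_imp_ucauchy[of "\<lambda>_. R", OF R that(1)], of y] by auto
  qed
  have posP: "eventually (\<lambda>y. 0 < lim_val_at y (Px \<phi>)) V" if "\<phi> \<in> \<Phi>" for \<phi>
    using nzV[OF that] discV
  proof eventually_elim
    case (elim y)
    then show ?case
      using lim_val_nonneg[OF ucauchy_poly[of "\<lambda>_. R", OF R Pc[OF that]], of y] by (auto simp: Px_def)
  qed
  define dep where "dep = (\<lambda>\<phi> \<psi> x y i j i' j'.
      gauss_cauchy (\<lambda>_. R) m x \<and> gauss_cauchy (\<lambda>_. R) m y \<and> (i, j) \<noteq> (i', j') \<and>
      eventually (\<lambda>z. lim_val_at z x \<noteq> 0) V \<and> eventually (\<lambda>z. lim_val_at z y \<noteq> 0) V \<and>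
      eventually (\<lambda>z. lim_val_at z x * lim_val_at z (Px \<phi>) ^ i * lim_val_at z (Px \<psi>) ^ j =
        lim_val_at z y * lim_val_at z (Px \<phi>) ^ i' * lim_val_at z (Px \<psi>) ^ j') V)"
  have "\<exists>x y i j i' j'. dep \<phi> \<psi> x y i j i' j'" if "\<phi> \<in> \<Phi>" "\<psi> \<in> \<Phi>" for \<phi> \<psi>
  proof (rule value_relation[of "\<lambda>_. R" V m "P \<phi>" "P \<psi>", OF R V discV Pc[OF that(1)] Pc[OF that(2)]])
    show "eventually (\<lambda>z. lim_val_at z (poly (P \<phi>) (\<lambda>n z. z m)) \<noteq> 0) V"
      "eventually (\<lambda>z. lim_val_at z (poly (P \<psi>) (\<lambda>n z. z m)) \<noteq> 0) V"
      using nzV[OF that(1)] nzV[OF that(2)] by (simp_all only: Px_def)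
  qed (unfold dep_def Px_def, blast)
  then obtain x y i j i' j' where "\<And>\<phi> \<psi>. \<phi> \<in> \<Phi> \<Longrightarrow> \<psi> \<in> \<Phi> \<Longrightarrow>
      dep \<phi> \<psi> (x \<phi> \<psi>) (y \<phi> \<psi>) (i \<phi> \<psi>) (j \<phi> \<psi>) (i' \<phi> \<psi>) (j' \<phi> \<psi>)"
    by metis
  note rel = this[unfolded dep_def]
  \<comment> \<open>The coefficients of the relations for all pairs: finitely many functions of one
    variable fewer, ready for the induction hypothesis.\<close>
  define \<Psi> where "\<Psi> = (\<lambda>(\<phi>, \<psi>). x \<phi> \<psi>) ` (\<Phi> \<times> \<Phi>) \<union> (\<lambda>(\<phi>, \<psi>). y \<phi> \<psi>) ` (\<Phi> \<times> \<Phi>)"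
  have "\<exists>b. \<forall>\<phi>\<in>\<Psi>. span_mod_bounded V m b (\<lambda>z. ln (lim_val_at z \<phi>))"
  proof (rule Suc.IH[OF V R])
    show "eventually (\<lambda>z. \<forall>i<m. val (z i) \<le> e) V" if "0 < e" for e
      using smallV[OF that] by eventually_elim auto
    show "finite \<Psi>"
      using fin by (auto simp: \<Psi>_def)
  qed (use rel in \<open>auto simp: \<Psi>_def\<close>)
  then obtain b where b: "\<And>\<phi> \<psi>. \<phi> \<in> \<Phi> \<Longrightarrow> \<psi> \<in> \<Phi> \<Longrightarrow> span_mod_bounded V m b (\<lambda>z. ln (lim_val_at z (x \<phi> \<psi>)))"
    "\<And>\<phi> \<psi>. \<phi> \<in> \<Phi> \<Longrightarrow> \<psi> \<in> \<Phi> \<Longrightarrow> span_mod_bounded V m b (\<lambda>z. ln (lim_val_at z (y \<phi> \<psi>)))"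
    unfolding \<Psi>_def by fast
  define L where "L = (\<lambda>\<phi> z. ln (lim_val_at z (Px \<phi>)))"
  \<comment> \<open>The logarithm of a value relation: modulo the span of \<open>b\<close>, any two
    of the \<open>L \<phi>\<close> are dependent. The coefficients are differences of exponents and
    do not both vanish.\<close>
  have lin: "\<exists>\<alpha> \<beta>. (\<alpha>, \<beta>) \<noteq> (0, 0) \<and> span_mod_bounded V m b (\<lambda>z. \<alpha> * L \<phi> z + \<beta> * L \<psi> z)"
    if "\<phi> \<in> \<Phi>" "\<psi> \<in> \<Phi>" for \<phi> \<psi>
  proof -
    note rel' = rel[OF that]
    have "eventually (\<lambda>z. (-1) * ln (lim_val_at z (x \<phi> \<psi>)) + 1 * ln (lim_val_at z (y \<phi> \<psi>)) =
        (real (i \<phi> \<psi>) - real (i' \<phi> \<psi>)) * L \<phi> z + (real (j \<phi> \<psi>) - real (j' \<phi> \<psi>)) * L \<psi> z) V"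
    proof -
      have "eventually (\<lambda>z. 0 < lim_val_at z (x \<phi> \<psi>)) V" "eventually (\<lambda>z. 0 < lim_val_at z (y \<phi> \<psi>)) V"
        using posV rel' by blast+
      with posP[OF that(1)] posP[OF that(2)]
        rel'[THEN conjunct2, THEN conjunct2, THEN conjunct2, THEN conjunct2, THEN conjunct2]
      show ?thesis
      proof eventually_elim
        case (elim z)
        have 1: "ln (lim_val_at z (x \<phi> \<psi>) * lim_val_at z (Px \<phi>) ^ i \<phi> \<psi> * lim_val_at z (Px \<psi>) ^ j \<phi> \<psi>) =
            ln (lim_val_at z (x \<phi> \<psi>)) + i \<phi> \<psi> * L \<phi> z + j \<phi> \<psi> * L \<psi> z"
          using elim(1,2,4,5) by (simp add: ln_mult ln_realpow L_def)
        have 2: "ln (lim_val_at z (y \<phi> \<psi>) * lim_val_at z (Px \<phi>) ^ i' \<phi> \<psi> * lim_val_at z (Px \<psi>) ^ j' \<phi> \<psi>) =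
            ln (lim_val_at z (y \<phi> \<psi>)) + i' \<phi> \<psi> * L \<phi> z + j' \<phi> \<psi> * L \<psi> z"
          using elim(1,2,4,5) by (simp add: ln_mult ln_realpow L_def)
        from 1 2 show ?case
          unfolding elim(3) by (simp add: algebra_simps)
      qed
    qed
    from span_mod_bounded_cong[OF span_mod_bounded_comb[OF b(1)[OF that] b(2)[OF that]] this]
    show ?thesis
      using rel' by (intro exI[of _ "real (i \<phi> \<psi>) - real (i' \<phi> \<psi>)"] exI[of _ "real (j \<phi> \<psi>) - real (j' \<phi> \<psi>)"]) auto
  qed
  \<comment> \<open>Pairwise dependence means rank at most 1 modulo the span of \<open>b\<close>:
    one further generator suffices, namely any \<open>L \<phi>0\<close> outside the span.\<close>
  have "\<exists>w. \<forall>\<phi>\<in>\<Phi>. \<exists>a. span_mod_bounded V m b (\<lambda>z. L \<phi> z - a * w z)"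
  proof (cases "\<forall>\<phi>\<in>\<Phi>. span_mod_bounded V m b (L \<phi>)")
    case True
    then show ?thesis
      by (intro exI[of _ "\<lambda>_. 0"]) auto
  next
    case False
    then obtain \<phi>0 where \<phi>0: "\<phi>0 \<in> \<Phi>" "\<not> span_mod_bounded V m b (L \<phi>0)"
      by blast
    have "\<exists>a. span_mod_bounded V m b (\<lambda>z. L \<psi> z - a * L \<phi>0 z)" if "\<psi> \<in> \<Phi>" for \<psi>
    proof -
      note lin' = lin[OF \<phi>0(1) that]
      obtain \<alpha> \<beta> where \<alpha>\<beta>: "(\<alpha>, \<beta>) \<noteq> (0, 0)" "span_mod_bounded V m b (\<lambda>z. \<alpha> * L \<phi>0 z + \<beta> * L \<psi> z)"
        using lin' by blast
      have "\<beta> \<noteq> 0"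
      proof
        assume "\<beta> = 0"
        then have "\<alpha> \<noteq> 0" "span_mod_bounded V m b (\<lambda>z. \<alpha> * L \<phi>0 z)"
          using \<alpha>\<beta> by auto
        with span_mod_bounded_comb[OF this(2) this(2), of "1 / \<alpha>" 0] \<phi>0(2) show False
          by simp
      qed
      with span_mod_bounded_comb[OF \<alpha>\<beta>(2) \<alpha>\<beta>(2), of "1 / \<beta>" 0] show ?thesis
        by (intro exI[of _ "- \<alpha> / \<beta>"]) (simp add: field_simps)
    qed
    then show ?thesis
      by blast
  qed
  then obtain w where w: "\<And>\<phi>. \<phi> \<in> \<Phi> \<Longrightarrow> \<exists>a. span_mod_bounded V m b (\<lambda>z. L \<phi> z - a * w z)"
    by blast
  define b' where "b' = b(m := w)"
  \<comment> \<open>Going back along \<open>S\<close>; the constant \<open>g \<phi>\<close> of the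
    preparation only adds a bounded term.\<close>
  have "span_mod_bounded U (Suc m) (\<lambda>i z. b' i (S z)) (\<lambda>z. ln (lim_val_at z \<phi>))" if "\<phi> \<in> \<Phi>" for \<phi>
  proof -
    have "span_mod_bounded V (Suc m) b' (L \<phi>)"
      using w[OF that] span_mod_bounded_Suc unfolding b'_def by blast
    then obtain c where c: "bounded_along U (\<lambda>z. L \<phi> (S z) - (\<Sum>i<Suc m. c i * b' i (S z)))"
      unfolding span_mod_bounded_def V_def bounded_along_filtermap by blast
    have "eventually (\<lambda>z. lim_val_at z \<phi> = g \<phi> * lim_val_at (S z) (Px \<phi>)) U"
      "eventually (\<lambda>z. 0 < lim_val_at (S z) (Px \<phi>)) U"
      using val_Px[OF that] posP[OF that] unfolding V_def eventually_filtermap TS by auto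
    then have "eventually (\<lambda>z. ln (g \<phi>) + (L \<phi> (S z) - (\<Sum>i<Suc m. c i * b' i (S z))) =
        ln (lim_val_at z \<phi>) - (\<Sum>i<Suc m. c i * b' i (S z))) U"
      by eventually_elim (use W[OF that] in \<open>simp add: L_def ln_mult\<close>)
    from bounded_along_cong[OF bounded_along_add[OF bounded_along_const c] this] show ?thesis
      unfolding span_mod_bounded_def by blast
  qed
  then show ?case
    by blast
qed

text \<open>The \<open>m + 1\<close> logarithms lie in a space of dimension at most \<open>m\<close>
  modulo bounded functions, so a nontrivial combination of them is bounded. But each
  \<open>L i\<close> tends to infinity and exceeds every multiple of the earlier ones, so the
  highest index with nonzero coefficient dominates the combination.\<close>

lemma no_separated_values:
  assumes U: "ultrafilter U" and r: "0 < r"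
    and small: "\<And>e. 0 < e \<Longrightarrow> eventually (\<lambda>z. \<forall>i<m. val (z i) \<le> e) U"
    and gc: "\<And>i. i \<le> m \<Longrightarrow> gauss_cauchy (\<lambda>_. r) m (\<phi> i)"
    and nz: "\<And>i. i \<le> m \<Longrightarrow> eventually (\<lambda>z. lim_val_at z (\<phi> i) \<noteq> 0) U"
    and lim: "\<And>e. 0 < e \<Longrightarrow> eventually (\<lambda>z. lim_val_at z (\<phi> 0) < e) U"
    and sep: "\<And>i n. i < m \<Longrightarrow> eventually (\<lambda>z. lim_val_at z (\<phi> (Suc i)) \<le> lim_val_at z (\<phi> i) ^ n) U"
  shows False
proof -
  define L where "L = (\<lambda>i z. - ln (lim_val_at z (\<phi> i)))"
  have pos: "eventually (\<lambda>z. 0 < lim_val_at z (\<phi> i)) U" if "i \<le> m" for i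
    using nz[OF that] small[OF r]
  proof eventually_elim
    case (elim z)
    then show ?case
      using lim_val_nonneg[OF gauss_cauchy_imp_ucauchy[of "\<lambda>_. r", OF r gc[OF that]], of z] by auto
  qed
  have sep': "eventually (\<lambda>z. lim_val_at z (\<phi> j) \<le> lim_val_at z (\<phi> i) ^ n) U" if "i < j" "j \<le> m" for i j n
    using that
  proof (induction j)
    case (Suc j)
    show ?case
    proof (cases "i = j")
      case True
      then show ?thesis
        using sep[of j n] Suc.prems by simp
    next
      case False
      then have "eventually (\<lambda>z. lim_val_at z (\<phi> j) \<le> lim_val_at z (\<phi> i) ^ n) U"
        using Suc by simp
      moreover have "eventually (\<lambda>z. lim_val_at z (\<phi> (Suc j)) \<le> lim_val_at z (\<phi> j) ^ 1) U"
        using sep[of j 1] Suc.prems by simp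
      ultimately show ?thesis
        by eventually_elim simp
    qed
  qed simp
  have L_sep: "eventually (\<lambda>z. real n * L i z \<le> L j z) U" if "i < j" "j \<le> m" for i j n
  proof -
    have "eventually (\<lambda>z. 0 < lim_val_at z (\<phi> i)) U" "eventually (\<lambda>z. 0 < lim_val_at z (\<phi> j)) U"
      using pos that by auto
    with sep'[OF that, of n] show ?thesis
    proof eventually_elim
      case (elim z)
      then have "ln (lim_val_at z (\<phi> j)) \<le> ln (lim_val_at z (\<phi> i) ^ n)"
        by (subst ln_le_cancel_iff) auto
      then show ?case
        using elim by (simp add: L_def ln_realpow)
    qed
  qed
  have L0: "eventually (\<lambda>z. B < L 0 z) U" for B
  proof -
    have "eventually (\<lambda>z. lim_val_at z (\<phi> 0) < exp (- B)) U" "eventually (\<lambda>z. 0 < lim_val_at z (\<phi> 0)) U"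
      using lim pos[of 0] by auto
    then show ?thesis
    proof eventually_elim
      case (elim z)
      then have "ln (lim_val_at z (\<phi> 0)) < ln (exp (- B))"
        by (subst ln_less_cancel_iff) auto
      then show ?case
        by (simp add: L_def)
    qed
  qed
  have Lj: "eventually (\<lambda>z. B < L j z) U" if "j \<le> m" for B j
  proof (cases "j = 0")
    case False
    then have "eventually (\<lambda>z. real 1 * L 0 z \<le> L j z) U"
      using L_sep[of 0 j 1] that by simp
    with L0[of B] show ?thesis
      by eventually_elim simp
  qed (simp add: L0)
  have "\<exists>b. \<forall>\<psi>\<in>\<phi> ` {..m}. span_mod_bounded U m b (\<lambda>z. ln (lim_val_at z \<psi>))"
    by (rule rank_bound[OF U r small]) (use gc nz in auto)
  then obtain b where "\<And>i. i \<le> m \<Longrightarrow> span_mod_bounded U m b (\<lambda>z. ln (lim_val_at z (\<phi> i)))"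
    by auto
  then have "\<exists>c. \<forall>i\<le>m. bounded_along U (\<lambda>z. ln (lim_val_at z (\<phi> i)) - (\<Sum>k<m. c i k * b k z))"
    unfolding span_mod_bounded_def by metis
  then obtain c where c: "\<And>i. i \<le> m \<Longrightarrow> bounded_along U (\<lambda>z. ln (lim_val_at z (\<phi> i)) - (\<Sum>k<m. c i k * b k z))"
    by blast
  \<comment> \<open>Elimination over the reals: \<open>m\<close> equations, one per generator, in
    \<open>m + 1\<close> unknowns.\<close>
  have "\<exists>x. (\<forall>i\<in>{..m}. x i \<in> (UNIV :: real set)) \<and> (\<exists>i\<in>{..m}. x i \<notin> {0}) \<and>
      (\<forall>k<m. (\<Sum>i\<in>{..m}. c i k * x i) \<in> {0})"
    by (rule homogeneous_system_mod_prime) auto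
  then obtain x where x: "\<exists>i\<le>m. x i \<noteq> 0" "\<And>k. k < m \<Longrightarrow> (\<Sum>i\<le>m. c i k * x i) = 0"
    by auto
  have "bounded_along U (\<lambda>z. \<Sum>i\<le>m. (- x i) * (ln (lim_val_at z (\<phi> i)) - (\<Sum>k<m. c i k * b k z)))"
    by (intro bounded_along_sum bounded_along_cmult c) auto
  moreover have "(\<Sum>i\<le>m. (- x i) * (ln (lim_val_at z (\<phi> i)) - (\<Sum>k<m. c i k * b k z))) = (\<Sum>i\<le>m. x i * L i z)" for z
  proof -
    have "(\<Sum>i\<le>m. x i * (\<Sum>k<m. c i k * b k z)) = (\<Sum>k<m. (\<Sum>i\<le>m. c i k * x i) * b k z)"
      unfolding sum_distrib_left sum_distrib_right by (subst sum.swap) (simp add: mult_ac)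
    also have "\<dots> = 0"
      using x(2) by simp
    finally show ?thesis
      by (simp add: L_def algebra_simps sum.distrib sum_subtractf sum_negf)
  qed
  ultimately obtain B where B: "eventually (\<lambda>z. \<bar>\<Sum>i\<le>m. x i * L i z\<bar> \<le> B) U"
    by (auto simp: bounded_along_def)
  define t where "t = Max {i. i \<le> m \<and> x i \<noteq> 0}"
  have fin: "finite {i. i \<le> m \<and> x i \<noteq> 0}"
    by (rule finite_subset[of _ "{..m}"]) auto
  then have "t \<in> {i. i \<le> m \<and> x i \<noteq> 0}"
    unfolding t_def using x(1) by (intro Max_in) auto
  then have t: "t \<le> m" "x t \<noteq> 0"
    by auto
  have above: "x i = 0" if "t < i" "i \<le> m" for i
    using Max_ge[OF fin, of i] that unfolding t_def by fastforce
  define X where "X = (\<Sum>i<t. \<bar>x i\<bar>)"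
  \<comment> \<open>Large enough that all lower terms together are at most half of the top
    term.\<close>
  obtain n :: nat where n: "2 * X / \<bar>x t\<bar> < n"
    using reals_Archimedean2 by blast
  have X0: "0 \<le> X"
    by (simp add: X_def sum_nonneg)
  have n0: "0 < real n" "2 * X < real n * \<bar>x t\<bar>"
  proof -
    show "2 * X < real n * \<bar>x t\<bar>"
      using n t(2) by (simp add: field_simps)
    have "0 \<le> 2 * X / \<bar>x t\<bar>"
      using X0 by simp
    then show "0 < real n"
      using n by linarith
  qed
  have "eventually (\<lambda>z. \<forall>i\<in>{..<t}. real n * L i z \<le> L t z) U"
    using L_sep t(1) by (intro eventually_ball_finite) auto
  moreover have "eventually (\<lambda>z. \<forall>i\<in>{..<t}. 0 < L i z) U"
    using Lj t(1) by (intro eventually_ball_finite) auto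
  ultimately have "eventually (\<lambda>z. False) U"
    using B Lj[OF t(1), of "2 * B / \<bar>x t\<bar>"] Lj[OF t(1), of 0]
  proof eventually_elim
    case (elim z)
    have "(\<Sum>i\<le>m. x i * L i z) = (\<Sum>i\<le>t. x i * L i z)"
      by (rule sum.mono_neutral_right) (use t(1) above in auto)
    also have "\<dots> = (\<Sum>i<t. x i * L i z) + x t * L t z"
      by (simp add: lessThan_Suc_atMost[symmetric])
    finally have eq: "(\<Sum>i\<le>m. x i * L i z) = (\<Sum>i<t. x i * L i z) + x t * L t z" .
    have "\<bar>\<Sum>i<t. x i * L i z\<bar> \<le> (\<Sum>i<t. \<bar>x i\<bar> * (L t z / n))"
    proof (rule order_trans[OF sum_abs], rule sum_mono)
      fix i assume "i \<in> {..<t}"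
      then have "L i z \<le> L t z / n" "0 < L i z"
        using elim(1,2) n0(1) by (auto simp: field_simps)
      then show "\<bar>x i * L i z\<bar> \<le> \<bar>x i\<bar> * (L t z / n)"
        by (simp add: abs_mult mult_left_mono del: times_divide_eq_right)
    qed
    also have "\<dots> = X * L t z / n"
      by (simp add: X_def sum_distrib_right sum_divide_distrib)
    also have "\<dots> \<le> \<bar>x t\<bar> / 2 * L t z"
      using n0 elim(5) mult_right_mono[OF less_imp_le[OF n0(2)], of "L t z"] by (simp add: field_simps)
    finally have "\<bar>x t * L t z\<bar> - \<bar>x t\<bar> / 2 * L t z \<le> B"
      using elim(3) unfolding eq by linarith
    then have "\<bar>x t\<bar> * L t z \<le> 2 * B"
      using elim(5) by (simp add: abs_mult)
    then show False
      using elim(4) t(2) by (simp add: field_simps)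
  qed
  then show False
    using U by (simp add: ultrafilter_def trivial_limit_def)
qed

end

section \<open>A calculus of difference quotients\<close>

type_synonym 'k point_dirs_steps = "(nat \<Rightarrow> 'k) \<times> (nat \<Rightarrow> nat \<Rightarrow> 'k) \<times> (nat \<Rightarrow> 'k)"

definition shift_point :: "nat \<Rightarrow> 'k::field point_dirs_steps \<Rightarrow> 'k point_dirs_steps" where
  "shift_point j = (\<lambda>(x, v, t). (\<lambda>i. x i + t j * v j i, v, t))"

definition step :: "nat \<Rightarrow> 'k point_dirs_steps \<Rightarrow> 'k" where
  "step j = (\<lambda>(x, v, t). t j)"

text \<open>Acts on functions of base point, directions and steps together. Quotients for different
  indices then are commuting operators, and the expressions arising in the chain rule may depend on
  directions and steps as well.\<close>

definition diff_quot :: "nat \<Rightarrow> ('k::field point_dirs_steps \<Rightarrow> 'k) \<Rightarrow> 'k point_dirs_steps \<Rightarrow> 'k" where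
  "diff_quot j A p = (A (shift_point j p) - A p) / step j p"

lemma step_shift_point [simp]: "step i (shift_point j p) = step i p"
  by (cases p) (simp add: step_def shift_point_def)

lemma shift_point_eq: "step j p \<noteq> 0 \<Longrightarrow> A (shift_point j p) = A p + step j p * diff_quot j A p"
  by (simp add: diff_quot_def)

text \<open>The scalar form of \<open>Phi\<close> on coordinate functions instead of vectors;
  \<open>Phi_vec1\<close> matches the two.\<close>

primrec iter_diff_quot ::
  "nat \<Rightarrow> ((nat \<Rightarrow> 'k::field) \<Rightarrow> 'k) \<Rightarrow> (nat \<Rightarrow> 'k) \<Rightarrow> (nat \<Rightarrow> nat \<Rightarrow> 'k) \<Rightarrow> (nat \<Rightarrow> 'k) \<Rightarrow> 'k" where
  "iter_diff_quot 0 G x v t = G x"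
| "iter_diff_quot (Suc k) G x v t =
     (iter_diff_quot k G (\<lambda>i. x i + t k * v k i) v t - iter_diff_quot k G x v t) / t k"

lemma iter_diff_quot_cong:
  "(\<And>l. l < k \<Longrightarrow> v l = v' l) \<Longrightarrow> (\<And>l. l < k \<Longrightarrow> t l = t' l) \<Longrightarrow>
     iter_diff_quot k G x v t = iter_diff_quot k G x v' t'"
proof (induction k arbitrary: x)
  case (Suc k)
  then have "iter_diff_quot k G y v t = iter_diff_quot k G y v' t'" for y
    by simp
  moreover have "v k = v' k" "t k = t' k"
    using Suc.prems by auto
  ultimately show ?case
    by simp
qed simp

text \<open>The two quotients share their initial point, so their difference compares end points,
  which lie \<open>t i * s * b\<close> apart. Divided by \<open>t i\<close>, this is
  \<open>s\<close> times a quotient that starts at the end point for \<open>a\<close> and has step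
  \<open>t i * s\<close>.\<close>

lemma iter_diff_quot_direction:
  assumes "i < k" "s \<noteq> 0"
  shows "iter_diff_quot k G x (v(i := \<lambda>c. a c + s * b c)) t - iter_diff_quot k G x (v(i := a)) t =
    s * iter_diff_quot k G (\<lambda>c. x c + t i * a c) (v(i := b)) (t(i := t i * s))"
  using assms(1)
proof (induction k arbitrary: x)
  case (Suc k)
  show ?case
  proof (cases "i = k")
    case True
    define D where "D = (\<lambda>y. iter_diff_quot k G y v t)"
    have D: "iter_diff_quot k G y (v(k := w)) t' = D y" if "\<And>l. l < k \<Longrightarrow> t' l = t l" for y w t'
      unfolding D_def using that by (intro iter_diff_quot_cong) auto
    have Suc_k: "iter_diff_quot (Suc k) G y (v(k := w)) t' = (D (\<lambda>i. y i + t' k * w i) - D y) / t' k"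
      if "\<And>l. l < k \<Longrightarrow> t' l = t l" for y w t'
      by (simp only: iter_diff_quot.simps fun_upd_same D[OF that])
    have *: "(\<lambda>c. x c + t k * (a c + s * b c)) = (\<lambda>c. x c + t k * a c + t k * s * b c)"
      by (simp add: algebra_simps)
    have 1: "iter_diff_quot (Suc k) G (\<lambda>c. x c + t k * a c) (v(k := b)) (t(k := t k * s)) =
        (D (\<lambda>c. x c + t k * a c + t k * s * b c) - D (\<lambda>c. x c + t k * a c)) / (t k * s)"
      by (subst Suc_k) simp_all
    have 2: "(y - z) / t k - (w - z) / t k = s * ((y - w) / (t k * s))" for y z w
      using assms(2) by (cases "t k = 0") (simp_all add: field_simps)
    show ?thesis
      unfolding True Suc_k[of t, OF refl] * 1 by (rule 2)
  next
    case False
    define v1 v2 v3 t3 where "v1 = v(i := \<lambda>c. a c + s * b c)" and "v2 = v(i := a)"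
      and "v3 = v(i := b)" and "t3 = t(i := t i * s)"
    have *: "v1 k = v k" "v2 k = v k" "v3 k = v k" "t3 k = t k"
      using False by (simp_all add: v1_def v2_def v3_def t3_def)
    have "i < k"
      using Suc.prems False by simp
    have "iter_diff_quot k G y v1 t - iter_diff_quot k G y v2 t =
        s * iter_diff_quot k G (\<lambda>c. y c + t i * a c) v3 t3" for y
      unfolding v1_def v2_def v3_def t3_def by (rule Suc.IH[OF \<open>i < k\<close>])
    then have IH: "iter_diff_quot k G y v1 t =
        iter_diff_quot k G y v2 t + s * iter_diff_quot k G (\<lambda>c. y c + t i * a c) v3 t3" for y
      by (metis diff_add_cancel add.commute)
    have "(\<lambda>c. x c + t k * v k c + t i * a c) = (\<lambda>c. x c + t i * a c + t k * v k c)"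
      by (simp add: algebra_simps)
    then have "iter_diff_quot (Suc k) G x v1 t - iter_diff_quot (Suc k) G x v2 t =
        s * iter_diff_quot (Suc k) G (\<lambda>c. x c + t i * a c) v3 t3"
      by (simp only: iter_diff_quot.simps * IH) (simp add: diff_divide_distrib add_divide_distrib right_diff_distrib)
    then show ?thesis
      by (simp only: v1_def v2_def v3_def t3_def)
  qed
qed simp

section \<open>Limits and smoothness in terms of values\<close>

context nontrivial_nonarch_valuation
begin

definition val_tendsto :: "('a \<Rightarrow> 'k) \<Rightarrow> 'k \<Rightarrow> 'a filter \<Rightarrow> bool" where
  "val_tendsto A L F \<longleftrightarrow> ((\<lambda>p. val (A p - L)) \<longlongrightarrow> 0) F"

lemma val_tendstoI:
  assumes "(g \<longlongrightarrow> 0) F" "eventually (\<lambda>p. val (A p - L) \<le> g p) F"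
  shows "val_tendsto A L F"
  unfolding val_tendsto_def
  by (rule Lim_null_comparison[OF _ assms(1)]) (use assms(2) in \<open>simp add: val_nonneg\<close>)

lemma val_tendsto_iff: "val_tendsto A L F \<longleftrightarrow> (\<forall>e>0. eventually (\<lambda>p. val (A p - L) < e) F)"
  by (simp add: val_tendsto_def tendsto_iff dist_real_def val_nonneg)

lemma val_tendsto_const: "val_tendsto (\<lambda>_. c) c F"
  by (simp add: val_tendsto_def)

lemma val_tendsto_cong:
  "val_tendsto A L F \<Longrightarrow> eventually (\<lambda>p. A p = B p) F \<Longrightarrow> val_tendsto B L F"
  unfolding val_tendsto_def by (erule Lim_transform_eventually) (auto elim: eventually_mono)

lemma val_tendsto_add:
  assumes "val_tendsto A L F" "val_tendsto B M F"
  shows "val_tendsto (\<lambda>p. A p + B p) (L + M) F"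
proof (rule val_tendstoI)
  show "((\<lambda>p. val (A p - L) + val (B p - M)) \<longlongrightarrow> 0) F"
    using tendsto_add[OF assms[unfolded val_tendsto_def]] by simp
  have "val (A p + B p - (L + M)) \<le> val (A p - L) + val (B p - M)" for p
    using val_ultrametric[of "A p - L" "B p - M"] val_nonneg[of "A p - L"] val_nonneg[of "B p - M"]
    by (simp add: add_diff_add)
  then show "eventually (\<lambda>p. val (A p + B p - (L + M)) \<le> val (A p - L) + val (B p - M)) F"
    by simp
qed

lemma val_tendsto_mult:
  assumes "val_tendsto A L F" "val_tendsto B M F"
  shows "val_tendsto (\<lambda>p. A p * B p) (L * M) F"
proof (rule val_tendstoI)
  let ?g = "\<lambda>p. val (A p - L) * val (B p - M) + (val L * val (B p - M) + val (A p - L) * val M)"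
  have "(?g \<longlongrightarrow> 0 * 0 + (val L * 0 + 0 * val M)) F"
    using assms unfolding val_tendsto_def by (intro tendsto_add tendsto_mult tendsto_const)
  then show "(?g \<longlongrightarrow> 0) F"
    by simp
  have "val (A p * B p - L * M) \<le> ?g p" for p
  proof -
    have *: "val (a + b) \<le> val a + val b" for a b
      using val_ultrametric[of a b] val_nonneg[of a] val_nonneg[of b] by linarith
    have "A p * B p - L * M = (A p - L) * (B p - M) + (L * (B p - M) + (A p - L) * M)"
      by (simp add: algebra_simps)
    then show ?thesis
      using *[of "(A p - L) * (B p - M)" "L * (B p - M) + (A p - L) * M"]
        *[of "L * (B p - M)" "(A p - L) * M"] by (simp add: val_mult)
  qed
  then show "eventually (\<lambda>p. val (A p * B p - L * M) \<le> ?g p) F"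
    by simp
qed

lemma val_tendsto_inverse:
  assumes "val_tendsto A L F" "L \<noteq> 0"
  shows "val_tendsto (\<lambda>p. inverse (A p)) (inverse L) F" "eventually (\<lambda>p. A p \<noteq> 0) F"
proof -
  have L: "0 < val L"
    using assms(2) by (simp add: val_pos_iff)
  then have ev: "eventually (\<lambda>p. val (A p - L) < val L) F"
    using assms(1) by (simp add: val_tendsto_iff)
  then show "eventually (\<lambda>p. A p \<noteq> 0) F"
    by eventually_elim auto
  show "val_tendsto (\<lambda>p. inverse (A p)) (inverse L) F"
  proof (rule val_tendstoI)
    have "((\<lambda>p. val (A p - L) / (val L * val L)) \<longlongrightarrow> 0 / (val L * val L)) F"
      using assms(1) L unfolding val_tendsto_def by (intro tendsto_divide tendsto_const) auto
    then show "((\<lambda>p. val (A p - L) / (val L * val L)) \<longlongrightarrow> 0) F"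
      by simp
    show "eventually (\<lambda>p. val (inverse (A p) - inverse L) \<le> val (A p - L) / (val L * val L)) F"
      using ev
    proof eventually_elim
      case (elim p)
      then have vA: "val (A p) = val L" and "A p \<noteq> 0"
        using val_eq_of_diff_less[OF elim] by auto
      then have "inverse (A p) - inverse L = (L - A p) / (A p * L)"
        using assms(2) by (simp add: field_simps)
      then show ?case
        using vA by (simp add: val_divide val_mult val_diff_commute)
    qed
  qed
qed

text \<open>Indices from \<open>J\<close> may repeat and come in any order; product and chain rule
  are proved by induction on this uniform condition.\<close>

primrec smooth_along ::
  "'k point_dirs_steps filter \<Rightarrow> nat set \<Rightarrow> nat \<Rightarrow> ('k point_dirs_steps \<Rightarrow> 'k) \<Rightarrow> bool" where
  "smooth_along F J 0 A \<longleftrightarrow> (\<exists>L. val_tendsto A L F)"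
| "smooth_along F J (Suc n) A \<longleftrightarrow> (\<exists>L. val_tendsto A L F) \<and> (\<forall>j\<in>J. smooth_along F J n (diff_quot j A))"

text \<open>Limits are required also at points with vanishing steps, but are approached through
  nonzero steps only. This amounts to a continuous extension of every \<open>Phi k\<close> without
  naming the extension.\<close>

definition smooth_fun :: "nat \<Rightarrow> ((nat \<Rightarrow> 'k) \<Rightarrow> 'k) \<Rightarrow> bool" where
  "smooth_fun d G \<longleftrightarrow> (\<forall>k x0 v0 t0. \<exists>L. \<forall>e>0. \<exists>\<delta>>0. \<forall>x v t.
     (\<forall>c<d. val (x c - x0 c) < \<delta>) \<longrightarrow> (\<forall>l<k. \<forall>c<d. val (v l c - v0 l c) < \<delta>) \<longrightarrow>
     (\<forall>l<k. val (t l - t0 l) < \<delta> \<and> t l \<noteq> 0) \<longrightarrow> val (iter_diff_quot k G x v t - L) < e)"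

lemma smooth_fun_tendsto:
  assumes "smooth_fun d G"
    and W: "\<And>c. c < d \<Longrightarrow> \<exists>L. val_tendsto (\<lambda>p. W p c) L F"
    and V: "\<And>l c. l < k \<Longrightarrow> c < d \<Longrightarrow> \<exists>L. val_tendsto (\<lambda>p. V l p c) L F"
    and T: "\<And>l. l < k \<Longrightarrow> \<exists>L. val_tendsto (T l) L F" "\<And>l. l < k \<Longrightarrow> eventually (\<lambda>p. T l p \<noteq> 0) F"
  shows "\<exists>L. val_tendsto (\<lambda>p. iter_diff_quot k G (W p) (\<lambda>l. V l p) (\<lambda>l. T l p)) L F"
proof -
  obtain w where w: "\<And>c. c < d \<Longrightarrow> val_tendsto (\<lambda>p. W p c) (w c) F"
    using W by metis
  have "\<forall>l c. \<exists>L. l < k \<longrightarrow> c < d \<longrightarrow> val_tendsto (\<lambda>p. V l p c) L F"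
    using V by blast
  then obtain v where v: "\<And>l c. l < k \<Longrightarrow> c < d \<Longrightarrow> val_tendsto (\<lambda>p. V l p c) (v l c) F"
    by metis
  obtain t where t: "\<And>l. l < k \<Longrightarrow> val_tendsto (T l) (t l) F"
    using T(1) by metis
  obtain L where L: "\<And>e. 0 < e \<Longrightarrow> \<exists>\<delta>>0. \<forall>x v' t'.
     (\<forall>c<d. val (x c - w c) < \<delta>) \<longrightarrow> (\<forall>l<k. \<forall>c<d. val (v' l c - v l c) < \<delta>) \<longrightarrow>
     (\<forall>l<k. val (t' l - t l) < \<delta> \<and> t' l \<noteq> 0) \<longrightarrow> val (iter_diff_quot k G x v' t' - L) < e"
    using assms(1) unfolding smooth_fun_def by blast
  have "val_tendsto (\<lambda>p. iter_diff_quot k G (W p) (\<lambda>l. V l p) (\<lambda>l. T l p)) L F"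
    unfolding val_tendsto_iff
  proof (intro allI impI)
    fix e :: real assume "0 < e"
    then obtain \<delta> where \<delta>: "0 < \<delta>" "\<And>x v' t'.
       (\<forall>c<d. val (x c - w c) < \<delta>) \<Longrightarrow> (\<forall>l<k. \<forall>c<d. val (v' l c - v l c) < \<delta>) \<Longrightarrow>
       (\<forall>l<k. val (t' l - t l) < \<delta> \<and> t' l \<noteq> 0) \<Longrightarrow> val (iter_diff_quot k G x v' t' - L) < e"
      using L by blast
    have "eventually (\<lambda>p. \<forall>c\<in>{..<d}. val (W p c - w c) < \<delta>) F"
      using w \<delta>(1) by (intro eventually_ball_finite) (auto simp: val_tendsto_iff)
    moreover have "eventually (\<lambda>p. \<forall>l\<in>{..<k}. \<forall>c\<in>{..<d}. val (V l p c - v l c) < \<delta>) F"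
      using v \<delta>(1) by (intro eventually_ball_finite ballI) (auto simp: val_tendsto_iff)
    moreover have "eventually (\<lambda>p. \<forall>l\<in>{..<k}. val (T l p - t l) < \<delta> \<and> T l p \<noteq> 0) F"
      using t \<delta>(1) T(2) by (intro eventually_ball_finite ballI eventually_conj) (auto simp: val_tendsto_iff)
    ultimately show "eventually (\<lambda>p. val (iter_diff_quot k G (W p) (\<lambda>l. V l p) (\<lambda>l. T l p) - L) < e) F"
      by eventually_elim (rule \<delta>(2), auto)
  qed
  then show ?thesis ..
qed

section \<open>Smoothness under arithmetic, shifts and composition\<close>

context
  fixes F :: "'k point_dirs_steps filter" and J :: "nat set"
  assumes shift_lim: "\<And>j. j \<in> J \<Longrightarrow> filterlim (shift_point j) F F"
    and step_lim: "\<And>j. j \<in> J \<Longrightarrow> val_tendsto (step j) 0 F"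
    and step_nz: "\<And>j. j \<in> J \<Longrightarrow> eventually (\<lambda>p. step j p \<noteq> 0) F"
begin

abbreviation "smooth \<equiv> smooth_along F J"

lemma smooth_imp_tendsto: "smooth n A \<Longrightarrow> \<exists>L. val_tendsto A L F"
  by (cases n) auto

lemma diff_quot_eventually_cong:
  assumes "eventually (\<lambda>p. A p = B p) F" "j \<in> J"
  shows "eventually (\<lambda>p. diff_quot j A p = diff_quot j B p) F"
  using assms(1) eventually_compose_filterlim[OF assms(1) shift_lim[OF assms(2)]]
  by eventually_elim (simp add: diff_quot_def)

lemma smooth_cong: "smooth n A \<Longrightarrow> eventually (\<lambda>p. A p = B p) F \<Longrightarrow> smooth n B"
proof (induction n arbitrary: A B)
  case 0
  then show ?case
    using val_tendsto_cong by fastforce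
next
  case (Suc n)
  then show ?case
    using val_tendsto_cong[of A _ F B] diff_quot_eventually_cong[of A B] by auto
qed

lemma smooth_Suc: "smooth (Suc n) A \<Longrightarrow> smooth n A"
  by (induction n arbitrary: A) auto

text \<open>Quantities that no shift moves, such as steps and directions, behave like constants:
  their quotients vanish.\<close>

lemma smooth_invariant:
  assumes "\<And>j p. j \<in> J \<Longrightarrow> A (shift_point j p) = A p" "\<exists>L. val_tendsto A L F"
  shows "smooth n A"
  using assms
proof (induction n arbitrary: A)
  case (Suc n)
  have "diff_quot j A = (\<lambda>_. 0)" if "j \<in> J" for j
    using Suc.prems(1)[OF that] by (auto simp: diff_quot_def)
  moreover have "smooth n (\<lambda>_. 0)"
    using val_tendsto_const by (intro Suc.IH) auto
  ultimately show ?case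
    using Suc.prems(2) by simp
qed auto

lemma smooth_const: "smooth n (\<lambda>_. c)"
  using val_tendsto_const by (intro smooth_invariant) auto

lemma smooth_step: "j \<in> J \<Longrightarrow> smooth n (step j)"
  using step_lim by (intro smooth_invariant) auto

lemma smooth_add: "smooth n A \<Longrightarrow> smooth n B \<Longrightarrow> smooth n (\<lambda>p. A p + B p)"
proof (induction n arbitrary: A B)
  case 0
  then show ?case
    using val_tendsto_add by fastforce
next
  case (Suc n)
  have "diff_quot j (\<lambda>p. A p + B p) = (\<lambda>p. diff_quot j A p + diff_quot j B p)" for j
    by (simp add: diff_quot_def add_divide_distrib diff_divide_distrib fun_eq_iff)
  moreover have "\<exists>L. val_tendsto (\<lambda>p. A p + B p) L F"
    using Suc.prems by (auto intro: val_tendsto_add)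
  ultimately show ?case
    using Suc by auto
qed

lemma smooth_mult: "smooth n A \<Longrightarrow> smooth n B \<Longrightarrow> smooth n (\<lambda>p. A p * B p)"
proof (induction n arbitrary: A B)
  case 0
  then show ?case
    using val_tendsto_mult by fastforce
next
  case (Suc n)
  have "smooth n (diff_quot j (\<lambda>p. A p * B p))" if j: "j \<in> J" for j
  proof (rule smooth_cong)
    show "smooth n (\<lambda>p. diff_quot j A p * B p + (A p + step j p * diff_quot j A p) * diff_quot j B p)"
      using Suc.prems smooth_Suc j by (intro smooth_add Suc.IH smooth_step) auto
    show "eventually (\<lambda>p. diff_quot j A p * B p + (A p + step j p * diff_quot j A p) * diff_quot j B p =
        diff_quot j (\<lambda>p. A p * B p) p) F"
      using step_nz[OF j] by eventually_elim (simp add: diff_quot_def field_simps)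
  qed
  moreover have "\<exists>L. val_tendsto (\<lambda>p. A p * B p) L F"
    using Suc.prems by (auto intro: val_tendsto_mult)
  ultimately show ?case
    by auto
qed

lemma smooth_diff: "smooth n A \<Longrightarrow> smooth n B \<Longrightarrow> smooth n (\<lambda>p. A p - B p)"
  using smooth_add[of n A "\<lambda>p. - 1 * B p"] smooth_mult[OF smooth_const, of n B "- 1"] by simp

lemma smooth_sum: "(\<And>i. i \<in> I \<Longrightarrow> smooth n (A i)) \<Longrightarrow> smooth n (\<lambda>p. \<Sum>i\<in>I. A i p)"
  by (induction I rule: infinite_finite_induct) (simp_all add: smooth_const smooth_add)

lemma smooth_power: "smooth n A \<Longrightarrow> smooth n (\<lambda>p. A p ^ k)"
  by (induction k) (simp_all add: smooth_const smooth_mult)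

text \<open>A shift costs one order of smoothness, as the shifted function is \<open>A\<close> plus
  the step times its quotient.\<close>

lemma smooth_shift:
  assumes "smooth (Suc n) A" "j \<in> J"
  shows "smooth n (\<lambda>p. A (shift_point j p))"
proof (rule smooth_cong)
  show "smooth n (\<lambda>p. A p + step j p * diff_quot j A p)"
    using assms smooth_Suc by (intro smooth_add smooth_mult smooth_step) auto
  show "eventually (\<lambda>p. A p + step j p * diff_quot j A p = A (shift_point j p)) F"
    using step_nz[OF assms(2)] by eventually_elim (simp add: shift_point_eq)
qed

lemma val_tendsto_shift:
  assumes "val_tendsto A L F" "j \<in> J"
  shows "val_tendsto (\<lambda>p. A (shift_point j p)) L F"
  using filterlim_compose[OF assms(1)[unfolded val_tendsto_def] shift_lim[OF assms(2)]]
  by (simp add: val_tendsto_def)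

lemma smooth_inverse:
  "smooth n A \<Longrightarrow> val_tendsto A L F \<Longrightarrow> L \<noteq> 0 \<Longrightarrow> smooth n (\<lambda>p. inverse (A p))"
proof (induction n arbitrary: A)
  case 0
  then show ?case
    using val_tendsto_inverse(1) by fastforce
next
  case (Suc n)
  have "smooth n (diff_quot j (\<lambda>p. inverse (A p)))" if j: "j \<in> J" for j
  proof (rule smooth_cong)
    have "smooth n (\<lambda>p. inverse (A (shift_point j p)))"
      using Suc.prems j by (intro Suc.IH smooth_shift val_tendsto_shift)
    moreover have "smooth n (\<lambda>p. inverse (A p))"
      using Suc.prems smooth_Suc by (intro Suc.IH)
    ultimately show "smooth n (\<lambda>p. - 1 * diff_quot j A p * (inverse (A p) * inverse (A (shift_point j p))))"
      using Suc.prems j by (intro smooth_mult smooth_const) auto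
    show "eventually (\<lambda>p. - 1 * diff_quot j A p * (inverse (A p) * inverse (A (shift_point j p))) =
        diff_quot j (\<lambda>p. inverse (A p)) p) F"
      using step_nz[OF j] val_tendsto_inverse(2)[OF Suc.prems(2,3)]
        val_tendsto_inverse(2)[OF val_tendsto_shift[OF Suc.prems(2) j] Suc.prems(3)]
      by eventually_elim (simp add: diff_quot_def field_simps)
  qed
  then show ?case
    using Suc.prems val_tendsto_inverse(1)[OF Suc.prems(2,3)] by auto
qed

text \<open>
  The chain rule: a difference quotient of an expression in \<open>\<Phi>\<^sup>k G\<close> is again a sum of such expressions.
  Moving the base point gives one with \<open>\<Phi>\<^sup>k\<^sup>+\<^sup>1 G\<close>; moving the \<open>i\<close>-th direction gives one whose \<open>i\<close>-th
  step is multiplied by the new step.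
\<close>

lemma smooth_compose:
  assumes "smooth_fun d G"
    and "\<And>c. c < d \<Longrightarrow> smooth n (\<lambda>p. W p c)"
    and "\<And>l c. l < k \<Longrightarrow> c < d \<Longrightarrow> smooth n (\<lambda>p. V l p c)"
    and "\<And>l. l < k \<Longrightarrow> \<exists>L. val_tendsto (T l) L F" "\<And>l. l < k \<Longrightarrow> eventually (\<lambda>p. T l p \<noteq> 0) F"
      "\<And>l j p. l < k \<Longrightarrow> j \<in> J \<Longrightarrow> T l (shift_point j p) = T l p"
  shows "smooth n (\<lambda>p. iter_diff_quot k G (W p) (\<lambda>l. V l p) (\<lambda>l. T l p))"
  using assms(2-)
proof (induction n arbitrary: k W V T)
  case 0
  then show ?case
    unfolding smooth_along.simps by (intro smooth_fun_tendsto[OF assms(1)]) blast+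
next
  case (Suc n)
  let ?E = "\<lambda>p. iter_diff_quot k G (W p) (\<lambda>l. V l p) (\<lambda>l. T l p)"
  note W = Suc.prems(1) and V = Suc.prems(2) and T = Suc.prems(3-5)
  have "smooth n (diff_quot j ?E)" if j: "j \<in> J" for j
  proof (rule smooth_cong)
    define dW where "dW = (\<lambda>p c. diff_quot j (\<lambda>p. W p c) p)"
    define dV where "dV = (\<lambda>l p c. diff_quot j (\<lambda>p. V l p c) p)"
    \<comment> \<open>The contribution of the base point: \<open>W\<close> moves by the new step
      times \<open>dW\<close>, so a quotient of order \<open>k + 1\<close> arises with the
      additional direction \<open>dW\<close>.\<close>
    define E0 where "E0 = (\<lambda>p. iter_diff_quot (Suc k) G (W p)
        (\<lambda>l. (if l = k then dW else V l) p) (\<lambda>l. (if l = k then step j else T l) p))"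
    \<comment> \<open>When direction \<open>i\<close> moves, the directions below \<open>i\<close>
      have already been moved.\<close>
    define V' where "V' = (\<lambda>i l p. if l < i then V l (shift_point j p) else V l p)"
    define E where "E = (\<lambda>i p. iter_diff_quot k G (\<lambda>c. W (shift_point j p) c + T i p * V i p c)
        (\<lambda>l. (if l = i then dV i else V' i l) p) (\<lambda>l. (if l = i then \<lambda>p. T i p * step j p else T l) p))"
    have W': "smooth n (\<lambda>p. W p c)" "smooth n (\<lambda>p. W (shift_point j p) c)" "smooth n (\<lambda>p. dW p c)"
      if "c < d" for c
      using smooth_Suc[OF W[OF that]] smooth_shift[OF W[OF that] j] W[OF that] j by (auto simp: dW_def)
    have Vs: "smooth n (\<lambda>p. V l p c)" "smooth n (\<lambda>p. V l (shift_point j p) c)" "smooth n (\<lambda>p. dV l p c)"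
      if "l < k" "c < d" for l c
      using smooth_Suc[OF V[OF that]] smooth_shift[OF V[OF that] j] V[OF that] j by (auto simp: dV_def)
    have Ts: "smooth n (T l)" if "l < k" for l
      using T[OF that] by (intro smooth_invariant)
    have "smooth n E0"
      unfolding E0_def
    proof (rule Suc.IH)
      show "\<exists>L. val_tendsto (if l = k then step j else T l) L F" if "l < Suc k" for l
        using that T(1) step_lim[OF j] by (auto simp: less_Suc_eq)
      show "eventually (\<lambda>p. (if l = k then step j else T l) p \<noteq> 0) F" if "l < Suc k" for l
        using that T(2) step_nz[OF j] by (auto simp: less_Suc_eq)
    qed (use W' Vs T(3) in \<open>auto simp: less_Suc_eq\<close>)
    moreover have "smooth n (E i)" if i: "i < k" for i
      unfolding E_def
    proof (rule Suc.IH)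
      show "smooth n (\<lambda>p. W (shift_point j p) c + T i p * V i p c)" if "c < d" for c
        using W'[OF that] Vs[OF i that] Ts[OF i] by (intro smooth_add smooth_mult)
      show "smooth n (\<lambda>p. (if l = i then dV i else V' i l) p c)" if "l < k" "c < d" for l c
        using Vs[OF that] by (cases "l = i"; cases "l < i") (simp_all add: V'_def)
      obtain L where "val_tendsto (T i) L F"
        using T(1)[OF i] by blast
      from val_tendsto_mult[OF this step_lim[OF j]] T(1)
      show "\<exists>L. val_tendsto (if l = i then \<lambda>p. T i p * step j p else T l) L F" if "l < k" for l
        using that by auto
      have "eventually (\<lambda>p. T i p * step j p \<noteq> 0) F"
        using T(2)[OF i] step_nz[OF j] by eventually_elim simp
      then show "eventually (\<lambda>p. (if l = i then \<lambda>p. T i p * step j p else T l) p \<noteq> 0) F" if "l < k" for l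
        using that T(2) by auto
    qed (use T(3) i in auto)
    ultimately show "smooth n (\<lambda>p. E0 p + (\<Sum>i<k. E i p))"
      by (intro smooth_add smooth_sum) auto
    show "eventually (\<lambda>p. E0 p + (\<Sum>i<k. E i p) = diff_quot j ?E p) F"
      using step_nz[OF j]
    proof eventually_elim
      case (elim p)
      define s where "s = step j p"
      define q where "q = shift_point j p"
      define \<tau> where "\<tau> = (\<lambda>l. T l p)"
      have s: "s \<noteq> 0"
        using elim by (simp add: s_def)
      have Wq: "W q = (\<lambda>c. W p c + s * dW p c)"
        unfolding q_def s_def dW_def by (rule ext, rule shift_point_eq[OF elim])
      have Vq: "V l q = (\<lambda>c. V l p c + s * dV l p c)" for l
        unfolding q_def s_def dV_def by (rule ext, rule shift_point_eq[OF elim])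
      \<comment> \<open>Telescopes over the directions: in \<open>H 0\<close> only the base point is
        moved, in \<open>H k\<close> all directions as well.\<close>
      define H where "H = (\<lambda>i. iter_diff_quot k G (W q) (\<lambda>l. if l < i then V l q else V l p) \<tau>)"
      have H: "H (Suc i) - H i = s * E i p" if "i < k" for i
      proof -
        define hyb where "hyb = (\<lambda>l. if l < i then V l q else V l p)"
        have "(\<lambda>l. if l < Suc i then V l q else V l p) = hyb(i := \<lambda>c. V i p c + s * dV i p c)"
          by (auto simp: fun_eq_iff Vq hyb_def)
        then have "H (Suc i) = iter_diff_quot k G (W q) (hyb(i := \<lambda>c. V i p c + s * dV i p c)) \<tau>"
          by (simp only: H_def)
        moreover have "hyb(i := V i p) = hyb"
          by (rule fun_upd_idem) (simp add: hyb_def)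
        then have "H i = iter_diff_quot k G (W q) (hyb(i := V i p)) \<tau>"
          by (simp only: H_def hyb_def)
        ultimately have "H (Suc i) - H i = s * iter_diff_quot k G (\<lambda>c. W q c + \<tau> i * V i p c)
            (hyb(i := dV i p)) (\<tau>(i := \<tau> i * s))"
          by (simp only: iter_diff_quot_direction[OF that s])
        also have "hyb(i := dV i p) = (\<lambda>l. (if l = i then dV i else V' i l) p)"
          by (auto simp: V'_def q_def hyb_def)
        also have "\<tau>(i := \<tau> i * s) = (\<lambda>l. (if l = i then \<lambda>p. T i p * step j p else T l) p)"
          by (auto simp: \<tau>_def s_def)
        finally show ?thesis
          by (simp add: E_def \<tau>_def q_def)
      qed
      have "?E q = iter_diff_quot k G (W q) (\<lambda>l. V l q) \<tau>"
        using T(3) j by (intro iter_diff_quot_cong) (auto simp: \<tau>_def q_def)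
      also have "\<dots> = H k"
        unfolding H_def by (intro iter_diff_quot_cong) auto
      also have "H k = H 0 + (\<Sum>i<k. H (Suc i) - H i)"
        by (simp add: sum_lessThan_telescope)
      also have "(\<Sum>i<k. H (Suc i) - H i) = s * (\<Sum>i<k. E i p)"
        by (simp add: H sum_distrib_left)
      also have "H 0 = iter_diff_quot k G (W q) (\<lambda>l. V l p) \<tau>"
        by (simp add: H_def)
      finally have 1: "?E q = iter_diff_quot k G (W q) (\<lambda>l. V l p) \<tau> + s * (\<Sum>i<k. E i p)" .
      have *: "iter_diff_quot k G y (\<lambda>l. (if l = k then dW else V l) p) (\<lambda>l. (if l = k then step j else T l) p) =
          iter_diff_quot k G y (\<lambda>l. V l p) \<tau>" for y
        by (intro iter_diff_quot_cong) (auto simp: \<tau>_def)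
      have "E0 p = (iter_diff_quot k G (W q) (\<lambda>l. V l p) \<tau> - ?E p) / s"
        using elim by (simp add: E0_def * Wq s_def[symmetric]) (simp add: \<tau>_def)
      then show ?case
        using s 1 by (simp add: diff_quot_def q_def[symmetric] s_def[symmetric] field_simps)
    qed
  qed
  moreover have "\<exists>L. val_tendsto ?E L F"
    by (rule smooth_fun_tendsto[OF assms(1)]) (use W V T smooth_imp_tendsto in blast)+
  ultimately show ?case
    by simp
qed

end

end

section \<open>Locality and comparison with \<open>C\<^sup>\<infinity>\<close>\<close>

lemma shift_point_commute: "shift_point i (shift_point j p) = shift_point j (shift_point i p)"
  by (cases p) (simp add: shift_point_def fun_eq_iff add_ac)

lemma diff_quot_commute: "diff_quot i (diff_quot j A) = diff_quot j (diff_quot i A)"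
  by (rule ext) (simp add: diff_quot_def shift_point_commute[of i j] diff_divide_distrib mult.commute)

text \<open>Lets any chosen index be moved to the outermost place.\<close>

lemma fold_diff_quot_commute: "fold diff_quot ks (diff_quot j A) = diff_quot j (fold diff_quot ks A)"
proof (induction ks arbitrary: A)
  case (Cons k ks)
  then show ?case
    by (simp add: diff_quot_commute[of k j])
qed simp

lemma iter_diff_quot_eq_fold:
  "iter_diff_quot k G x v t = fold diff_quot [0..<k] (\<lambda>(x, v, t). G x) (x, v, t)"
proof (induction k arbitrary: x)
  case (Suc k)
  then show ?case
    by (simp add: diff_quot_def shift_point_def step_def)
qed simp

lemma vec1_index [simp]: "vec1 a $ 0 = a" "vec1 a \<in> carrier_vec 1"
  by (simp_all add: vec1_def)

lemma vec1_diff: "vec1 a - vec1 b = vec1 (a - b :: 'a::ring_1)"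
  by (auto simp: vec1_def)

lemma smult_vec1: "c \<cdot>\<^sub>v vec1 a = vec1 (c * a :: 'a::ring_1)"
  by (auto simp: vec1_def)

lemma Phi_cong:
  "(\<And>l. l < k \<Longrightarrow> v l = v' l) \<Longrightarrow> (\<And>l. l < k \<Longrightarrow> t l = t' l) \<Longrightarrow> Phi k f x v t = Phi k f x v' t'"
proof (induction k arbitrary: x)
  case (Suc k)
  then have "Phi k f y v t = Phi k f y v' t'" for y
    by simp
  then show ?case
    using Suc.prems by simp
qed simp

lemma Phi_vec1:
  "Phi k (\<lambda>x. vec1 (g x)) (vec d x) (\<lambda>l. vec d (v l)) t = vec1 (iter_diff_quot k (\<lambda>x. g (vec d x)) x v t)"
proof (induction k arbitrary: x)
  case (Suc k)
  have "vec d x + t k \<cdot>\<^sub>v vec d (v k) = vec d (\<lambda>i. x i + t k * v k i)"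
    by auto
  then show ?case
    by (simp add: Phi1_def Suc vec1_diff smult_vec1)
qed simp

section \<open>The filter of approach to a point through nonzero steps\<close>

context nontrivial_nonarch_valuation
begin

text \<open>
  All infinitely many directions and steps are close uniformly in their index; an iterated
  difference quotient depends on finitely many of them only.
\<close>

definition near_point ::
  "nat \<Rightarrow> (nat \<Rightarrow> 'k) \<Rightarrow> (nat \<Rightarrow> nat \<Rightarrow> 'k) \<Rightarrow> (nat \<Rightarrow> 'k) \<Rightarrow> real \<Rightarrow> 'k point_dirs_steps set" where
  "near_point d x0 v0 t0 e = {(x, v, t). (\<forall>c<d. val (x c - x0 c) < e) \<and>
     (\<forall>l. \<forall>c<d. val (v l c - v0 l c) < e) \<and> (\<forall>l. t l \<noteq> 0 \<and> val (t l - t0 l) < e)}"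

definition point_filter ::
  "nat \<Rightarrow> (nat \<Rightarrow> 'k) \<Rightarrow> (nat \<Rightarrow> nat \<Rightarrow> 'k) \<Rightarrow> (nat \<Rightarrow> 'k) \<Rightarrow> 'k point_dirs_steps filter" where
  "point_filter d x0 v0 t0 = (INF e\<in>{0<..}. principal (near_point d x0 v0 t0 e))"

lemma near_point_mono: "e \<le> e' \<Longrightarrow> near_point d x0 v0 t0 e \<subseteq> near_point d x0 v0 t0 e'"
  unfolding near_point_def by (auto intro: less_le_trans)

lemma eventually_point_filter:
  "eventually P (point_filter d x0 v0 t0) \<longleftrightarrow> (\<exists>e>0. \<forall>p\<in>near_point d x0 v0 t0 e. P p)"
  unfolding point_filter_def
proof (subst eventually_INF_base)
  fix a b :: real assume ab: "a \<in> {0<..}" "b \<in> {0<..}"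
  show "\<exists>x\<in>{0<..}. principal (near_point d x0 v0 t0 x) \<le>
      inf (principal (near_point d x0 v0 t0 a)) (principal (near_point d x0 v0 t0 b))"
    using ab near_point_mono[of "min a b" a] near_point_mono[of "min a b" b]
    by (intro bexI[of _ "min a b"]) auto
qed (auto simp: eventually_principal)

lemma point_filter_tendsto:
  "c < d \<Longrightarrow> val_tendsto (\<lambda>(x, v, t). x c) (x0 c) (point_filter d x0 v0 t0)"
  "c < d \<Longrightarrow> val_tendsto (\<lambda>(x, v, t). v l c) (v0 l c) (point_filter d x0 v0 t0)"
  "val_tendsto (step l) (t0 l) (point_filter d x0 v0 t0)"
  unfolding val_tendsto_iff eventually_point_filter
  by (auto simp: near_point_def step_def intro!: exI)

lemma eventually_step_nonzero: "eventually (\<lambda>p. step j p \<noteq> 0) (point_filter d x0 v0 t0)"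
  unfolding eventually_point_filter by (intro exI[of _ 1]) (auto simp: near_point_def step_def)

text \<open>In the limit the base point moves by \<open>t0 j * v0 j\<close>. For
  \<open>t0 j = 0\<close> the filter is thus mapped into itself, as the rules for smoothness
  require.\<close>

lemma point_filter_shift:
  "filterlim (shift_point j) (point_filter d (\<lambda>c. x0 c + t0 j * v0 j c) v0 t0) (point_filter d x0 v0 t0)"
  unfolding filterlim_iff
proof (intro allI impI)
  fix P assume "eventually P (point_filter d (\<lambda>c. x0 c + t0 j * v0 j c) v0 t0)"
  then obtain e where e: "0 < e" "\<And>p. p \<in> near_point d (\<lambda>c. x0 c + t0 j * v0 j c) v0 t0 e \<Longrightarrow> P p"
    by (auto simp: eventually_point_filter)
  let ?F = "point_filter d x0 v0 t0"
  have "val_tendsto (\<lambda>p. (\<lambda>(x, v, t). x c) p + step j p * (\<lambda>(x, v, t). v j c) p) (x0 c + t0 j * v0 j c) ?F"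
    if "c < d" for c
    using that by (intro val_tendsto_add val_tendsto_mult point_filter_tendsto)
  then have "eventually (\<lambda>p. \<forall>c\<in>{..<d}.
      val ((\<lambda>(x, v, t). x c) p + step j p * (\<lambda>(x, v, t). v j c) p - (x0 c + t0 j * v0 j c)) < e) ?F"
    using e(1) by (intro eventually_ball_finite) (auto simp: val_tendsto_iff)
  moreover have "eventually (\<lambda>p. p \<in> near_point d x0 v0 t0 e) ?F"
    using e(1) by (auto simp: eventually_point_filter)
  ultimately show "eventually (\<lambda>p. P (shift_point j p)) ?F"
  proof eventually_elim
    case (elim p)
    obtain x v t where p: "p = (x, v, t)"
      by (cases p)
    show ?case
      using elim by (intro e(2)) (auto simp: p shift_point_def near_point_def step_def)
  qed
qed

text \<open>Vanishing steps are perturbed to a small nonzero element and the others kept: points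
  with nonzero steps are dense.\<close>

lemma near_point_nonempty:
  assumes "0 < e"
  shows "\<exists>t'. (\<forall>l. t l \<noteq> 0 \<longrightarrow> t' l = t l) \<and> (x, v, t') \<in> near_point d x v t e"
proof -
  obtain c where c: "c \<noteq> 0" "val c < e"
    using obtain_small[OF assms] .
  then show ?thesis
    using assms by (intro exI[of _ "\<lambda>l. if t l = 0 then c else t l"]) (auto simp: near_point_def)
qed

lemma smooth_funI:
  assumes "\<And>k x0 v0 t0. \<exists>L. val_tendsto (\<lambda>(x, v, t). iter_diff_quot k G x v t) L (point_filter d x0 v0 t0)"
  shows "smooth_fun d G"
  unfolding smooth_fun_def
proof (intro allI)
  fix k x0 v0 and t0 :: "nat \<Rightarrow> 'k"
  \<comment> \<open>The quotient involves only the steps below \<open>k\<close>, while the filter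
    asks all of them to be nonzero and near their centre. Centring the others at 0 lets one small
    element \<open>c\<close> fill them.\<close>
  define t1 where "t1 = (\<lambda>l. if l < k then t0 l else 0)"
  obtain L where L: "val_tendsto (\<lambda>(x, v, t). iter_diff_quot k G x v t) L (point_filter d x0 v0 t1)"
    using assms by blast
  show "\<exists>L. \<forall>e>0. \<exists>\<delta>>0. \<forall>x v t. (\<forall>c<d. val (x c - x0 c) < \<delta>) \<longrightarrow>
      (\<forall>l<k. \<forall>c<d. val (v l c - v0 l c) < \<delta>) \<longrightarrow>
      (\<forall>l<k. val (t l - t0 l) < \<delta> \<and> t l \<noteq> 0) \<longrightarrow> val (iter_diff_quot k G x v t - L) < e"
  proof (intro exI[of _ L] allI impI)
    fix e :: real assume "0 < e"
    then obtain \<delta> where \<delta>: "0 < \<delta>"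
      "\<And>x v t. (x, v, t) \<in> near_point d x0 v0 t1 \<delta> \<Longrightarrow> val (iter_diff_quot k G x v t - L) < e"
      using L unfolding val_tendsto_iff eventually_point_filter by fastforce
    obtain c where c: "c \<noteq> 0" "val c < \<delta>"
      using obtain_small[OF \<delta>(1)] .
    have "val (iter_diff_quot k G x v t - L) < e"
      if x: "\<forall>c<d. val (x c - x0 c) < \<delta>" "\<forall>l<k. \<forall>c<d. val (v l c - v0 l c) < \<delta>"
        "\<forall>l<k. val (t l - t0 l) < \<delta> \<and> t l \<noteq> 0" for x v t
    proof -
      define v' where "v' = (\<lambda>l. if l < k then v l else v0 l)"
      define t' where "t' = (\<lambda>l. if l < k then t l else c)"
      have "(x, v', t') \<in> near_point d x0 v0 t1 \<delta>"
        using x c \<delta>(1) by (auto simp: near_point_def v'_def t'_def t1_def)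
      from \<delta>(2)[OF this] show ?thesis
        using iter_diff_quot_cong[of k v v' t t' G x] by (simp add: v'_def t'_def)
    qed
    with \<delta>(1) show "\<exists>\<delta>>0. \<forall>x v t. (\<forall>c<d. val (x c - x0 c) < \<delta>) \<longrightarrow>
      (\<forall>l<k. \<forall>c<d. val (v l c - v0 l c) < \<delta>) \<longrightarrow>
      (\<forall>l<k. val (t l - t0 l) < \<delta> \<and> t l \<noteq> 0) \<longrightarrow> val (iter_diff_quot k G x v t - L) < e"
      by blast
  qed
qed

lemma smooth_along_fold:
  "smooth_along F J n A \<Longrightarrow> set ks \<subseteq> J \<Longrightarrow> length ks \<le> n \<Longrightarrow> \<exists>L. val_tendsto (fold diff_quot ks A) L F"
proof (induction ks arbitrary: n A)
  case Nil
  then show ?case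
    by (cases n) auto
next
  case (Cons k ks)
  then obtain n' where "n = Suc n'"
    by (cases n) auto
  with Cons show ?case
    by auto
qed

text \<open>
  Smoothness is local: where a step does not tend to 0, the difference quotient is a combination of
  values at two base points, so only the steps tending to 0 matter.
\<close>

lemma smooth_fun_local:
  assumes "\<And>x0 v0 t0 n. smooth_along (point_filter d x0 v0 t0) {j. t0 j = 0} n (\<lambda>(x, v, t). G x)"
  shows "smooth_fun d G"
proof (rule smooth_funI)
  fix k x0 v0 t0
  let ?A = "\<lambda>(x, v, t). G x"
  \<comment> \<open>Stated for all index lists and base points: removing an index \<open>j\<close>
    with \<open>t0 j \<noteq> 0\<close> requires the shorter quotient at the translated base point,
    too.\<close>
  have "\<exists>L. val_tendsto (fold diff_quot ks ?A) L (point_filter d x0 v0 t0)" for ks x0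
  proof (induction ks arbitrary: x0 rule: length_induct)
    case (1 ks)
    show ?case
    proof (cases "set ks \<subseteq> {j. t0 j = 0}")
      case True
      then show ?thesis
        using smooth_along_fold[OF assms] by blast
    next
      case False
      then obtain j where j: "j \<in> set ks" "t0 j \<noteq> 0"
        by blast
      then obtain as bs where ks: "ks = as @ j # bs"
        by (meson split_list)
      define B where "B = fold diff_quot (as @ bs) ?A"
      have eq: "fold diff_quot ks ?A = diff_quot j B"
        by (simp add: ks B_def fold_diff_quot_commute)
      obtain L where L: "val_tendsto B L (point_filter d x0 v0 t0)"
        using 1[rule_format, of "as @ bs" x0] by (auto simp: ks B_def)
      obtain M where M: "val_tendsto B M (point_filter d (\<lambda>c. x0 c + t0 j * v0 j c) v0 t0)"
        using 1[rule_format, of "as @ bs" "\<lambda>c. x0 c + t0 j * v0 j c"] by (auto simp: ks B_def)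
      have M': "val_tendsto (\<lambda>p. B (shift_point j p)) M (point_filter d x0 v0 t0)"
        using filterlim_compose[OF M[unfolded val_tendsto_def] point_filter_shift] by (simp add: val_tendsto_def)
      have "val_tendsto (\<lambda>p. (B (shift_point j p) + - 1 * B p) * inverse (step j p))
          ((M + - 1 * L) * inverse (t0 j)) (point_filter d x0 v0 t0)"
        by (intro val_tendsto_mult val_tendsto_add val_tendsto_const val_tendsto_inverse(1)
            point_filter_tendsto M' L j(2))
      then show ?thesis
        unfolding eq by (auto simp: diff_quot_def[abs_def] divide_inverse)
    qed
  qed
  moreover have "(\<lambda>(x, v, t). iter_diff_quot k G x v t) = fold diff_quot [0..<k] ?A"
    by (auto simp: iter_diff_quot_eq_fold)
  ultimately show "\<exists>L. val_tendsto (\<lambda>(x, v, t). iter_diff_quot k G x v t) L (point_filter d x0 v0 t0)"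
    by metis
qed

section \<open>The topologies and differentiability classes in terms of values\<close>

lemma topspace_vec [simp]: "topspace (vec_topology val d) = carrier_vec d"
proof -
  interpret Metric_space "carrier_vec d :: 'k vec set" "max_dist val d"
    by (rule Metric_space_vec)
  show ?thesis
    by (simp add: vec_topology_def)
qed

lemma topspace_field [simp]: "topspace (field_topology val) = UNIV"
proof -
  interpret Metric_space "UNIV :: 'k set" "\<lambda>x y. val (x - y)"
    by (rule Metric_space_field)
  show ?thesis
    by (simp add: field_topology_def)
qed

lemma topspace_Phi_domain:
  "topspace (Phi_domain val d n) = carrier_vec d \<times> (({..<n} \<rightarrow>\<^sub>E carrier_vec d) \<times> ({..<n} \<rightarrow>\<^sub>E UNIV))"
  by (simp add: Phi_domain_def)

lemma limitin_field_iff: "limitin (field_topology val) f l F \<longleftrightarrow> val_tendsto f l F"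
proof -
  interpret Metric_space "UNIV :: 'k set" "\<lambda>x y. val (x - y)"
    by (rule Metric_space_field)
  show ?thesis
    by (simp add: field_topology_def limitin_metric val_tendsto_iff)
qed

lemma max_dist_less_iff: "0 < c \<Longrightarrow> max_dist val d x y < c \<longleftrightarrow> (\<forall>i<d. val (x $ i - y $ i) < c)"
  by (auto simp: max_dist_def)

lemma limitin_vec_iff:
  "limitin (vec_topology val d) f l F \<longleftrightarrow> l \<in> carrier_vec d \<and> eventually (\<lambda>p. f p \<in> carrier_vec d) F \<and>
     (\<forall>i<d. val_tendsto (\<lambda>p. f p $ i) (l $ i) F)"
proof -
  interpret Metric_space "carrier_vec d :: 'k vec set" "max_dist val d"
    by (rule Metric_space_vec)
  show ?thesis
    unfolding vec_topology_def limitin_metric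
  proof (intro iffI conjI; (elim conjE)?)
    assume *: "\<forall>e>0. eventually (\<lambda>x. f x \<in> carrier_vec d \<and> max_dist val d (f x) l < e) F"
    show "eventually (\<lambda>p. f p \<in> carrier_vec d) F"
      using *[rule_format, of 1] by (auto elim: eventually_mono)
    show "\<forall>i<d. val_tendsto (\<lambda>p. f p $ i) (l $ i) F"
      unfolding val_tendsto_iff
    proof (intro allI impI)
      fix i and e :: real assume "i < d" "0 < e"
      with *[rule_format, of e] show "eventually (\<lambda>p. val (f p $ i - l $ i) < e) F"
        by (auto simp: max_dist_less_iff elim: eventually_mono)
    qed
  next
    assume *: "\<forall>i<d. val_tendsto (\<lambda>p. f p $ i) (l $ i) F" "eventually (\<lambda>p. f p \<in> carrier_vec d) F"
    show "\<forall>e>0. eventually (\<lambda>x. f x \<in> carrier_vec d \<and> max_dist val d (f x) l < e) F"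
    proof (intro allI impI)
      fix e :: real assume e: "0 < e"
      have "eventually (\<lambda>p. \<forall>i\<in>{..<d}. val (f p $ i - l $ i) < e) F"
        using *(1) e by (intro eventually_ball_finite) (auto simp: val_tendsto_iff)
      with *(2) show "eventually (\<lambda>x. f x \<in> carrier_vec d \<and> max_dist val d (f x) l < e) F"
        by eventually_elim (simp add: max_dist_less_iff e)
    qed
  qed auto
qed

text \<open>For \<open>k = 0\<close> the domain is \<open>K^d\<close> times two one-point spaces, so
  continuity of \<open>f\<close> is the extension property of order 0.\<close>

lemma C_infinity_iff: "f \<in> C_infinity val d l \<longleftrightarrow> (\<forall>k. Phi_extends val d l k f)"
proof
  assume f: "f \<in> C_infinity val d l"
  have "Phi_extends val d l k f" for k
  proof (cases "k = 0")
    case True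
    have "continuous_map (vec_topology val d) (vec_topology val l) f"
      using f by (auto simp: C_infinity_def C_n_def)
    then have "continuous_map (Phi_domain val d 0) (vec_topology val l) (f \<circ> fst)"
      unfolding Phi_domain_def by (rule continuous_map_compose[OF continuous_map_fst])
    then show ?thesis
      unfolding Phi_extends_def True by (intro exI[of _ "f \<circ> fst"]) auto
  next
    case False
    have "f \<in> C_n val d l k"
      using f by (simp add: C_infinity_def)
    with False show ?thesis
      by (simp add: C_n_def)
  qed
  then show "\<forall>k. Phi_extends val d l k f" ..
next
  assume f: "\<forall>k. Phi_extends val d l k f"
  then obtain F where F: "continuous_map (Phi_domain val d 0) (vec_topology val l) F"
    "\<And>x v t. (x, v, t) \<in> topspace (Phi_domain val d 0) \<Longrightarrow> F (x, v, t) = f x"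
    unfolding Phi_extends_def by (metis Phi.simps(1) less_nat_zero_code)
  have "continuous_map (vec_topology val d) (Phi_domain val d 0) (\<lambda>x. (x, \<lambda>_. undefined, \<lambda>_. undefined))"
    unfolding Phi_domain_def by (intro continuous_map_pairedI continuous_map_id[unfolded id_def]) auto
  from continuous_map_compose[OF this F(1)]
  have "continuous_map (vec_topology val d) (vec_topology val l) f"
    by (rule continuous_map_eq) (simp add: F(2) topspace_Phi_domain)
  with f show "f \<in> C_infinity val d l"
    by (auto simp: C_infinity_def C_n_def)
qed

lemma C_infinity_imp_smooth_fun:
  assumes "(\<lambda>x. vec1 (g x)) \<in> C_infinity val d 1"
  shows "smooth_fun d (\<lambda>x. g (vec d x))"
proof (rule smooth_funI)
  fix k x0 v0 and t0 :: "nat \<Rightarrow> 'k"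
  let ?Fil = "point_filter d x0 v0 t0"
  obtain F where F: "continuous_map (Phi_domain val d k) (vec_topology val 1) F"
    "\<And>x v t. (x, v, t) \<in> topspace (Phi_domain val d k) \<Longrightarrow> \<forall>i<k. t i \<noteq> 0 \<Longrightarrow>
       F (x, v, t) = Phi k (\<lambda>x. vec1 (g x)) x v t"
    using assms unfolding C_infinity_iff Phi_extends_def by metis
  \<comment> \<open>The filter lives on total functions, \<open>Phi_domain\<close> on vectors and
    extensional families; \<open>Q\<close> passes from one to the other.\<close>
  define Q where "Q = (\<lambda>(x :: nat \<Rightarrow> 'k, v :: nat \<Rightarrow> nat \<Rightarrow> 'k, t :: nat \<Rightarrow> 'k).
      (vec d x, \<lambda>l\<in>{..<k}. vec d (v l), restrict t {..<k}))"
  have "limitin (Phi_domain val d k) Q (Q (x0, v0, t0)) ?Fil"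
    unfolding Phi_domain_def limitin_pairwise limitin_componentwise
  proof (intro conjI ballI)
    show "limitin (vec_topology val d) (fst \<circ> Q) (fst (Q (x0, v0, t0))) ?Fil"
      unfolding limitin_vec_iff
      using point_filter_tendsto(1)[of _ d x0 v0 t0] by (auto simp: Q_def case_prod_unfold)
    show "limitin (vec_topology val d) (\<lambda>c. (fst \<circ> (snd \<circ> Q)) c i) (fst (snd (Q (x0, v0, t0))) i) ?Fil"
      if "i \<in> {..<k}" for i
      unfolding limitin_vec_iff
      using that point_filter_tendsto(2)[of _ d i v0 x0 t0] by (auto simp: Q_def case_prod_unfold)
    show "limitin (field_topology val) (\<lambda>c. (snd \<circ> (snd \<circ> Q)) c i) (snd (snd (Q (x0, v0, t0))) i) ?Fil"
      if "i \<in> {..<k}" for i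
      unfolding limitin_field_iff
      using that point_filter_tendsto(3)[of i t0 d x0 v0] by (auto simp: Q_def case_prod_unfold step_def)
  qed (auto simp: Q_def case_prod_unfold)
  from continuous_map_limit[OF F(1) this]
  have "val_tendsto (\<lambda>p. F (Q p) $ 0) (F (Q (x0, v0, t0)) $ 0) ?Fil"
    unfolding limitin_vec_iff by simp
  moreover have "eventually (\<lambda>p. F (Q p) $ 0 = (\<lambda>(x, v, t). iter_diff_quot k (\<lambda>x. g (vec d x)) x v t) p) ?Fil"
    unfolding eventually_point_filter
  proof (intro exI[of _ 1] conjI ballI)
    fix p assume p: "p \<in> near_point d x0 v0 t0 1"
    obtain x v t where xvt: "p = (x, v, t)"
      by (cases p)
    have "F (Q p) = Phi k (\<lambda>x. vec1 (g x)) (vec d x) (\<lambda>l\<in>{..<k}. vec d (v l)) (restrict t {..<k})"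
      using p unfolding Q_def xvt prod.case
      by (intro F(2)) (auto simp: topspace_Phi_domain near_point_def)
    also have "\<dots> = Phi k (\<lambda>x. vec1 (g x)) (vec d x) (\<lambda>l. vec d (v l)) t"
      by (rule Phi_cong) auto
    finally show "F (Q p) $ 0 = (\<lambda>(x, v, t). iter_diff_quot k (\<lambda>x. g (vec d x)) x v t) p"
      by (simp add: Phi_vec1 xvt)
  qed simp
  ultimately show "\<exists>L. val_tendsto (\<lambda>(x, v, t). iter_diff_quot k (\<lambda>x. g (vec d x)) x v t) L ?Fil"
    using val_tendsto_cong by blast
qed

text \<open>The limits themselves form the extension. It is continuous because points with nonzero
  steps are dense, so nearby limits are compared through a common quotient. Where all steps are
  nonzero the limit is the quotient, since the point lies in each of its own neighbourhoods.\<close>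

lemma smooth_fun_imp_C_infinity:
  assumes "smooth_fun d (\<lambda>x. g (vec d x))"
  shows "(\<lambda>x. vec1 (g x)) \<in> C_infinity val d 1"
  unfolding C_infinity_iff
proof
  fix k
  let ?D = "iter_diff_quot k (\<lambda>x. g (vec d x))"
  define lim where "lim = (\<lambda>x0 v0 t0 L. \<forall>e>0. \<exists>\<delta>>0. \<forall>x v t.
     (\<forall>c<d. val (x c - x0 c) < \<delta>) \<longrightarrow> (\<forall>l<k. \<forall>c<d. val (v l c - v0 l c) < \<delta>) \<longrightarrow>
     (\<forall>l<k. val (t l - t0 l) < \<delta> \<and> t l \<noteq> 0) \<longrightarrow> val (?D x v t - L) < e)"
  have "\<exists>L. lim x0 v0 t0 L" for x0 v0 t0
    using assms unfolding smooth_fun_def lim_def by blast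
  then obtain L where L: "\<And>x0 v0 t0. lim x0 v0 t0 (L x0 v0 t0)"
    by metis
  have near: "\<exists>\<delta>>0. \<forall>x v t. (\<forall>c<d. val (x c - x0 c) < \<delta>) \<longrightarrow> (\<forall>l<k. \<forall>c<d. val (v l c - v0 l c) < \<delta>) \<longrightarrow>
     (\<forall>l<k. val (t l - t0 l) < \<delta>) \<longrightarrow> val (L x v t - L x0 v0 t0) < e" if e: "0 < e" for x0 v0 t0 e
  proof -
    obtain \<delta> where \<delta>: "0 < \<delta>" "\<And>x v t. (\<forall>c<d. val (x c - x0 c) < \<delta>) \<Longrightarrow> (\<forall>l<k. \<forall>c<d. val (v l c - v0 l c) < \<delta>) \<Longrightarrow>
       (\<forall>l<k. val (t l - t0 l) < \<delta> \<and> t l \<noteq> 0) \<Longrightarrow> val (?D x v t - L x0 v0 t0) < e"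
      using L[of x0 v0 t0] e unfolding lim_def by blast
    have "val (L x v t - L x0 v0 t0) < e"
      if *: "\<forall>c<d. val (x c - x0 c) < \<delta>" "\<forall>l<k. \<forall>c<d. val (v l c - v0 l c) < \<delta>"
        "\<forall>l<k. val (t l - t0 l) < \<delta>" for x v t
    proof -
      obtain \<delta>' where \<delta>': "0 < \<delta>'" "\<And>y w s. (\<forall>c<d. val (y c - x c) < \<delta>') \<Longrightarrow> (\<forall>l<k. \<forall>c<d. val (w l c - v l c) < \<delta>') \<Longrightarrow>
         (\<forall>l<k. val (s l - t l) < \<delta>' \<and> s l \<noteq> 0) \<Longrightarrow> val (?D y w s - L x v t) < e"
        using L[of x v t] e unfolding lim_def by blast
      \<comment> \<open>Nonzero steps close enough to \<open>t\<close> for both limit statements to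
        apply to the same quotient.\<close>
      obtain t' where t': "(x, v, t') \<in> near_point d x v t (min \<delta> \<delta>')"
        using near_point_nonempty[of "min \<delta> \<delta>'" t x v d] \<delta>(1) \<delta>'(1) by auto
      have "val (t' l - t0 l) < \<delta>" if "l < k" for l
      proof -
        have "val (t' l - t l) < \<delta>" "val (t l - t0 l) < \<delta>"
          using t' *(3) that by (auto simp: near_point_def)
        then show ?thesis
          using val_ultrametric[of "t' l - t l" "t l - t0 l"] by auto
      qed
      then have "val (?D x v t' - L x0 v0 t0) < e"
        using t' * by (intro \<delta>(2)) (auto simp: near_point_def)
      moreover have "val (?D x v t' - L x v t) < e"
        using t' \<delta>'(1) by (intro \<delta>'(2)) (auto simp: near_point_def)
      ultimately show ?thesis
        using val_diff_ultrametric[of "?D x v t' - L x0 v0 t0" "?D x v t' - L x v t"] by auto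
    qed
    with \<delta>(1) show ?thesis
      by blast
  qed
  define H where "H = (\<lambda>(x, v, t). vec1 (L (\<lambda>c. x $ c) (\<lambda>l c. v l $ c) t))"
  interpret X: Metric_space "carrier_vec d :: 'k vec set" "max_dist val d"
    by (rule Metric_space_vec)
  interpret Y: Metric_space "carrier_vec 1 :: 'k vec set" "max_dist val 1"
    by (rule Metric_space_vec)
  interpret K: Metric_space "UNIV :: 'k set" "\<lambda>x y. val (x - y)"
    by (rule Metric_space_field)
  have "continuous_map (Phi_domain val d k) Y.mtopology H"
    unfolding Y.continuous_map_to_metric
  proof (intro ballI allI impI)
    fix p and e :: real assume p: "p \<in> topspace (Phi_domain val d k)" and e: "0 < e"
    obtain x0 v0 t0 where p0: "p = (x0, v0, t0)"
      by (cases p)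
    have p': "x0 \<in> carrier_vec d" "v0 \<in> {..<k} \<rightarrow>\<^sub>E carrier_vec d" "t0 \<in> {..<k} \<rightarrow>\<^sub>E UNIV"
      using p by (auto simp: topspace_Phi_domain p0)
    obtain \<delta> where \<delta>: "0 < \<delta>" "\<And>x v t. (\<forall>c<d. val (x c - x0 $ c) < \<delta>) \<Longrightarrow>
       (\<forall>l<k. \<forall>c<d. val (v l c - v0 l $ c) < \<delta>) \<Longrightarrow>
       (\<forall>l<k. val (t l - t0 l) < \<delta>) \<Longrightarrow> val (L x v t - L (\<lambda>c. x0 $ c) (\<lambda>l c. v0 l $ c) t0) < e"
      using near[OF e, of "\<lambda>c. x0 $ c" "\<lambda>l c. v0 l $ c" t0] by blast
    define U where "U = X.mball x0 \<delta> \<times> ((\<Pi>\<^sub>E l\<in>{..<k}. X.mball (v0 l) \<delta>) \<times> (\<Pi>\<^sub>E l\<in>{..<k}. K.mball (t0 l) \<delta>))"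
    show "\<exists>U. openin (Phi_domain val d k) U \<and> p \<in> U \<and> (\<forall>y\<in>U. H y \<in> Y.mball (H p) e)"
    proof (intro exI[of _ U] conjI ballI)
      show "openin (Phi_domain val d k) U"
        unfolding U_def Phi_domain_def openin_prod_Times_iff vec_topology_def field_topology_def
        by (simp add: openin_PiE)
      show "p \<in> U"
        using p' \<delta>(1) by (auto simp: U_def p0 PiE_iff)
      fix q assume "q \<in> U"
      then obtain x v t where q: "q = (x, v, t)" and x: "x \<in> X.mball x0 \<delta>"
        and v: "v \<in> (\<Pi>\<^sub>E l\<in>{..<k}. X.mball (v0 l) \<delta>)" and t: "t \<in> (\<Pi>\<^sub>E l\<in>{..<k}. K.mball (t0 l) \<delta>)"
        by (auto simp: U_def)
      have sym: "max_dist val d a b < \<delta> \<longleftrightarrow> (\<forall>c<d. val (b $ c - a $ c) < \<delta>)" for a b :: "'k vec"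
        using \<delta>(1) by (simp add: max_dist_less_iff val_diff_commute)
      have "\<forall>c<d. val (x $ c - x0 $ c) < \<delta>"
        using x by (auto simp: X.in_mball sym)
      moreover have "\<forall>l<k. \<forall>c<d. val (v l $ c - v0 l $ c) < \<delta>"
        using v by (auto simp: X.in_mball sym PiE_iff)
      moreover have "\<forall>l<k. val (t l - t0 l) < \<delta>"
        using t by (auto simp: K.in_mball PiE_iff val_diff_commute)
      ultimately have "val (L (\<lambda>c. x $ c) (\<lambda>l c. v l $ c) t - L (\<lambda>c. x0 $ c) (\<lambda>l c. v0 l $ c) t0) < e"
        by (rule \<delta>(2))
      then show "H q \<in> Y.mball (H p) e"
        unfolding Y.in_mball using e
        by (simp add: H_def q p0 max_dist_less_iff val_diff_commute del: One_nat_def)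
    qed
  qed
  then have cont: "continuous_map (Phi_domain val d k) (vec_topology val 1) H"
    by (simp add: vec_topology_def)
  have "H (x, v, t) = Phi k (\<lambda>x. vec1 (g x)) x v t"
    if "(x, v, t) \<in> topspace (Phi_domain val d k)" "\<forall>i<k. t i \<noteq> 0" for x v t
  proof -
    have vec_id: "vec d (\<lambda>c. w $ c) = w" if "w \<in> carrier_vec d" for w :: "'k vec"
      using that by (intro eq_vecI) auto
    have x: "vec d (\<lambda>c. x $ c) = x" and v: "\<And>l. l < k \<Longrightarrow> vec d (\<lambda>c. v l $ c) = v l"
      using that(1) by (auto simp only: topspace_Phi_domain PiE_iff lessThan_iff mem_Times_iff fst_conv snd_conv intro!: vec_id)
    let ?a = "?D (\<lambda>c. x $ c) (\<lambda>l c. v l $ c) t" and ?b = "L (\<lambda>c. x $ c) (\<lambda>l c. v l $ c) t"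
    have "val (?a - ?b) < e" if e: "0 < e" for e
    proof -
      obtain \<delta> where "0 < \<delta>" "\<And>y w s. (\<forall>c<d. val (y c - x $ c) < \<delta>) \<Longrightarrow>
          (\<forall>l<k. \<forall>c<d. val (w l c - v l $ c) < \<delta>) \<Longrightarrow>
          (\<forall>l<k. val (s l - t l) < \<delta> \<and> s l \<noteq> 0) \<Longrightarrow> val (?D y w s - ?b) < e"
        using L[of "\<lambda>c. x $ c" "\<lambda>l c. v l $ c" t] e unfolding lim_def by blast
      then show ?thesis
        using \<open>\<forall>i<k. t i \<noteq> 0\<close> by simp
    qed
    then have "?a = ?b"
      using val_pos_iff[of "?a - ?b"] by force
    have "Phi k (\<lambda>x. vec1 (g x)) x v t = Phi k (\<lambda>x. vec1 (g x)) (vec d (\<lambda>c. x $ c)) (\<lambda>l. vec d (\<lambda>c. v l $ c)) t"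
      unfolding x by (rule Phi_cong) (simp_all only: v)
    then show ?thesis
      using \<open>?a = ?b\<close> by (simp add: H_def Phi_vec1)
  qed
  with cont show "Phi_extends val d 1 k (\<lambda>x. vec1 (g x))"
    unfolding Phi_extends_def by blast
qed

end

section \<open>Locally analytic functions are smooth\<close>

lemma prod_fun_apply: "(\<Prod>i\<in>A. (f i :: 'a \<Rightarrow> 'b::comm_ring_1)) x = (\<Prod>i\<in>A. f i x)"
  by (induction A rule: infinite_finite_induct) simp_all

lemma fold_diff_quot_add:
  "fold diff_quot ks (\<lambda>p. A p + B p) = (\<lambda>p. fold diff_quot ks A p + fold diff_quot ks B p)"
proof (induction ks arbitrary: A B)
  case (Cons j ks)
  have "diff_quot j (\<lambda>p. A p + B p) = (\<lambda>p. diff_quot j A p + diff_quot j B p)"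
    by (simp add: diff_quot_def add_divide_distrib diff_divide_distrib fun_eq_iff)
  then show ?case
    by (simp add: Cons)
qed simp

lemma fold_diff_quot_zero: "fold diff_quot ks (\<lambda>_. 0 :: 'a::field) = (\<lambda>_. 0)"
proof (induction ks)
  case (Cons j ks)
  have "diff_quot j (\<lambda>_. 0 :: 'a) = (\<lambda>_. 0)"
    by (simp add: diff_quot_def fun_eq_iff)
  with Cons show ?case
    by (simp only: fold_Cons o_apply)
qed simp

lemma fold_diff_quot_shift:
  "fold diff_quot ks (\<lambda>p. A (shift_point j p)) = (\<lambda>p. fold diff_quot ks A (shift_point j p))"
proof (induction ks arbitrary: A)
  case (Cons k ks)
  have "diff_quot k (\<lambda>p. A (shift_point j p)) = (\<lambda>p. diff_quot k A (shift_point j p))"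
    by (simp add: diff_quot_def fun_eq_iff shift_point_commute[of j k])
  then show ?case
    by (simp add: Cons)
qed simp

lemma diff_quot_mult:
  "diff_quot j (\<lambda>p. A p * B p) = (\<lambda>p. diff_quot j A p * B p + A (shift_point j p) * diff_quot j B p)"
  by (simp add: diff_quot_def fun_eq_iff algebra_simps diff_divide_distrib add_divide_distrib)

lemma diff_quot_coord: "step j p \<noteq> 0 \<Longrightarrow> diff_quot j (\<lambda>(x, v, t). x c - b) p = (\<lambda>(x, v, t). v j c) p"
  by (cases p) (simp add: diff_quot_def shift_point_def step_def)

context nontrivial_nonarch_valuation
begin

lemma val_prod: "val (prod f A) = (\<Prod>i\<in>A. val (f i))"
  by (induction A rule: infinite_finite_induct) (simp_all add: val_mult)

lemma gauss_le_prod: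
  assumes "\<And>i. 0 < \<rho> i" "\<And>i. i \<in> I \<Longrightarrow> gauss_le \<rho> m (C i) (f i)"
  shows "gauss_le \<rho> m (prod C I) (prod f I)"
  using assms(2)
proof (induction I rule: infinite_finite_induct)
  case (insert i I)
  then show ?case
    unfolding prod.insert[OF insert.hyps] by (intro gauss_le_mult assms(1)) auto
qed (use gauss_le_const[of \<rho>, OF assms(1), of 1 1 m] in \<open>simp_all add: one_fun_def\<close>)

text \<open>
  Convergence of the series at one point all of whose displacements have value \<open>R\<close> bounds the
  coefficients; the polynomials \<open>F n\<close> are partial sums.
\<close>

lemma locally_analytic_approx:
  fixes u :: "'k vec \<Rightarrow> 'k vec"
  assumes u: "locally_analytic val d l u" and a: "a \<in> carrier_vec d" and i: "i < l"
  obtains F C R where "0 < R" "1 \<le> C" "gauss_le (\<lambda>_. R) d C (F 0)"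
    "\<And>\<rho> n. 0 < \<rho> \<Longrightarrow> \<rho> \<le> R \<Longrightarrow> gauss_le (\<lambda>_. \<rho>) d (C * (\<rho> / R) ^ Suc n) (F (Suc n) - F n)"
    "\<And>w. (\<And>j. j < d \<Longrightarrow> val (w j) \<le> R) \<Longrightarrow> val_tendsto (\<lambda>n. F n w) (u (a + vec d w) $ i) sequentially"
proof -
  define E where "E = {..<d} \<rightarrow>\<^sub>E (UNIV :: nat set)"
  obtain r c where r: "0 < r" and lim: "\<And>x. x \<in> carrier_vec d \<Longrightarrow> max_norm val (x - a) < r \<Longrightarrow>
      limitin (field_topology val) (\<lambda>A. \<Sum>\<alpha>\<in>A. c \<alpha> $ i * (\<Prod>j<d. (x $ j - a $ j) ^ \<alpha> j))
             (u x $ i) (finite_subsets_at_top E)"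
    using u a i unfolding locally_analytic_def E_def by blast
  \<comment> \<open>Taking the radius in the value group lets one point, all of whose displacements
    equal \<open>\<pi>\<close>, control every coefficient.\<close>
  obtain \<pi> where \<pi>: "\<pi> \<noteq> 0" "val \<pi> < r"
    using obtain_small[OF r] .
  define R where "R = val \<pi>"
  have R: "0 < R" "R < r"
    using \<pi> by (auto simp: R_def val_pos_iff)
  define mterm where "mterm = (\<lambda>\<alpha> w. c \<alpha> $ i * (\<Prod>j<d. w j ^ \<alpha> j))"
  have lim': "val_tendsto (\<lambda>A. \<Sum>\<alpha>\<in>A. mterm \<alpha> w) (u (a + vec d w) $ i) (finite_subsets_at_top E)"
    if w: "\<And>j. j < d \<Longrightarrow> val (w j) \<le> R" for w
  proof -
    let ?x = "a + vec d w"
    have "max_norm val (?x - a) < r"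
      unfolding max_norm_def
      using a w R r by (subst Max_less_iff) (auto intro: le_less_trans)
    then have "val_tendsto (\<lambda>A. \<Sum>\<alpha>\<in>A. c \<alpha> $ i * (\<Prod>j<d. (?x $ j - a $ j) ^ \<alpha> j)) (u ?x $ i) (finite_subsets_at_top E)"
      using lim[of ?x] a by (simp add: limitin_field_iff)
    moreover have "(\<Prod>j<d. (?x $ j - a $ j) ^ \<alpha> j) = (\<Prod>j<d. w j ^ \<alpha> j)" for \<alpha>
      using a by (intro prod.cong) auto
    ultimately show ?thesis
      by (simp add: mterm_def)
  qed
  define pv where "pv = (\<lambda>_::nat. \<pi>)"
  obtain L where L: "val_tendsto (\<lambda>A. \<Sum>\<alpha>\<in>A. mterm \<alpha> pv) L (finite_subsets_at_top E)"
    using lim'[of pv] by (auto simp: pv_def R_def)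
  have "eventually (\<lambda>A. val ((\<Sum>\<alpha>\<in>A. mterm \<alpha> pv) - L) < 1) (finite_subsets_at_top E)"
    by (rule L[unfolded val_tendsto_iff, rule_format]) simp
  \<comment> \<open>A term outside the finite set \<open>X\<close> is the difference of two partial
    sums near the limit, hence has value below 1.\<close>
  then obtain X where X': "finite X \<and> X \<subseteq> E \<and>
      (\<forall>Y. finite Y \<and> X \<subseteq> Y \<and> Y \<subseteq> E \<longrightarrow> val ((\<Sum>\<alpha>\<in>Y. mterm \<alpha> pv) - L) < 1)"
    unfolding eventually_finite_subsets_at_top by (rule exE)
  have X: "finite X" "X \<subseteq> E"
    using X' by blast+
  have X3: "val ((\<Sum>\<alpha>\<in>Y. mterm \<alpha> pv) - L) < 1"
    if "finite Y" "X \<subseteq> Y" "Y \<subseteq> E" for Y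
    using X' that by blast
  define C where "C = Max (insert 1 ((\<lambda>\<alpha>. val (mterm \<alpha> pv)) ` X))"
  have C1: "1 \<le> C"
    unfolding C_def using X(1) by (intro Max_ge) auto
  have C: "val (mterm \<alpha> pv) \<le> C" if "\<alpha> \<in> E" for \<alpha>
  proof (cases "\<alpha> \<in> X")
    case True
    then show ?thesis
      unfolding C_def using X(1) by (intro Max_ge) auto
  next
    case False
    have "val ((\<Sum>\<alpha>\<in>insert \<alpha> X. mterm \<alpha> pv) - L) < 1" "val ((\<Sum>\<alpha>\<in>X. mterm \<alpha> pv) - L) < 1"
      using X that by (auto intro!: X3)
    then have "val (mterm \<alpha> pv) < 1"
      using val_diff_ultrametric[of "(\<Sum>\<alpha>\<in>insert \<alpha> X. mterm \<alpha> pv) - L" "(\<Sum>\<alpha>\<in>X. mterm \<alpha> pv) - L"] False X(1)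
      by auto
    then show ?thesis
      using C1 by linarith
  qed
  define s where "s = (\<lambda>\<alpha>. \<Sum>j<d. \<alpha> j :: nat)"
  have val_c: "val (c \<alpha> $ i) * R ^ s \<alpha> \<le> C" if "\<alpha> \<in> E" for \<alpha>
    using C[OF that] by (simp add: mterm_def pv_def val_mult val_prod val_power R_def s_def power_sum)
  have mono: "gauss_le (\<lambda>_. \<rho>) d (C * (\<rho> / R) ^ s \<alpha>) (mterm \<alpha>)" if "\<alpha> \<in> E" "0 < \<rho>" for \<alpha> \<rho>
  proof -
    have "gauss_le (\<lambda>_. \<rho>) d (\<Prod>j<d. \<rho> ^ \<alpha> j) (\<Prod>j<d. (\<lambda>w. w j) ^ \<alpha> j)"
      by (intro gauss_le_prod gauss_le_power that gauss_le_var[of "\<lambda>_. \<rho>"]) auto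
    from gauss_le_cmult[of "\<lambda>_. \<rho>", OF that(2) this, of "c \<alpha> $ i"]
    have "gauss_le (\<lambda>_. \<rho>) d (val (c \<alpha> $ i) * \<rho> ^ s \<alpha>) (mterm \<alpha>)"
      by (simp add: mterm_def prod_fun_apply power_fun_apply s_def power_sum)
    moreover have "val (c \<alpha> $ i) * \<rho> ^ s \<alpha> \<le> C * (\<rho> / R) ^ s \<alpha>"
      using mult_right_mono[OF val_c[OF that(1)], of "(\<rho> / R) ^ s \<alpha>"] that(2) R
      by (simp add: power_divide)
    ultimately show ?thesis
      by (rule gauss_le_mono_bound[of "\<lambda>_. \<rho>", OF that(2)])
  qed
  \<comment> \<open>Boxes of multi-indices: outside the \<open>n\<close>-th box some exponent
    exceeds \<open>n\<close>, hence so does the total degree, which yields the factor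
    \<open>(\<rho> / R) ^ Suc n\<close>.\<close>
  define A where "A = (\<lambda>n. {..<d} \<rightarrow>\<^sub>E {..n :: nat})"
  have A: "finite (A n)" "A n \<subseteq> E" "A n \<subseteq> A (Suc n)" for n
    by (auto simp: A_def E_def PiE_iff intro!: finite_PiE le_SucI)
  define F where "F = (\<lambda>n w. \<Sum>\<alpha>\<in>A n. mterm \<alpha> w)"
  have F_eq: "F n = (\<Sum>\<alpha>\<in>A n. mterm \<alpha>)" for n
    by (simp add: F_def fun_eq_iff sum_fun_apply)
  show ?thesis
  proof (rule that[of R C F])
    show "gauss_le (\<lambda>_. R) d C (F 0)"
      unfolding F_eq
    proof (rule gauss_le_sum[of "\<lambda>_. R", OF R(1)])
      show "gauss_le (\<lambda>_. R) d C (mterm \<alpha>)" if "\<alpha> \<in> A 0" for \<alpha>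
        using mono[of \<alpha> R] A(2)[of 0] that R by auto
    qed (use C1 in simp)
  next
    fix \<rho> n assume \<rho>: "0 < \<rho>" "\<rho> \<le> R"
    have eq: "F (Suc n) - F n = (\<Sum>\<alpha>\<in>A (Suc n) - A n. mterm \<alpha>)"
      unfolding F_eq using A by (simp add: sum_diff)
    show "gauss_le (\<lambda>_. \<rho>) d (C * (\<rho> / R) ^ Suc n) (F (Suc n) - F n)"
      unfolding eq
    proof (rule gauss_le_sum[of "\<lambda>_. \<rho>", OF \<rho>(1)])
      show "0 \<le> C * (\<rho> / R) ^ Suc n"
        using C1 \<rho> R by simp
      fix \<alpha> assume \<alpha>: "\<alpha> \<in> A (Suc n) - A n"
      then obtain j where j: "j < d" "n < \<alpha> j"
        by (auto simp: A_def PiE_iff not_le)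
      then have "\<alpha> j \<le> s \<alpha>"
        unfolding s_def by (intro member_le_sum) auto
      then have "(\<rho> / R) ^ s \<alpha> \<le> (\<rho> / R) ^ Suc n"
        using j \<rho> R by (intro power_decreasing) auto
      then have "C * (\<rho> / R) ^ s \<alpha> \<le> C * (\<rho> / R) ^ Suc n"
        using C1 by (intro mult_left_mono) auto
      moreover have "\<alpha> \<in> E"
        using \<alpha> A(2) by blast
      ultimately show "gauss_le (\<lambda>_. \<rho>) d (C * (\<rho> / R) ^ Suc n) (mterm \<alpha>)"
        using gauss_le_mono_bound[of "\<lambda>_. \<rho>", OF \<rho>(1) mono[OF _ \<rho>(1)]] by blast
    qed
  next
    fix w assume w: "\<And>j. j < d \<Longrightarrow> val (w j) \<le> R"
    have "filterlim A (finite_subsets_at_top E) sequentially"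
      unfolding filterlim_finite_subsets_at_top
    proof (intro allI impI, elim conjE)
      fix X assume X: "finite X" "X \<subseteq> E"
      define n where "n = Max (insert 0 ((\<lambda>(\<alpha>, j). \<alpha> j) ` (X \<times> {..<d})))"
      have "X \<subseteq> A k" if "n \<le> k" for k
      proof
        fix \<alpha> assume \<alpha>: "\<alpha> \<in> X"
        have "\<alpha> j \<le> n" if "j < d" for j
          unfolding n_def using X(1) \<alpha> that by (intro Max_ge) auto
        then show "\<alpha> \<in> A k"
          using \<alpha> X(2) \<open>n \<le> k\<close> by (force simp: A_def E_def PiE_iff)
      qed
      then show "eventually (\<lambda>k. finite (A k) \<and> X \<subseteq> A k \<and> A k \<subseteq> E) sequentially"
        using A by (auto simp: eventually_sequentially)
    qed
    from filterlim_compose[OF lim'[OF w, unfolded val_tendsto_def] this]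
    show "val_tendsto (\<lambda>n. F n w) (u (a + vec d w) $ i) sequentially"
      by (simp add: val_tendsto_def F_def)
  qed (use R C1 in auto)
qed

lemma smooth_alongI:
  "(\<And>ks. set ks \<subseteq> J \<Longrightarrow> length ks \<le> n \<Longrightarrow> \<exists>L. val_tendsto (fold diff_quot ks A) L F) \<Longrightarrow> smooth_along F J n A"
proof (induction n arbitrary: A)
  case 0
  then show ?case
    using 0[of "[]"] by simp
next
  case (Suc n)
  have "\<exists>L. val_tendsto (fold diff_quot ks (diff_quot j A)) L F"
    if "j \<in> J" "set ks \<subseteq> J" "length ks \<le> n" for j ks
    using Suc.prems[of "j # ks"] that by simp
  then have "smooth_along F J n (diff_quot j A)" if "j \<in> J" for j
    using that by (intro Suc.IH) auto
  moreover have "\<exists>L. val_tendsto A L F"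
    using Suc.prems[of "[]"] by simp
  ultimately show ?case
    by simp
qed

lemma val_tendsto_le:
  assumes "val_tendsto s L sequentially" "eventually (\<lambda>n. val (s n) \<le> c) sequentially" "0 < c"
  shows "val L \<le> c"
proof -
  have "eventually (\<lambda>n. val (s n - L) < c) sequentially"
    using assms(1,3) by (simp add: val_tendsto_iff)
  with assms(2) have "eventually (\<lambda>n. val (s n - L) < c \<and> val (s n) \<le> c) sequentially"
    by eventually_elim simp
  then obtain n where "val (s n - L) < c" "val (s n) \<le> c"
    by (auto simp: eventually_sequentially)
  then show ?thesis
    using val_diff_ultrametric[of "s n" "s n - L"] by auto
qed

section \<open>A Cauchy estimate for iterated difference quotients\<close>

context
  fixes d :: nat and x0 :: "nat \<Rightarrow> 'k" and I :: "nat set" and B \<rho> :: real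
  assumes B: "0 \<le> B" and \<rho>: "0 < \<rho>"
begin

text \<open>The condition \<open>val (t j) * B \<le> \<rho>\<close> makes the region stable under
  shifts with index in \<open>I\<close>, so that bounds can be iterated.\<close>

definition small_region :: "'k point_dirs_steps set" where
  "small_region = {(x, v, t). \<forall>i<d. val (x i - x0 i) \<le> \<rho> \<and>
     (\<forall>j\<in>I. val (v j i) \<le> B \<and> val (t j) * B \<le> \<rho> \<and> t j \<noteq> 0)}"

lemma small_region_shift:
  assumes "p \<in> small_region" "j \<in> I"
  shows "shift_point j p \<in> small_region"
proof -
  obtain x v t where p: "p = (x, v, t)"
    by (cases p)
  have "val (x i + t j * v j i - x0 i) \<le> \<rho>" if "i < d" for i
  proof -
    have *: "val (x i - x0 i) \<le> \<rho>" "val (v j i) \<le> B" "val (t j) * B \<le> \<rho>"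
      using assms that by (auto simp: p small_region_def)
    have "val (t j * v j i) \<le> val (t j) * B"
      using *(2) val_nonneg by (simp add: val_mult mult_left_mono)
    then have "val (t j * v j i) \<le> \<rho>"
      using *(3) by linarith
    then show ?thesis
      using val_ultrametric[of "x i - x0 i" "t j * v j i"] *(1) by (simp add: algebra_simps)
  qed
  then show ?thesis
    using assms by (auto simp: p small_region_def shift_point_def)
qed

text \<open>The difference-quotient form of Cauchy's estimate: each quotient may cost one factor
  \<open>B / \<rho>\<close>, the size of the directions over the radius.\<close>

definition quot_le :: "real \<Rightarrow> ('k point_dirs_steps \<Rightarrow> 'k) \<Rightarrow> bool" where
  "quot_le c A \<longleftrightarrow> (\<forall>ks. set ks \<subseteq> I \<longrightarrow>
     (\<forall>p\<in>small_region. val (fold diff_quot ks A p) \<le> c * (B / \<rho>) ^ length ks))"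

lemma quot_le_diff_quot: "quot_le c A \<Longrightarrow> j \<in> I \<Longrightarrow> quot_le (c * (B / \<rho>)) (diff_quot j A)"
  unfolding quot_le_def
proof (intro allI impI ballI)
  fix ks p
  assume *: "\<forall>ks. set ks \<subseteq> I \<longrightarrow> (\<forall>p\<in>small_region. val (fold diff_quot ks A p) \<le> c * (B / \<rho>) ^ length ks)"
    "j \<in> I" "set ks \<subseteq> I" "p \<in> small_region"
  have "val (fold diff_quot (j # ks) A p) \<le> c * (B / \<rho>) ^ length (j # ks)"
    using * by (metis insert_subset list.simps(15))
  then show "val (fold diff_quot ks (diff_quot j A) p) \<le> c * (B / \<rho>) * (B / \<rho>) ^ length ks"
    by (simp add: mult_ac)
qed

lemma quot_le_shift: "quot_le c A \<Longrightarrow> j \<in> I \<Longrightarrow> quot_le c (\<lambda>p. A (shift_point j p))"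
  unfolding quot_le_def fold_diff_quot_shift using small_region_shift by blast

lemma quot_le_add: "quot_le c A \<Longrightarrow> quot_le c A' \<Longrightarrow> quot_le c (\<lambda>p. A p + A' p)"
  unfolding quot_le_def fold_diff_quot_add using val_ultrametric by (meson max.boundedI order_trans)

lemma quot_le_zero: "0 \<le> c \<Longrightarrow> quot_le c (\<lambda>_. 0)"
  unfolding quot_le_def fold_diff_quot_zero using B \<rho> by simp

lemma quot_le_const:
  assumes "val a \<le> c"
  shows "quot_le c (\<lambda>_. a)"
  unfolding quot_le_def
proof (intro allI impI ballI)
  fix ks p
  have c: "0 \<le> c"
    using assms val_nonneg[of a] by linarith
  have "diff_quot j (\<lambda>_. a) = (\<lambda>_. 0)" for j
    by (simp add: diff_quot_def fun_eq_iff)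
  then show "val (fold diff_quot ks (\<lambda>_. a) p) \<le> c * (B / \<rho>) ^ length ks"
    using assms B \<rho> c by (cases ks) (simp_all add: fold_diff_quot_zero)
qed

lemma quot_le_sum: "0 \<le> c \<Longrightarrow> (\<And>i. i \<in> S \<Longrightarrow> quot_le c (A i)) \<Longrightarrow> quot_le c (\<lambda>p. \<Sum>i\<in>S. A i p)"
  by (induction S rule: infinite_finite_induct) (simp_all add: quot_le_zero quot_le_add)

lemma quot_le_mono: "quot_le c A \<Longrightarrow> c \<le> c' \<Longrightarrow> quot_le c' A"
  unfolding quot_le_def using B \<rho> by (meson divide_nonneg_pos mult_right_mono order_trans zero_le_power)

text \<open>The product rule gives each quotient to one of the two factors, and the ultrametric
  inequality absorbs the number of summands, so no binomial constants arise.\<close>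

lemma quot_le_mult:
  assumes "quot_le c A" "quot_le c' A'"
  shows "quot_le (c * c') (\<lambda>p. A p * A' p)"
proof -
  have "val (fold diff_quot ks (\<lambda>p. A p * A' p) p) \<le> c * c' * (B / \<rho>) ^ length ks"
    if "set ks \<subseteq> I" "p \<in> small_region" for ks p
    using that(1) assms
  proof (induction ks arbitrary: A A' c c')
    case Nil
    have "val (A p) \<le> c" "val (A' p) \<le> c'"
      using Nil that(2) unfolding quot_le_def by (metis fold_simps(1) list.size(3) mult.right_neutral power_0)+
    then show ?case
      using val_nonneg[of "A p"] val_nonneg[of "A' p"] by (auto simp: val_mult intro!: mult_mono)
  next
    case (Cons j ks)
    have "val (fold diff_quot ks (\<lambda>p. diff_quot j A p * A' p) p) \<le> c * (B / \<rho>) * c' * (B / \<rho>) ^ length ks"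
      using Cons.prems by (intro Cons.IH quot_le_diff_quot) auto
    moreover have "val (fold diff_quot ks (\<lambda>p. A (shift_point j p) * diff_quot j A' p) p) \<le> c * (c' * (B / \<rho>)) * (B / \<rho>) ^ length ks"
      using Cons.prems by (intro Cons.IH quot_le_diff_quot quot_le_shift) auto
    moreover have "c * (B / \<rho>) * c' * (B / \<rho>) ^ length ks = c * c' * (B / \<rho>) ^ length (j # ks)"
      "c * (c' * (B / \<rho>)) * (B / \<rho>) ^ length ks = c * c' * (B / \<rho>) ^ length (j # ks)"
      by simp_all
    moreover have "fold diff_quot (j # ks) (\<lambda>p. A p * A' p) p =
        fold diff_quot ks (\<lambda>p. diff_quot j A p * A' p) p +
        fold diff_quot ks (\<lambda>p. A (shift_point j p) * diff_quot j A' p) p"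
      by (simp only: fold_Cons o_apply diff_quot_mult fold_diff_quot_add)
    ultimately show ?case
      using val_ultrametric[of "fold diff_quot ks (\<lambda>p. diff_quot j A p * A' p) p"
          "fold diff_quot ks (\<lambda>p. A (shift_point j p) * diff_quot j A' p) p"]
      by (simp only: max_def split: if_splits)
  qed
  then show ?thesis
    by (simp add: quot_le_def)
qed

lemma quot_le_power: "quot_le c A \<Longrightarrow> quot_le (c ^ k) (\<lambda>p. A p ^ k)"
  by (induction k) (simp_all add: quot_le_const quot_le_mult)

text \<open>The first quotient of a coordinate is a component of a direction, of value at most
  \<open>B = \<rho> * (B / \<rho>)\<close>; all further quotients vanish.\<close>

lemma quot_le_coord:
  assumes "i < d"
  shows "quot_le \<rho> (\<lambda>(x, v, t). x i - x0 i)"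
  unfolding quot_le_def
proof (intro allI impI ballI)
  fix ks p assume ks: "set ks \<subseteq> I" and p: "p \<in> small_region"
  let ?A = "\<lambda>(x, v, t). x i - x0 i"
  have dd: "diff_quot k (diff_quot j ?A) = (\<lambda>_. 0)" for j k
    by (auto simp: diff_quot_def shift_point_def step_def fun_eq_iff)
  consider "ks = []" | j where "ks = [j]" | j k ks' where "ks = j # k # ks'"
    by (metis list.exhaust)
  then show "val (fold diff_quot ks ?A p) \<le> \<rho> * (B / \<rho>) ^ length ks"
  proof cases
    case 1
    then show ?thesis
      using p assms by (auto simp: small_region_def)
  next
    case (2 j)
    obtain x v t where xvt: "p = (x, v, t)"
      by (cases p)
    have "t j \<noteq> 0" "val (v j i) \<le> B"
      using p ks 2 assms by (auto simp: xvt small_region_def)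
    then show ?thesis
      using \<rho> 2 by (simp add: xvt diff_quot_def shift_point_def step_def)
  next
    case 3
    then show ?thesis
      using \<rho> B by (simp add: dd fold_diff_quot_zero)
  qed
qed

text \<open>From coordinates the estimate passes to monomials with their Gauss weights and then to
  polynomials. No constant is lost, so it is uniform in the degree and passes to series.\<close>

lemma quot_le_gauss:
  assumes "gauss_le (\<lambda>_. \<rho>) m C \<phi>" "m \<le> d"
  shows "quot_le C (\<lambda>(x, v, t). \<phi> (\<lambda>j. x j - x0 j))"
  using assms
proof (induction m arbitrary: C \<phi>)
  case 0
  then obtain c where "\<phi> = (\<lambda>_. c)" "val c \<le> C"
    by auto
  then show ?case
    using quot_le_const[of c C] by (simp add: case_prod_unfold)
next
  case (Suc m)
  then obtain p where p: "\<phi> = poly p (\<lambda>z. z m)" "\<And>k. gauss_le (\<lambda>_. \<rho>) m (C / \<rho> ^ k) (coeff p k)"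
    by auto
  let ?c = "\<lambda>k (q :: 'k point_dirs_steps). (\<lambda>(x, v, t). coeff p k (\<lambda>j. x j - x0 j)) q"
  let ?x = "\<lambda>q. (\<lambda>(x, v, t). x m - x0 m) q"
  have "quot_le C (\<lambda>q. \<Sum>k\<le>degree p. ?c k q * ?x q ^ k)"
  proof (rule quot_le_sum)
    show "0 \<le> C"
      using gauss_le_nonneg[OF Suc.prems(1)] .
    fix k
    have "quot_le (C / \<rho> ^ k * \<rho> ^ k) (\<lambda>q. ?c k q * ?x q ^ k)"
      using Suc.prems(2) by (intro quot_le_mult quot_le_power quot_le_coord Suc.IH p(2)) auto
    then show "quot_le C (\<lambda>q. ?c k q * ?x q ^ k)"
      using \<rho> by simp
  qed
  moreover have "(\<lambda>q. \<Sum>k\<le>degree p. ?c k q * ?x q ^ k) = (\<lambda>(x, v, t). \<phi> (\<lambda>j. x j - x0 j))"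
    by (auto simp: p(1) poly_fun_apply[OF order_refl])
  ultimately show ?case
    by (simp only:)
qed

text \<open>At fixed steps an iterated quotient is a finite linear combination of values, so
  pointwise convergence on the region is enough.\<close>

lemma fold_diff_quot_tendsto:
  assumes "\<And>q. q \<in> small_region \<Longrightarrow> val_tendsto (\<lambda>n. A n q) (A' q) sequentially"
    and "set ks \<subseteq> I" "p \<in> small_region"
  shows "val_tendsto (\<lambda>n. fold diff_quot ks (A n) p) (fold diff_quot ks A' p) sequentially"
  using assms
proof (induction ks arbitrary: A A')
  case (Cons j ks)
  have "val_tendsto (\<lambda>n. diff_quot j (A n) q) (diff_quot j A' q) sequentially" if "q \<in> small_region" for q
  proof -
    have "val_tendsto (\<lambda>n. (A n (shift_point j q) + - 1 * A n q) * inverse (step j q))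
        ((A' (shift_point j q) + - 1 * A' q) * inverse (step j q)) sequentially"
      using Cons.prems(2) by (intro val_tendsto_mult val_tendsto_add val_tendsto_const Cons.prems(1)
          small_region_shift that) auto
    then show ?thesis
      by (simp add: diff_quot_def divide_inverse)
  qed
  then show ?case
    using Cons by simp
qed simp

end

lemma smooth_coord:
  assumes "c < d"
  shows "smooth_along (point_filter d x0 v0 t0) {j. t0 j = 0} n (\<lambda>(x, v, t). x c - b)"
proof -
  let ?F = "point_filter d x0 v0 t0" and ?J = "{j. t0 j = 0}"
  have F: "filterlim (shift_point j) ?F ?F" "val_tendsto (step j) 0 ?F" if "j \<in> ?J" for j
    using point_filter_shift[of j d x0 t0 v0] point_filter_tendsto(3)[of j t0 d x0 v0] that by auto
  note F = F eventually_step_nonzero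
  have lim: "\<exists>L. val_tendsto (\<lambda>(x, v, t). x c - b) L ?F"
  proof -
    have "val_tendsto (\<lambda>p. (\<lambda>(x, v, t). x c) p + - b) (x0 c + - b) ?F"
      by (intro val_tendsto_add val_tendsto_const point_filter_tendsto(1) assms)
    then show ?thesis
      by (auto simp: case_prod_unfold)
  qed
  show ?thesis
  proof (cases n)
    case (Suc k)
    have "smooth_along ?F ?J k (diff_quot j (\<lambda>(x, v, t). x c - b))" if "j \<in> ?J" for j
    proof (rule smooth_cong[OF F])
      show "smooth_along ?F ?J k (\<lambda>(x, v, t). v j c)"
      proof (rule smooth_invariant[OF F])
        show "\<exists>L. val_tendsto (\<lambda>(x, v, t). v j c) L ?F"
          by (rule exI, rule point_filter_tendsto(2)[OF assms])
      qed (auto simp: shift_point_def)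
      show "eventually (\<lambda>p. (\<lambda>(x, v, t). v j c) p = diff_quot j (\<lambda>(x, v, t). x c - b) p) ?F"
        using eventually_step_nonzero[of j] by eventually_elim (rule diff_quot_coord[symmetric])
    qed
    with lim show ?thesis
      by (simp add: Suc)
  qed (use lim in simp)
qed

lemma smooth_gauss:
  assumes "gauss_le \<rho> m C \<phi>" "m \<le> d"
  shows "smooth_along (point_filter d x0 v0 t0) {j. t0 j = 0} n (\<lambda>(x, v, t). \<phi> (\<lambda>j. x j - x0 j))"
  using assms
proof (induction m arbitrary: C \<phi>)
  let ?F = "point_filter d x0 v0 t0" and ?J = "{j. t0 j = 0}"
  have F: "filterlim (shift_point j) ?F ?F" "val_tendsto (step j) 0 ?F" if "j \<in> ?J" for j
    using point_filter_shift[of j d x0 t0 v0] point_filter_tendsto(3)[of j t0 d x0 v0] that by auto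
  note F = F eventually_step_nonzero
  {
    case 0
    then obtain c where "\<phi> = (\<lambda>_. c)"
      by auto
    moreover have "smooth_along ?F ?J n (\<lambda>_. c)"
      by (rule smooth_const[OF F])
    ultimately show ?case
      by (simp add: case_prod_unfold)
  next
    case (Suc m)
    then obtain p where p: "\<phi> = poly p (\<lambda>z. z m)" "\<And>k. gauss_le \<rho> m (C / \<rho> m ^ k) (coeff p k)"
      by auto
    let ?c = "\<lambda>k (q :: 'k point_dirs_steps). (\<lambda>(x, v, t). coeff p k (\<lambda>j. x j - x0 j)) q"
    let ?x = "\<lambda>q. (\<lambda>(x, v, t). x m - x0 m) q"
    have "smooth_along ?F ?J n (\<lambda>q. \<Sum>k\<le>degree p. ?c k q * ?x q ^ k)"
      using Suc.prems(2)
      by (intro smooth_sum[OF F] smooth_mult[OF F] smooth_power[OF F] smooth_coord Suc.IH[OF p(2)]) auto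
    moreover have "(\<lambda>q. \<Sum>k\<le>degree p. ?c k q * ?x q ^ k) = (\<lambda>(x, v, t). \<phi> (\<lambda>j. x j - x0 j))"
      by (auto simp: p(1) poly_fun_apply[OF order_refl])
    ultimately show ?case
      by (simp only:)
  }
qed

text \<open>For \<open>k\<close> quotients the polynomial \<open>F k\<close> is subtracted: what is
  left has Gauss norm of order \<open>\<rho> ^ (k + 1)\<close> at radius \<open>\<rho>\<close>, and
  the quotients cost \<open>(B / \<rho>) ^ k\<close>. The remainder is thus of order
  \<open>\<rho>\<close> and disappears in the limit, which is that of a polynomial.\<close>

lemma smooth_locally_analytic:
  fixes u :: "'k vec \<Rightarrow> 'k vec"
  assumes u: "locally_analytic val d l u" and i: "i < l"
  shows "smooth_along (point_filter d x0 v0 t0) {j. t0 j = 0} n (\<lambda>(x, v, t). u (vec d x) $ i)"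
proof (rule smooth_alongI)
  fix ks assume ks: "set ks \<subseteq> {j. t0 j = 0}"
  let ?F = "point_filter d x0 v0 t0"
  let ?u = "\<lambda>(x :: nat \<Rightarrow> 'k, v :: nat \<Rightarrow> nat \<Rightarrow> 'k, t :: nat \<Rightarrow> 'k). u (vec d x) $ i"
  define k where "k = length ks"
  obtain F C R where R: "0 < R" and C: "1 \<le> C" and F0: "gauss_le (\<lambda>_. R) d C (F 0)"
    and dF: "\<And>\<rho> n. 0 < \<rho> \<Longrightarrow> \<rho> \<le> R \<Longrightarrow> gauss_le (\<lambda>_. \<rho>) d (C * (\<rho> / R) ^ Suc n) (F (Suc n) - F n)"
    and lim: "\<And>w. (\<And>j. j < d \<Longrightarrow> val (w j) \<le> R) \<Longrightarrow>
      val_tendsto (\<lambda>n. F n w) (u (vec d x0 + vec d w) $ i) sequentially"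
    using locally_analytic_approx[OF u vec_carrier i, of x0] by metis
  define A where "A = (\<lambda>n (x :: nat \<Rightarrow> 'k, v :: nat \<Rightarrow> nat \<Rightarrow> 'k, t :: nat \<Rightarrow> 'k). F n (\<lambda>j. x j - x0 j))"
  \<comment> \<open>Bounds the limiting directions; because of the inserted 1 it also bounds
    directions that differ from them by less than 1.\<close>
  define B where "B = Max (insert 1 ((\<lambda>(j, c). val (v0 j c)) ` (set ks \<times> {..<d})))"
  have B: "1 \<le> B" "\<And>j c. j \<in> set ks \<Longrightarrow> c < d \<Longrightarrow> val (v0 j c) \<le> B"
    unfolding B_def by (auto intro!: Max_ge)
  have FK: "\<exists>C'. gauss_le (\<lambda>_. R) d C' (F n)" for n
  proof (induction n)
    case (Suc n)
    then obtain C' where C': "gauss_le (\<lambda>_. R) d C' (F n)" ..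
    have "gauss_le (\<lambda>_. R) d (max C C') (F (Suc n) - F n + F n)"
    proof (intro gauss_le_add R)
      show "gauss_le (\<lambda>_. R) d (max C C') (F (Suc n) - F n)"
        by (rule gauss_le_mono_bound[of "\<lambda>_. R", OF R dF[OF R order_refl]]) (use R in simp)
      show "gauss_le (\<lambda>_. R) d (max C C') (F n)"
        by (rule gauss_le_mono_bound[of "\<lambda>_. R", OF R C']) simp
    qed
    then show ?case by auto
  qed (use F0 in blast)
  have "val_tendsto (fold diff_quot ks (\<lambda>p. ?u p + - 1 * A k p)) 0 ?F"
    unfolding val_tendsto_iff
  proof (intro allI impI)
    fix e :: real assume e: "0 < e"
    define \<rho> where "\<rho> = min R (e / 2 / (C * (B / R) ^ k / R))"
    have D: "0 < C * (B / R) ^ k / R"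
      using C B(1) R by simp
    have \<rho>: "0 < \<rho>" "\<rho> \<le> R" "C * (B / R) ^ k / R * \<rho> \<le> e / 2"
    proof -
      have "0 < e / 2 / (C * (B / R) ^ k / R)"
        by (rule divide_pos_pos[OF _ D]) (use e in simp)
      then show "0 < \<rho>" "\<rho> \<le> R"
        using R by (auto simp only: \<rho>_def min_less_iff_conj min.cobounded1)
      have "C * (B / R) ^ k / R * \<rho> \<le> C * (B / R) ^ k / R * (e / 2 / (C * (B / R) ^ k / R))"
        using D by (intro mult_left_mono) (auto simp: \<rho>_def)
      also have "\<dots> = e / 2"
        using D by (metis less_irrefl nonzero_mult_div_cancel_left times_divide_eq_right)
      finally show "C * (B / R) ^ k / R * \<rho> \<le> e / 2" .
    qed
    have B0: "0 \<le> B"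
      using B(1) by simp
    let ?S = "small_region d x0 (set ks) B \<rho>"
    let ?q = "quot_le d x0 (set ks) B \<rho>"
    have inc: "?q (C * (\<rho> / R) ^ Suc k) (\<lambda>p. A (k + M) p + - 1 * A k p)" for M
    proof (induction M)
      case 0
      then show ?case
        using quot_le_zero[OF B0 \<rho>(1), of "C * (\<rho> / R) ^ Suc k"] \<rho> C R by simp
    next
      case (Suc M)
      have "?q (C * (\<rho> / R) ^ Suc (k + M)) (\<lambda>(x, v, t). (F (Suc (k + M)) - F (k + M)) (\<lambda>j. x j - x0 j))"
        by (rule quot_le_gauss[OF B0 \<rho>(1) dF[OF \<rho>(1,2)] order_refl])
      moreover have "C * (\<rho> / R) ^ Suc (k + M) \<le> C * (\<rho> / R) ^ Suc k"
        using C \<rho> R by (intro mult_left_mono power_decreasing) auto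
      ultimately have "?q (C * (\<rho> / R) ^ Suc k) (\<lambda>(x, v, t). (F (Suc (k + M)) - F (k + M)) (\<lambda>j. x j - x0 j))"
        using quot_le_mono[OF B0 \<rho>(1)] by blast
      from quot_le_add[OF B0 \<rho>(1) this Suc] show ?case
        by (simp add: A_def case_prod_unfold)
    qed
    have bound: "val (fold diff_quot ks (\<lambda>p. ?u p + - 1 * A k p) p) < e" if p: "p \<in> ?S" for p
    proof -
      have "val_tendsto (\<lambda>M. A (k + M) q + - 1 * A k q) (?u q + - 1 * A k q) sequentially" if q: "q \<in> ?S" for q
      proof -
        obtain x v t where xvt: "q = (x, v, t)"
          by (cases q)
        define w where "w = (\<lambda>j. x j - x0 j)"
        have "val (w j) \<le> R" if "j < d" for j
          using q that \<rho>(2) by (auto simp: xvt small_region_def[OF B0 \<rho>(1)] w_def)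
        then have "val_tendsto (\<lambda>n. F n w) (u (vec d x0 + vec d w) $ i) sequentially"
          by (rule lim)
        moreover have "vec d x0 + vec d w = vec d x"
          by (auto simp: w_def)
        ultimately have "val_tendsto (\<lambda>n. A n q) (?u q) sequentially"
          by (simp add: A_def xvt w_def)
        then have "val_tendsto (\<lambda>M. A (M + k) q) (?u q) sequentially"
          unfolding val_tendsto_def by (rule LIMSEQ_ignore_initial_segment)
        then show ?thesis
          by (intro val_tendsto_add val_tendsto_const) (simp add: add.commute)
      qed
      then have "val_tendsto (\<lambda>M. fold diff_quot ks (\<lambda>p. A (k + M) p + - 1 * A k p) p)
          (fold diff_quot ks (\<lambda>p. ?u p + - 1 * A k p) p) sequentially"
        by (rule fold_diff_quot_tendsto[OF B0 \<rho>(1) _ order_refl p])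
      moreover have "val (fold diff_quot ks (\<lambda>p. A (k + M) p + - 1 * A k p) p) \<le> C * (\<rho> / R) ^ Suc k * (B / \<rho>) ^ k" for M
        using inc[of M] p unfolding quot_le_def[OF B0 \<rho>(1)] k_def by blast
      ultimately have "val (fold diff_quot ks (\<lambda>p. ?u p + - 1 * A k p) p) \<le> C * (\<rho> / R) ^ Suc k * (B / \<rho>) ^ k"
        by (intro val_tendsto_le[where s = "\<lambda>M. fold diff_quot ks (\<lambda>p. A (k + M) p + - 1 * A k p) p"])
          (use C \<rho> R B(1) in auto)
      also have "\<dots> = C * (B / R) ^ k / R * \<rho>"
        using \<rho>(1) R by (simp add: power_divide field_simps)
      finally show ?thesis
        using \<rho>(3) e by linarith
    qed
    \<comment> \<open>The entry 1 keeps the directions within \<open>B\<close>,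
      \<open>\<rho>\<close> keeps the base point in the polydisc, and \<open>\<rho> / B\<close>
      makes the steps so small that shifts stay inside.\<close>
    define \<delta> where "\<delta> = min 1 (min \<rho> (\<rho> / B))"
    have "0 < \<delta>"
      using \<rho> B(1) by (simp add: \<delta>_def)
    moreover have "p \<in> ?S" if p: "p \<in> near_point d x0 v0 t0 \<delta>" for p
    proof -
      obtain x v t where xvt: "p = (x, v, t)"
        by (cases p)
      have "val (v j c) \<le> B" if "j \<in> set ks" "c < d" for j c
      proof -
        have "val (v j c - v0 j c) < 1"
          using p that by (auto simp: xvt near_point_def \<delta>_def)
        then show ?thesis
          using val_ultrametric[of "v j c - v0 j c" "v0 j c"] B(1) B(2)[OF that] by simp
      qed
      moreover have "val (t j) * B \<le> \<rho> \<and> t j \<noteq> 0" if "j \<in> set ks" for j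
      proof -
        have "t0 j = 0"
          using ks that by auto
        then have "val (t j) < \<rho> / B" "t j \<noteq> 0"
          using p by (auto simp: xvt near_point_def \<delta>_def) (metis diff_zero)
        then show ?thesis
          using B(1) by (simp add: field_simps)
      qed
      moreover have "val (x c - x0 c) \<le> \<rho>" if "c < d" for c
        using p that by (auto simp: xvt near_point_def \<delta>_def intro: less_imp_le)
      ultimately show ?thesis
        by (auto simp: xvt small_region_def[OF B0 \<rho>(1)])
    qed
    ultimately show "eventually (\<lambda>p. val (fold diff_quot ks (\<lambda>p. ?u p + - 1 * A k p) p - 0) < e) ?F"
      unfolding eventually_point_filter using bound by auto
  qed
  moreover have "\<exists>L. val_tendsto (fold diff_quot ks (A k)) L ?F"
  proof -
    obtain C' where "gauss_le (\<lambda>_. R) d C' (F k)"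
      using FK by blast
    from smooth_gauss[OF this order_refl] show ?thesis
      unfolding A_def using smooth_along_fold[OF _ ks, of _ k] by (simp add: k_def)
  qed
  ultimately obtain L where
    "val_tendsto (\<lambda>p. fold diff_quot ks (\<lambda>p. ?u p + - 1 * A k p) p + fold diff_quot ks (A k) p) (0 + L) ?F"
    using val_tendsto_add by blast
  moreover have "(\<lambda>p. fold diff_quot ks (\<lambda>p. ?u p + - 1 * A k p) p + fold diff_quot ks (A k) p) = fold diff_quot ks ?u"
    unfolding fold_diff_quot_add[symmetric] by simp
  ultimately show "\<exists>L. val_tendsto (fold diff_quot ks ?u) L ?F"
    by auto
qed

end

section \<open>The counterexample\<close>

context nontrivial_nonarch_valuation
begin

lemma val_tendsto_val:
  assumes "val_tendsto A L F"
  shows "((\<lambda>p. val (A p)) \<longlongrightarrow> val L) F"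
proof -
  have "((\<lambda>p. val (A p) - val L) \<longlongrightarrow> 0) F"
    by (rule Lim_null_comparison[OF _ assms[unfolded val_tendsto_def]]) (simp add: abs_val_diff_le)
  then show ?thesis
    by (simp add: LIM_zero_iff)
qed

lemma smooth_fun_continuous:
  assumes "smooth_fun d G" "0 < e"
  obtains \<delta> where "0 < \<delta>" "\<And>x. (\<And>c. c < d \<Longrightarrow> val (x c - a c) < \<delta>) \<Longrightarrow> val (G x - G a) < e"
proof -
  obtain L where L: "\<And>e. 0 < e \<Longrightarrow> \<exists>\<delta>>0. \<forall>x. (\<forall>c<d. val (x c - a c) < \<delta>) \<longrightarrow> val (G x - L) < e"
    using assms(1)[unfolded smooth_fun_def, THEN spec[of _ 0], THEN spec[of _ a]] by auto
  obtain \<delta> where \<delta>: "0 < \<delta>" "\<forall>x. (\<forall>c<d. val (x c - a c) < \<delta>) \<longrightarrow> val (G x - L) < e"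
    using L[OF assms(2)] by blast
  have "val (G x - G a) < e" if "\<And>c. c < d \<Longrightarrow> val (x c - a c) < \<delta>" for x
  proof -
    have "val (G x - L) < e" "val (G a - L) < e"
      using \<delta> that by auto
    then show ?thesis
      using val_diff_ultrametric[of "G x - L" "G a - L"] by auto
  qed
  with \<delta>(1) show ?thesis
    using that by blast
qed

lemma smooth_fun_point_filter:
  assumes "smooth_fun d G"
  shows "val_tendsto (\<lambda>(x, v, t). G x) (G x0) (point_filter d x0 v0 t0)"
  unfolding val_tendsto_iff
proof (intro allI impI)
  fix e :: real assume "0 < e"
  then obtain \<delta> where "0 < \<delta>" "\<And>x. (\<And>c. c < d \<Longrightarrow> val (x c - x0 c) < \<delta>) \<Longrightarrow> val (G x - G x0) < e"
    using smooth_fun_continuous[OF assms, where a = x0] by blast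
  then show "eventually (\<lambda>p. val ((\<lambda>(x, v, t). G x) p - G x0) < e) (point_filter d x0 v0 t0)"
    unfolding eventually_point_filter by (intro exI[of _ \<delta>]) (auto simp: near_point_def)
qed

lemma smooth_fun_locally_analytic:
  fixes u :: "'k vec \<Rightarrow> 'k vec"
  assumes "locally_analytic val d l u" "i < l"
  shows "smooth_fun d (\<lambda>x. u (vec d x) $ i)"
  by (intro smooth_fun_local smooth_locally_analytic[OF assms])

lemma eventually_atin_field:
  "eventually P (atin (field_topology val) a) \<longleftrightarrow> (\<exists>\<delta>>0. \<forall>y. y \<noteq> a \<longrightarrow> val (y - a) < \<delta> \<longrightarrow> P y)"
proof -
  interpret Metric_space "UNIV :: 'k set" "\<lambda>x y. val (x - y)"
    by (rule Metric_space_field)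
  show ?thesis
    by (auto simp: field_topology_def eventually_atin_metric val_pos_iff)
qed

text \<open>The chain rule in the case without directions and steps.\<close>

lemma smooth_compose_point_filter:
  assumes "smooth_fun e G"
    and "\<And>c. c < e \<Longrightarrow> smooth_along (point_filter d x0 v0 t0) {j. t0 j = 0} n (\<lambda>p. W p c)"
  shows "smooth_along (point_filter d x0 v0 t0) {j. t0 j = 0} n (\<lambda>p. G (W p))"
proof -
  let ?F = "point_filter d x0 v0 t0" and ?J = "{j. t0 j = 0}"
  have F: "filterlim (shift_point j) ?F ?F" "val_tendsto (step j) 0 ?F" if "j \<in> ?J" for j
    using point_filter_shift[of j d x0 t0 v0] point_filter_tendsto(3)[of j t0 d x0 v0] that by auto
  have "smooth_along ?F ?J n (\<lambda>p. iter_diff_quot 0 G (W p) (\<lambda>l. (\<lambda>_. 0)) (\<lambda>l. 0))"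
    by (rule smooth_compose[where V = "\<lambda>_ _ _. 0" and T = "\<lambda>_ _. 0", OF F eventually_step_nonzero assms(1)])
      (use assms(2) in auto)
  then show ?thesis
    by simp
qed

section \<open>Vanishing, smoothness of compositions and discontinuity\<close>

context
  fixes m :: nat and h :: "nat \<Rightarrow> 'k \<Rightarrow> 'k" and g f :: "'k vec \<Rightarrow> 'k"
  assumes h_smooth: "\<And>j. j \<le> m \<Longrightarrow> (\<lambda>y. vec1 (h j (y $ 0))) \<in> C_infinity val 1 1"
    and h_0: "\<And>j. j \<le> m \<Longrightarrow> h j 0 = 0"
    and h0_nz: "\<And>y. y \<noteq> 0 \<Longrightarrow> h 0 y \<noteq> 0"
    and h_nz: "\<And>j. j \<in> {1..m} \<Longrightarrow> \<forall>\<^sub>F y in atin (field_topology val) 0. h j y \<noteq> 0"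
    and h_sep: "\<And>j n :: nat. j \<in> {1..m} \<Longrightarrow>
           limitin (field_topology val) (\<lambda>y. h (j - 1) y / h j y ^ n) 0 (atin (field_topology val) 0)"
    and h_flat: "\<And>n :: nat.
           limitin (field_topology val) (\<lambda>y. h m y / y ^ n) 0 (atin (field_topology val) 0)"
    and g_smooth: "(\<lambda>x. vec1 (g x)) \<in> C_infinity val m 1"
    and g_supp: "\<And>x. x \<in> carrier_vec m \<Longrightarrow> max_norm val x > 1 \<Longrightarrow> g x = 0"
    and f_eq: "\<And>x y. x \<in> carrier_vec m \<Longrightarrow> y \<noteq> 0 \<Longrightarrow>
           f (x @\<^sub>v vec1 y) = g ((1 / h 0 y) \<cdot>\<^sub>v (x - vec m (\<lambda>i. h (i + 1) y)))"
    and f_0: "\<And>x. x \<in> carrier_vec m \<Longrightarrow> f (x @\<^sub>v vec1 0) = 0"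
begin

lemma h_smooth_fun: "j \<le> m \<Longrightarrow> smooth_fun 1 (\<lambda>x. h j (x 0))"
  using C_infinity_imp_smooth_fun[OF h_smooth] by simp

lemma g_smooth_fun: "smooth_fun m (\<lambda>x. g (vec m x))"
  by (rule C_infinity_imp_smooth_fun[OF g_smooth])

lemma h_continuous:
  assumes "j \<le> m" "0 < e"
  obtains \<delta> where "0 < \<delta>" "\<And>y. val (y - y0) < \<delta> \<Longrightarrow> val (h j y - h j y0) < e"
proof -
  obtain \<delta> where \<delta>: "0 < \<delta>"
    "\<And>x. (\<And>c. c < 1 \<Longrightarrow> val (x c - y0) < \<delta>) \<Longrightarrow> val (h j (x (0::nat)) - h j y0) < e"
    using smooth_fun_continuous[OF h_smooth_fun[OF assms(1)] assms(2), where a = "\<lambda>_. y0"] by blast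
  have "val (h j y - h j y0) < e" if "val (y - y0) < \<delta>" for y
    using \<delta>(2)[of "\<lambda>_. y"] that by simp
  with \<delta>(1) show ?thesis
    using that by blast
qed

lemma h_less:
  assumes "j \<in> {1..m}"
  shows "\<forall>\<^sub>F y in atin (field_topology val) 0. val (h (j - 1) y) < val (h j y) ^ n \<and> h j y \<noteq> 0"
proof -
  have "\<forall>\<^sub>F y in atin (field_topology val) 0. val (h (j - 1) y / h j y ^ n - 0) < 1"
    by (rule h_sep[OF assms, of n, unfolded limitin_field_iff val_tendsto_iff, rule_format]) simp
  with h_nz[OF assms] show ?thesis
  proof eventually_elim
    case (elim y)
    then have "0 < val (h j y)"
      by (simp add: val_pos_iff)
    with elim show ?case
      by (simp add: val_divide val_power)
  qed
qed

lemma h_m_less: "\<forall>\<^sub>F y in atin (field_topology val) 0. val (h m y) < val y ^ n \<and> y \<noteq> 0"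
proof -
  have "\<forall>\<^sub>F y in atin (field_topology val) 0. val (h m y / y ^ n - 0) < 1"
    by (rule h_flat[of n, unfolded limitin_field_iff val_tendsto_iff, rule_format]) simp
  moreover have "\<forall>\<^sub>F y in atin (field_topology val) 0. y \<noteq> 0"
    unfolding eventually_atin_field by (intro exI[of _ 1]) auto
  ultimately show ?thesis
  proof eventually_elim
    case (elim y)
    then have "0 < val y"
      by (simp add: val_pos_iff)
    with elim show ?case
      by (simp add: val_divide val_power)
  qed
qed

text \<open>The separation conditions with exponent 1, chained up to \<open>j\<close>. Consequently
  an error of size \<open>h 0\<close> cannot change the value of \<open>h j\<close>.\<close>

lemma h_0_less:
  assumes "j \<in> {1..m}"
  shows "\<forall>\<^sub>F y in atin (field_topology val) 0. val (h 0 y) < val (h j y)"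
proof -
  from assms have "1 \<le> j" "j \<le> m"
    by auto
  then show ?thesis
  proof (induction j rule: dec_induct)
    case base
    then show ?case
      using h_less[of 1 1] by (auto elim: eventually_mono)
  next
    case (step j)
    then have "\<forall>\<^sub>F y in atin (field_topology val) 0. val (h 0 y) < val (h j y)"
      by simp
    moreover have "\<forall>\<^sub>F y in atin (field_topology val) 0. val (h j y) < val (h (Suc j) y) ^ 1 \<and> h (Suc j) y \<noteq> 0"
      using h_less[of "Suc j" 1] step by simp
    ultimately show ?case
      by eventually_elim simp
  qed
qed

lemma split_last:
  assumes "(z :: 'k vec) \<in> carrier_vec (m + 1)"
  shows "z = vec m (\<lambda>i. z $ i) @\<^sub>v vec1 (z $ m)"
  using assms by (auto simp: vec1_def less_Suc_eq intro!: eq_vecI)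

text \<open>A nonzero value of \<open>g\<close> confines its argument to the closed unit ball;
  multiplying by \<open>h 0\<close> gives the bound.\<close>

lemma f_nonzero_imp_near:
  assumes "z \<in> carrier_vec (m + 1)" "f z \<noteq> 0"
  shows "z $ m \<noteq> 0" "\<And>i. i < m \<Longrightarrow> val (z $ i - h (i + 1) (z $ m)) \<le> val (h 0 (z $ m))"
proof -
  let ?x = "vec m (\<lambda>i. z $ i)" and ?y = "z $ m"
  have z: "f z = f (?x @\<^sub>v vec1 ?y)"
    using split_last[OF assms(1)] by simp
  show y: "?y \<noteq> 0"
  proof
    assume "?y = 0"
    with z assms(2) f_0[of ?x] show False
      by simp
  qed
  let ?w = "(1 / h 0 ?y) \<cdot>\<^sub>v (?x - vec m (\<lambda>i. h (i + 1) ?y))"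
  have "f z = g ?w"
    using z f_eq[OF _ y, of ?x] by simp
  then have "\<not> max_norm val ?w > 1"
    using g_supp[of ?w] assms(2) by auto
  then have le: "max_norm val ?w \<le> 1"
    by simp
  show "val (z $ i - h (i + 1) ?y) \<le> val (h 0 ?y)" if "i < m" for i
  proof -
    have "val (?w $ i) \<le> max_norm val ?w"
      unfolding max_norm_def using that by (intro Max_ge) auto
    then have "val ((z $ i - h (i + 1) ?y) / h 0 ?y) \<le> 1"
      using le that by simp
    then show ?thesis
      using h0_nz[OF y] by (simp add: val_divide val_pos_iff)
  qed
qed

lemma f_vanishes_near_zero_of_last:
  fixes u :: "'k vec \<Rightarrow> 'k vec"
  assumes u: "locally_analytic val m (m + 1) u" and a: "u (vec m x0) $ m = 0"
  shows "\<exists>\<delta>>0. \<forall>w. (\<forall>c<m. val (w c) < \<delta>) \<longrightarrow> f (u (vec m x0 + vec m w)) = 0"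
proof (rule ccontr)
  assume "\<not> ?thesis"
  then have neg: "\<exists>w. (\<forall>c<m. val (w c) < \<delta>) \<and> f (u (vec m x0 + vec m w)) \<noteq> 0" if "0 < \<delta>" for \<delta>
    using that by blast
  define Z where "Z = (\<lambda>w. u (vec m x0 + vec m w))"
  have Z: "Z w \<in> carrier_vec (m + 1)" for w
    using u by (auto simp: locally_analytic_def Z_def)
  \<comment> \<open>Displacements from \<open>x0\<close> are used instead of points, so that the
    coordinates become small as the rank inequality requires.\<close>
  define N where "N = (\<lambda>\<delta>::real. {w. (\<forall>c<m. val (w c) < \<delta>) \<and> f (Z w) \<noteq> 0})"
  define \<F> where "\<F> = (INF \<delta>\<in>{0<..}. principal (N \<delta>))"
  have ev: "eventually P \<F> \<longleftrightarrow> (\<exists>\<delta>>0. \<forall>w\<in>N \<delta>. P w)" for P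
    unfolding \<F>_def
  proof (subst eventually_INF_base)
    fix a b :: real assume ab: "a \<in> {0<..}" "b \<in> {0<..}"
    show "\<exists>x\<in>{0<..}. principal (N x) \<le> inf (principal (N a)) (principal (N b))"
      using ab by (intro bexI[of _ "min a b"]) (auto simp: N_def)
  qed (auto simp: eventually_principal)
  have "\<F> \<noteq> bot"
    unfolding trivial_limit_def ev using neg by (auto simp: N_def Z_def)
  then obtain U where U: "U \<le> \<F>" "ultrafilter U"
    using ultrafilter_exists by blast
  have evU: "eventually P U" if "0 < \<delta>" "\<And>w. w \<in> N \<delta> \<Longrightarrow> P w" for P \<delta>
    using filter_leD[OF U(1)] that unfolding ev by blast
  define q where "q = (\<lambda>w. Z w $ m)"
  have fU: "eventually (\<lambda>w. f (Z w) \<noteq> 0) U"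
    by (rule evU[of 1]) (auto simp: N_def)
  have q_small: "eventually (\<lambda>w. val (q w) < e) U" if "0 < e" for e
  proof -
    have sm: "smooth_fun m (\<lambda>x. u (vec m x) $ m)"
      by (rule smooth_fun_locally_analytic[OF u]) simp
    obtain \<delta> where \<delta>: "0 < \<delta>" "\<And>x. (\<And>c. c < m \<Longrightarrow> val (x c - x0 c) < \<delta>) \<Longrightarrow>
        val (u (vec m x) $ m - u (vec m x0) $ m) < e"
      using smooth_fun_continuous[OF sm \<open>0 < e\<close>, where a = x0] by blast
    show ?thesis
    proof (rule evU[OF \<delta>(1)])
      fix w assume "w \<in> N \<delta>"
      then have "val (u (vec m (\<lambda>c. x0 c + w c)) $ m - u (vec m x0) $ m) < e"
        by (intro \<delta>(2)) (auto simp: N_def)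
      moreover have "vec m (\<lambda>c. x0 c + w c) = vec m x0 + vec m w"
        by auto
      ultimately show "val (q w) < e"
        by (simp add: a q_def Z_def)
    qed
  qed
  have q_nz: "eventually (\<lambda>w. q w \<noteq> 0) U"
    using fU by eventually_elim (simp add: q_def f_nonzero_imp_near(1)[OF Z])
  have atin_U: "eventually (\<lambda>w. P (q w)) U" if P: "eventually P (atin (field_topology val) 0)" for P
  proof -
    obtain \<delta> where \<delta>: "0 < \<delta>" "\<forall>y. y \<noteq> 0 \<longrightarrow> val (y - 0) < \<delta> \<longrightarrow> P y"
      using P unfolding eventually_atin_field by blast
    show ?thesis
      using q_small[OF \<delta>(1)] q_nz by eventually_elim (use \<delta>(2) in simp)
  qed
  define approx where "approx = (\<lambda>i F C R. 0 < R \<and> gauss_le (\<lambda>_. R) m C (F 0) \<and>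
      (\<forall>\<rho> n. 0 < \<rho> \<longrightarrow> \<rho> \<le> R \<longrightarrow> gauss_le (\<lambda>_. \<rho>) m (C * (\<rho> / R) ^ Suc n) (F (Suc n) - F n)) \<and>
      (\<forall>w. (\<forall>j<m. val (w j) \<le> R) \<longrightarrow> val_tendsto (\<lambda>n. F n w) (Z w $ i) sequentially))"
  have "\<exists>F C R. approx i F C R" if i: "i \<le> m" for i
  proof -
    have "i < m + 1"
      using i by simp
    then show ?thesis
    proof (rule locally_analytic_approx[OF u vec_carrier[of m x0]])
      fix F C R
      assume "0 < R" "gauss_le (\<lambda>_. R) m C (F 0)"
        "\<And>\<rho> n. 0 < \<rho> \<Longrightarrow> \<rho> \<le> R \<Longrightarrow> gauss_le (\<lambda>_. \<rho>) m (C * (\<rho> / R) ^ Suc n) (F (Suc n) - F n)"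
        "\<And>w. (\<And>j. j < m \<Longrightarrow> val (w j) \<le> R) \<Longrightarrow>
          val_tendsto (\<lambda>n. F n w) (u (vec m x0 + vec m w) $ i) sequentially"
      then have "approx i F C R"
        unfolding approx_def Z_def by blast
      then show ?thesis
        by blast
    qed
  qed
  then obtain F C R where FCR: "\<And>i. i \<le> m \<Longrightarrow> approx i (F i) (C i) (R i)"
    by metis
  have R: "0 < R i" and C: "gauss_le (\<lambda>_. R i) m (C i) (F i 0)"
    and dF: "\<And>\<rho> n. 0 < \<rho> \<Longrightarrow> \<rho> \<le> R i \<Longrightarrow>
      gauss_le (\<lambda>_. \<rho>) m (C i * (\<rho> / R i) ^ Suc n) (F i (Suc n) - F i n)"
    and lim: "\<And>w. (\<forall>j<m. val (w j) \<le> R i) \<Longrightarrow> val_tendsto (\<lambda>n. F i n w) (Z w $ i) sequentially"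
    if "i \<le> m" for i
    using FCR[OF that] unfolding approx_def by blast+
  \<comment> \<open>Half of the least radius: the strict inequality makes
    \<open>(\<rho> / R i) ^ n\<close> tend to 0.\<close>
  define \<rho> where "\<rho> = Min (R ` {..m}) / 2"
  have "Min (R ` {..m}) \<in> R ` {..m}"
    by (rule Min_in) auto
  then have \<rho>: "0 < \<rho>" "\<And>i. i \<le> m \<Longrightarrow> \<rho> < R i"
  proof -
    assume "Min (R ` {..m}) \<in> R ` {..m}"
    then have pos: "0 < Min (R ` {..m})"
      using R by auto
    then show "0 < \<rho>"
      by (simp add: \<rho>_def)
    fix i assume "i \<le> m"
    then have "Min (R ` {..m}) \<le> R i"
      by (intro Min_le) auto
    then show "\<rho> < R i"
      unfolding \<rho>_def using pos by linarith
  qed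
  have gc: "gauss_cauchy (\<lambda>_. \<rho>) m (F i)" if i: "i \<le> m" for i
    unfolding gauss_cauchy_def
  proof (intro conjI exI allI)
    show "gauss_le (\<lambda>_. \<rho>) m (C i) (F i 0)"
      by (rule gauss_le_mono[OF _ _ order_refl C[OF i]]) (use \<rho> i in \<open>auto intro: less_imp_le\<close>)
    show "gauss_le (\<lambda>_. \<rho>) m (C i * (\<rho> / R i) ^ Suc n) (F i (Suc n) - F i n)" for n
      using dF[OF i \<rho>(1)] \<rho>(2)[OF i] by simp
    have "0 \<le> \<rho> / R i" "\<rho> / R i < 1"
      using \<rho>(1) \<rho>(2)[OF i] R[OF i] by simp_all
    then have "(\<lambda>n. (\<rho> / R i) ^ n) \<longlonglongrightarrow> 0"
      by (rule LIMSEQ_realpow_zero)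
    then have "(\<lambda>n. C i * (\<rho> / R i) ^ Suc n) \<longlonglongrightarrow> C i * 0"
      by (intro tendsto_mult tendsto_const LIMSEQ_Suc)
    then show "(\<lambda>n. C i * (\<rho> / R i) ^ Suc n) \<longlonglongrightarrow> 0"
      by simp
  qed
  have val_Z: "eventually (\<lambda>w. lim_val_at w (F i) = val (Z w $ i)) U" if i: "i \<le> m" for i
  proof (rule evU[OF \<rho>(1)])
    fix w assume w: "w \<in> N \<rho>"
    have "val_tendsto (\<lambda>n. F i n w) (Z w $ i) sequentially"
      by (rule lim[OF i]) (use w \<rho>(2)[OF i] in \<open>auto simp: N_def intro: less_imp_le less_trans\<close>)
    then show "lim_val_at w (F i) = val (Z w $ i)"
      by (intro lim_val_eqI val_tendsto_val)
  qed
  \<comment> \<open>Ordered from the largest value to the smallest: the last component, then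
    \<open>h m\<close> down to \<open>h 1\<close>. Components are numbered from 0, so for
    \<open>i > 0\<close> component \<open>m - i\<close> is compared with
    \<open>h (m + 1 - i)\<close>.\<close>
  define H where "H = (\<lambda>i y. if i = 0 then y else h (m + 1 - i) y)"
  have val_H: "eventually (\<lambda>w. lim_val_at w (F (m - i)) = val (H i (q w))) U" if i: "i \<le> m" for i
  proof (cases "i = 0")
    case True
    then show ?thesis
      using val_Z[of m] by (simp add: H_def q_def)
  next
    case False
    then have j: "m + 1 - i \<in> {1..m}" "m - i + 1 = m + 1 - i" "m - i < m"
      using i by auto
    have "eventually (\<lambda>w. lim_val_at w (F (m - i)) = val (Z w $ (m - i))) U"
      by (rule val_Z) simp
    with fU atin_U[OF h_0_less[OF j(1)]] show ?thesis
    proof eventually_elim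
      case (elim w)
      have "val (Z w $ (m - i) - h (m + 1 - i) (q w)) \<le> val (h 0 (q w))"
        using f_nonzero_imp_near(2)[OF Z elim(1) j(3)] j(2) by (simp add: q_def)
      then have "val (Z w $ (m - i)) = val (h (m + 1 - i) (q w))"
        using elim(2) by (intro val_eq_of_diff_less) linarith
      then show ?case
        using elim(3) False by (simp add: H_def)
    qed
  qed
  have H_nz: "eventually (\<lambda>w. H i (q w) \<noteq> 0) U" if i: "i \<le> m" for i
  proof (cases "i = 0")
    case False
    then have "m + 1 - i \<in> {1..m}"
      using i by auto
    from atin_U[OF h_nz[OF this]] show ?thesis
      using False by (simp add: H_def)
  qed (use q_nz in \<open>simp add: H_def\<close>)
  have H_sep: "eventually (\<lambda>w. val (H (Suc i) (q w)) \<le> val (H i (q w)) ^ n) U" if i: "i < m" for i n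
  proof (cases "i = 0")
    case True
    have "eventually (\<lambda>w. val (h m (q w)) < val (q w) ^ n \<and> q w \<noteq> 0) U"
      by (rule atin_U[OF h_m_less])
    then show ?thesis
      by eventually_elim (simp add: True H_def)
  next
    case False
    then have j: "m + 1 - i \<in> {1..m}" "m + 1 - i - 1 = m - i"
      using i by auto
    from atin_U[OF h_less[OF j(1), of n]] show ?thesis
      by eventually_elim (use False j(2) in \<open>simp add: H_def\<close>)
  qed
  show False
  proof (rule no_separated_values[OF U(2) \<rho>(1), of m "\<lambda>i. F (m - i)"])
    show "eventually (\<lambda>w. \<forall>i<m. val (w i) \<le> e) U" if "0 < e" for e
      by (rule evU[OF that]) (auto simp: N_def intro: less_imp_le)
    show "gauss_cauchy (\<lambda>_. \<rho>) m (F (m - i))" for i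
      by (rule gc) simp
    show "eventually (\<lambda>w. lim_val_at w (F (m - i)) \<noteq> 0) U" if "i \<le> m" for i
      using val_H[OF that] H_nz[OF that] by eventually_elim (simp add: val_eq_0_iff)
    show "eventually (\<lambda>w. lim_val_at w (F (m - 0)) < e) U" if "0 < e" for e
      using val_H[of 0] q_small[OF that] by (auto simp: H_def elim: eventually_elim2)
    show "eventually (\<lambda>w. lim_val_at w (F (m - Suc i)) \<le> lim_val_at w (F (m - i)) ^ n) U" if "i < m" for i n
    proof -
      have "eventually (\<lambda>w. lim_val_at w (F (m - Suc i)) = val (H (Suc i) (q w))) U"
        "eventually (\<lambda>w. lim_val_at w (F (m - i)) = val (H i (q w))) U"
        using val_H[of "Suc i"] val_H[of i] that by auto
      with H_sep[OF that, of n] show ?thesis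
        by eventually_elim simp
    qed
  qed
qed

lemma f_comp_smooth:
  fixes u :: "'k vec \<Rightarrow> 'k vec"
  assumes u: "locally_analytic val m (m + 1) u"
  shows "(\<lambda>z. vec1 (f (u z))) \<in> C_infinity val m 1"
proof (rule smooth_fun_imp_C_infinity, rule smooth_fun_local)
  fix x0 v0 and t0 :: "nat \<Rightarrow> 'k" and n
  let ?F = "point_filter m x0 v0 t0" and ?J = "{j. t0 j = 0}"
  have F: "filterlim (shift_point j) ?F ?F" "val_tendsto (step j) 0 ?F" if "j \<in> ?J" for j
    using point_filter_shift[of j m x0 t0 v0] point_filter_tendsto(3)[of j t0 m x0 v0] that by auto
  note F = F eventually_step_nonzero
  have Z: "u (vec m x) \<in> carrier_vec (m + 1)" for x
    using u by (auto simp: locally_analytic_def)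
  show "smooth_along ?F ?J n (\<lambda>(x, v, t). f (u (vec m x)))"
  proof (cases "u (vec m x0) $ m = 0")
    case True
    obtain \<delta> where \<delta>: "0 < \<delta>" "\<And>w. (\<And>c. c < m \<Longrightarrow> val (w c) < \<delta>) \<Longrightarrow> f (u (vec m x0 + vec m w)) = 0"
      using f_vanishes_near_zero_of_last[OF u True] by metis
    show ?thesis
    proof (rule smooth_cong[OF F])
      show "smooth_along ?F ?J n (\<lambda>_. 0)"
        by (rule smooth_const[OF F])
      show "eventually (\<lambda>p. 0 = (\<lambda>(x, v, t). f (u (vec m x))) p) ?F"
        unfolding eventually_point_filter
      proof (intro exI[of _ \<delta>] conjI ballI)
        fix p assume p: "p \<in> near_point m x0 v0 t0 \<delta>"
        obtain x v t where xvt: "p = (x, v, t)"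
          by (cases p)
        have "f (u (vec m x0 + vec m (\<lambda>c. x c - x0 c))) = 0"
          using p by (intro \<delta>(2)) (auto simp: xvt near_point_def)
        moreover have "vec m x0 + vec m (\<lambda>c. x c - x0 c) = vec m x"
          by auto
        ultimately show "0 = (\<lambda>(x, v, t). f (u (vec m x))) p"
          by (simp add: xvt)
      qed (rule \<delta>(1))
    qed
  next
    case False
    define P where "P = (\<lambda>i (x :: nat \<Rightarrow> 'k, v :: nat \<Rightarrow> nat \<Rightarrow> 'k, t :: nat \<Rightarrow> 'k). u (vec m x) $ i)"
    define y0 where "y0 = u (vec m x0) $ m"
    have P: "smooth_along ?F ?J n (P i)" if "i \<le> m" for i
      unfolding P_def by (rule smooth_locally_analytic[OF u]) (use that in simp)
    have hP: "smooth_along ?F ?J n (\<lambda>p. h j (P m p))" if "j \<le> m" for j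
      using smooth_compose_point_filter[OF h_smooth_fun[OF that], of m x0 v0 t0 n "\<lambda>p _. P m p"] P by simp
    have Pm: "val_tendsto (P m) y0 ?F"
      unfolding P_def y0_def
      by (rule smooth_fun_point_filter[OF smooth_fun_locally_analytic[OF u]]) simp
    have hPm: "val_tendsto (\<lambda>p. h 0 (P m p)) (h 0 y0) ?F"
      unfolding val_tendsto_iff
    proof (intro allI impI)
      fix e :: real assume "0 < e"
      then obtain \<delta> where "0 < \<delta>" and "\<And>y. val (y - y0) < \<delta> \<Longrightarrow> val (h 0 y - h 0 y0) < e"
        using h_continuous[of 0 e y0] by blast
      moreover from \<open>0 < \<delta>\<close> have "eventually (\<lambda>p. val (P m p - y0) < \<delta>) ?F"
        using Pm unfolding val_tendsto_iff by blast
      ultimately show "eventually (\<lambda>p. val (h 0 (P m p) - h 0 y0) < e) ?F"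
        by (auto elim: eventually_mono)
    qed
    have y0: "y0 \<noteq> 0" "h 0 y0 \<noteq> 0"
      using False h0_nz by (auto simp: y0_def)
    \<comment> \<open>The argument of \<open>g\<close>; the inverse is smooth because
      \<open>h 0\<close> has the nonzero limit \<open>h 0 y0\<close> here.\<close>
    define W where "W = (\<lambda>p i. (P i p - h (i + 1) (P m p)) * inverse (h 0 (P m p)))"
    have W: "smooth_along ?F ?J n (\<lambda>p. W p i)" if "i < m" for i
      unfolding W_def using that
      by (intro smooth_mult[OF F] smooth_diff[OF F] smooth_inverse[OF F _ hPm y0(2)] P hP) auto
    show ?thesis
    proof (rule smooth_cong[OF F])
      show "smooth_along ?F ?J n (\<lambda>p. g (vec m (W p)))"
        by (rule smooth_compose_point_filter[OF g_smooth_fun W])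
      show "eventually (\<lambda>p. g (vec m (W p)) = (\<lambda>(x, v, t). f (u (vec m x))) p) ?F"
        using val_tendsto_inverse(2)[OF Pm y0(1)]
      proof eventually_elim
        case (elim p)
        obtain x v t where xvt: "p = (x, v, t)"
          by (cases p)
        let ?z = "u (vec m x)"
        have nz: "?z $ m \<noteq> 0"
          using elim by (simp add: P_def xvt)
        have "f ?z = f (vec m (\<lambda>i. ?z $ i) @\<^sub>v vec1 (?z $ m))"
          using split_last[OF Z] by simp
        also have "\<dots> = g ((1 / h 0 (?z $ m)) \<cdot>\<^sub>v (vec m (\<lambda>i. ?z $ i) - vec m (\<lambda>i. h (i + 1) (?z $ m))))"
          by (rule f_eq[OF _ nz]) simp
        also have "(1 / h 0 (?z $ m)) \<cdot>\<^sub>v (vec m (\<lambda>i. ?z $ i) - vec m (\<lambda>i. h (i + 1) (?z $ m))) = vec m (W p)"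
          by (auto simp: W_def P_def xvt divide_inverse)
        finally show ?case
          by (simp add: xvt)
      qed
    qed
  qed
qed

text \<open>There is a curve tending to the origin along which the argument of \<open>g\<close> is
  constantly \<open>x\<close>. On it \<open>f\<close> keeps the nonzero value \<open>g x\<close>,
  although \<open>f\<close> vanishes at the origin.\<close>

lemma f_discontinuous:
  assumes "\<exists>x\<in>carrier_vec m. g x \<noteq> 0"
  shows "\<not> continuous_map (vec_topology val (m + 1)) (field_topology val) f"
proof
  assume cont: "continuous_map (vec_topology val (m + 1)) (field_topology val) f"
  obtain x where x: "x \<in> carrier_vec m" "g x \<noteq> 0"
    using assms by blast
  let ?F = "atin (field_topology val) (0 :: 'k)"
  \<comment> \<open>Solves the equation "argument of \<open>g\<close> equals \<open>x\<close>" for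
    the first \<open>m\<close> coordinates; it tends to 0 because all \<open>h j\<close> do.\<close>
  define X where "X = (\<lambda>y. vec m (\<lambda>i. h 0 y * x $ i + h (i + 1) y))"
  have h_lim: "val_tendsto (h j) 0 ?F" if j: "j \<le> m" for j
    unfolding val_tendsto_iff
  proof (intro allI impI)
    fix e :: real assume "0 < e"
    then obtain \<delta> where "0 < \<delta>" "\<And>y. val (y - 0) < \<delta> \<Longrightarrow> val (h j y - h j 0) < e"
      using h_continuous[OF j, of e 0] by blast
    then show "eventually (\<lambda>y. val (h j y - 0) < e) ?F"
      unfolding eventually_atin_field using h_0[OF j] by auto
  qed
  have id_lim: "val_tendsto (\<lambda>y. y) 0 ?F"
    unfolding val_tendsto_iff eventually_atin_field by auto
  have "limitin (vec_topology val (m + 1)) (\<lambda>y. X y @\<^sub>v vec1 y) (0\<^sub>v (m + 1)) ?F"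
    unfolding limitin_vec_iff
  proof (intro conjI allI impI)
    show "eventually (\<lambda>y. X y @\<^sub>v vec1 y \<in> carrier_vec (m + 1)) ?F"
      by (intro always_eventually allI append_carrier_vec) (auto simp: X_def vec1_def)
    fix i assume i: "i < m + 1"
    show "val_tendsto (\<lambda>y. (X y @\<^sub>v vec1 y) $ i) (0\<^sub>v (m + 1) $ i) ?F"
    proof (cases "i < m")
      case True
      have "val_tendsto (\<lambda>y. h 0 y * x $ i + h (i + 1) y) (0 * x $ i + 0) ?F"
        using True by (intro val_tendsto_add val_tendsto_mult val_tendsto_const h_lim) auto
      then show ?thesis
        using True by (simp add: X_def vec1_def)
    next
      case False
      then show ?thesis
        using i id_lim by (simp add: X_def vec1_def less_Suc_eq)
    qed
  qed auto
  from continuous_map_limit[OF cont this]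
  have lim: "val_tendsto (\<lambda>y. f (X y @\<^sub>v vec1 y)) (f (0\<^sub>v (m + 1))) ?F"
    by (simp add: limitin_field_iff o_def)
  have "f (0\<^sub>v (m + 1)) = 0"
  proof -
    have "0\<^sub>v (m + 1) = 0\<^sub>v m @\<^sub>v vec1 (0 :: 'k)"
      by (auto simp: vec1_def intro!: eq_vecI)
    then show ?thesis
      using f_0[of "0\<^sub>v m"] by simp
  qed
  with lim have "eventually (\<lambda>y. val (f (X y @\<^sub>v vec1 y)) < val (g x)) ?F"
    using x(2) by (simp add: val_tendsto_iff val_pos_iff)
  then obtain \<delta> where \<delta>: "0 < \<delta>" "\<And>y. y \<noteq> 0 \<Longrightarrow> val y < \<delta> \<Longrightarrow> val (f (X y @\<^sub>v vec1 y)) < val (g x)"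
    unfolding eventually_atin_field by auto
  obtain y where y: "y \<noteq> 0" "val y < \<delta>"
    using obtain_small[OF \<delta>(1)] .
  have "f (X y @\<^sub>v vec1 y) = g ((1 / h 0 y) \<cdot>\<^sub>v (X y - vec m (\<lambda>i. h (i + 1) y)))"
    by (rule f_eq[OF _ y(1)]) (simp add: X_def)
  also have "(1 / h 0 y) \<cdot>\<^sub>v (X y - vec m (\<lambda>i. h (i + 1) y)) = x"
    using x(1) h0_nz[OF y(1)] by (auto simp: X_def)
  finally show False
    using \<delta>(2)[OF y] by simp
qed

end

end

theorem theorem41:
  fixes val :: "'k::field \<Rightarrow> real"
    and m :: nat
    and h :: "nat \<Rightarrow> 'k \<Rightarrow> 'k"
    and g :: "'k vec \<Rightarrow> 'k"
    and f :: "'k vec \<Rightarrow> 'k"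
  assumes "infinite (UNIV :: 'k set)"
    and "nontrivial_nonarch_valuation val"
    and "\<And>j. j \<le> m \<Longrightarrow> (\<lambda>y. vec1 (h j (y $ 0))) \<in> C_infinity val 1 1"
    and "\<And>j. j \<le> m \<Longrightarrow> h j 0 = 0"
    and "\<And>y. y \<noteq> 0 \<Longrightarrow> h 0 y \<noteq> 0"
    and "\<And>j. j \<in> {1..m} \<Longrightarrow> \<forall>\<^sub>F y in atin (field_topology val) 0. h j y \<noteq> 0"
    and "\<And>j n :: nat. j \<in> {1..m} \<Longrightarrow>
           limitin (field_topology val) (\<lambda>y. h (j - 1) y / h j y ^ n) 0 (atin (field_topology val) 0)"
    and "\<And>n :: nat.
           limitin (field_topology val) (\<lambda>y. h m y / y ^ n) 0 (atin (field_topology val) 0)"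
    and "(\<lambda>x. vec1 (g x)) \<in> C_infinity val m 1"
    and "\<exists>x\<in>carrier_vec m. g x \<noteq> 0"
    and "\<And>x. x \<in> carrier_vec m \<Longrightarrow> max_norm val x > 1 \<Longrightarrow> g x = 0"
    and "\<And>x y. x \<in> carrier_vec m \<Longrightarrow> y \<noteq> 0 \<Longrightarrow>
           f (x @\<^sub>v vec1 y) = g ((1 / h 0 y) \<cdot>\<^sub>v (x - vec m (\<lambda>i. h (i + 1) y)))"
    and "\<And>x. x \<in> carrier_vec m \<Longrightarrow> f (x @\<^sub>v vec1 0) = 0"
  shows "(\<forall>u. locally_analytic val m (m + 1) u \<longrightarrow> (\<lambda>z. vec1 (f (u z))) \<in> C_infinity val m 1) \<and>
         \<not> continuous_map (vec_topology val (m + 1)) (field_topology val) f"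
proof -
  interpret nontrivial_nonarch_valuation val
    by fact
  note hyps = assms(3-9) assms(11-13)
  show ?thesis
    using f_comp_smooth[OF hyps] f_discontinuous[OF hyps assms(10)] by blast
qed

end
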